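(* For $n\in\mathbb N=\{0,1,2,\ldots\}$ define the polynomial $$R_n(x)=\sum_{k=0}^n\binom nk\binom{n+k}k\frac{x^k}{2k-1}\in\mathbb Z[x],\qquad R_n=R_n(1).$$ (i) Let $p\equiv1\pmod 4$ be a prime, and write $p=x^2+y^2$ with integers $x\equiv1\pmod 4$ and $y\equiv0\pmod 2$. Then $$R_{(p-1)/2}-p\equiv\sum_{k=0}^{p-1}\frac{\binom{2k}k^2}{(2k-1)(-16)^k}\equiv-2\left(\frac 2p\right)x\pmod{p^2},$$ $$R_{(p-1)/2}(-2)+2p\left(\frac 2p\right)\equiv\sum_{k=0}^{p-1}\frac{\binom{2k}k^2}{(2k-1)8^k}\equiv\left(\frac2p\right)\frac p{2x}\pmod{p^2},$$ and $$R_{(p-1)/2}\left(-\frac12\right)+\frac p2\left(\frac 2p\right)\equiv\sum_{k=0}^{p-1}\frac{\binom{2k}k^2}{(2k-1)32^k}\equiv\frac p{4x}-x\pmod{p^2}.$$ (ii) Let $p\equiv3\pmod 4$ be a prime. Then $$R_{(p-1)/2}\equiv \sum_{k=0}^{p-1}\frac{\binom{2k}k^2}{(2k-1)(-16)^k}\equiv-\frac12\left(\frac 2p\right)\binom{(p+1)/2}{(p+1)/4}\pmod p,$$ $$R_{(p-1)/2}(-2)\equiv \sum_{k=0}^{p-1}\frac{\binom{2k}k^2}{(2k-1)8^k}\equiv-\frac12\left(\frac 2p\right)\binom{(p+1)/2}{(p+1)/4}\pmod p,$$ and $$R_{(p-1)/2}\left(-\frac12\right)+\frac p2\left(\frac2p\right)\equiv\sum_{k=0}^{p-1}\frac{\binom{2k}k^2}{(2k-1)32^k}\equiv-\frac{p+1}{2^p+2}\binom{(p+1)/2}{(p+1)/4}\pmod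 {p^2}.$$
   Context: $\left(\frac{\cdot}{p}\right)$ denotes the Legendre symbol. Congruences between rational numbers whose denominators are prime to $p$ are understood in the ring of $p$-integral rationals (i.e. $a\equiv b\pmod{p^m}$ means $(a-b)/p^m$ has denominator prime to $p$). Note $(2k-1)\mid\binom{2k}k$ for all $k\in\mathbb N$, so $R_n(x)$ has integer coefficients. *)

theory Defs
  imports "HOL-Number_Theory.Number_Theory" "HOL-Computational_Algebra.Polynomial"
begin

(* snd (quotient_of a) is the positive denominator of a in lowest terms. *)
definition p_integral :: "nat \<Rightarrow> rat \<Rightarrow> bool" where
  "p_integral p a \<longleftrightarrow> coprime (snd (quotient_of a)) (int p)"

(* a == b (mod p^m) in the ring of p-integral rationals; both sides are required
   to lie in that ring. *)
definition rat_cong :: "nat \<Rightarrow> nat \<Rightarrow> rat \<Rightarrow> rat \<Rightarrow> bool" where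
  "rat_cong p m a b \<longleftrightarrow>
     p_integral p a \<and> p_integral p b \<and> p_integral p ((a - b) / of_nat p ^ m)"

(* The rational denominator 2k - 1 equals -1 at k = 0. *)
definition R :: "nat \<Rightarrow> rat poly" where
  "R n = (\<Sum>k\<le>n. monom (of_nat (n choose k) * of_nat ((n + k) choose k) / (2 * of_nat k - 1)) k)"

definition binom_sum :: "nat \<Rightarrow> rat \<Rightarrow> rat" where
  "binom_sum p m = (\<Sum>k<p. of_nat ((2 * k) choose k) ^ 2 / ((2 * of_nat k - 1) * m ^ k))"

end

theory Submission
  imports Defs "HOL-Computational_Algebra.Formal_Power_Series" Complex_Main
begin

text \<open>
  Put \<open>n = (p - 1) / 2\<close>, \<open>e\<^sub>k = binomial(2k, k) / 4\<^sup>k\<close> and \<open>d\<^sub>k = e\<^sub>k / (2k - 1)\<close>. The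
  sum with parameter \<open>m\<close> has the terms \<open>e\<^sub>k d\<^sub>k (16/m)\<^sup>k\<close>, and modulo the square of \<open>p\<close> it
  is \<open>-(P\<^sub>n\<^sub>-\<^sub>1 + 2 P\<^sub>n + P\<^sub>n\<^sub>+\<^sub>1) / 4\<close> for the Legendre polynomials at \<open>1 - 32/m\<close>.
  For \<open>m = 32\<close> the argument is \<open>0\<close>, where they have closed forms; \<open>m = 8\<close> and \<open>m = -16\<close>
  belong to the arguments \<open>-3\<close> and \<open>3\<close>, exchanged by the reflection \<open>P\<^sub>N(-z) = (-1)\<^sup>N P\<^sub>N(z)\<close>.
  At \<open>z = 3\<close> one uses that \<open>e\<^sub>n\<^sub>-\<^sub>k\<close> agrees with \<open>e\<^sub>k\<close>, and \<open>d\<^sub>n\<^sub>+\<^sub>1\<^sub>-\<^sub>k\<close> with \<open>d\<^sub>k\<close>, up to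
  sign modulo \<open>p\<close>: squares may be replaced by products of reflected terms to precision \<open>p\<^sup>2\<close>, which turns
  the sums into coefficients of \<open>(1 - x\<^sup>2)\<close> to the power \<open>-1/2\<close>. The remaining alternating sum of
  \<open>d\<^sub>k\<^sup>2\<close> is a perturbation of a terminating case of Kummer's theorem.

  The number \<open>x\<close> enters through the character sum of \<open>t\<^sup>3 - t\<close>: Jacobsthal's identity identifies it
  with \<open>2x\<close> up to sign, and expressing the Legendre symbol of \<open>u\<close> as
  \<open>(3 u\<^sup>n - u\<^sup>3\<^sup>n) / 2\<close> modulo \<open>p\<^sup>2\<close> evaluates it by binomial coefficients, which gives the
  theorem of Chowla, Dwork and Evans on \<open>binomial((p-1)/2, (p-1)/4)\<close>.
\<close>

section \<open>Congruences in the ring of \<open>p\<close>-integral rationals\<close>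

text \<open>At \<open>z = 3\<close> no closed form is at hand. Reflection makes the combinations for
  \<open>m = 8\<close> and \<open>m = -16\<close> differ only in the sign of the middle term and an
  overall sign, so the sum of the two (\<open>n\<close> even) or their difference (\<open>n\<close>
  odd) is \<open>P_n(3)\<close> up to sign; hence only \<open>P_n(3)\<close> and one of the two sums
  have to be evaluated. Precision is doubled because \<open>a = b\<close> modulo \<open>p\<close>
  gives \<open>(a - b)^2 = 0\<close> modulo \<open>p^2\<close>, so \<open>a^2 + b^2\<close> becomes
  \<open>2 a b\<close>. This needs the squares to add up under reversal. For odd \<open>n\<close>
  the reversed alternating sum has the opposite sign, the squares cancel, and only congruences
  modulo \<open>p\<close> survive, as in (ii). For \<open>m = -16\<close> and even \<open>n\<close>
  the reversal over \<open>0..n+1\<close> also changes the sign, but the weight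
  \<open>2k - 1\<close> turns into \<open>p - 2k\<close>; the two weights fail to match by a
  constant, and this is how the alternating sum of \<open>d_k^2\<close> arises. The cubic
  \<open>(3 s - s^3) / 2\<close> fixes \<open>1\<close> and \<open>-1\<close> with derivative 0, so
  it squares the error of Euler's criterion.\<close>

locale prime_modulus =
  fixes p :: nat
  assumes prime_p: "prime p"
begin

definition Zp :: "rat set" where
  "Zp = {a. p_integral p a}"

text \<open>Makes integrality independent of lowest terms: the reduced denominator divides the
  denominator of every other representation.\<close>

lemma Zp_iff: "a \<in> Zp \<longleftrightarrow> (\<exists>u v. a = of_int u / of_int v \<and> \<not> int p dvd v)"
proof
  assume "a \<in> Zp"
  then have "coprime (snd (quotient_of a)) (int p)"
    by (simp add: Zp_def p_integral_def)
  moreover have "\<not> is_unit (int p)"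
    using prime_p by (auto simp: prime_nat_iff)
  ultimately have "\<not> int p dvd snd (quotient_of a)"
    by (metis coprime_common_divisor dvd_refl)
  then show "\<exists>u v. a = of_int u / of_int v \<and> \<not> int p dvd v"
    by (metis quotient_of_div surjective_pairing)
next
  assume "\<exists>u v. a = of_int u / of_int v \<and> \<not> int p dvd v"
  then obtain u v where uv: "a = of_int u / of_int v" "\<not> int p dvd v" by blast
  then have v0: "v \<noteq> 0" by auto
  obtain r s where rs: "quotient_of a = (r, s)" by fastforce
  then have s0: "s > 0" and cop: "coprime r s" and a: "a = of_int r / of_int s"
    using quotient_of_denom_pos quotient_of_coprime quotient_of_div by auto
  have "(of_int (r * v) :: rat) = of_int (u * s)"
    using a uv(1) v0 s0 by (simp add: field_simps)
  then have "r * v = u * s" by (simp only: of_int_eq_iff)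
  then have "s dvd v"
    by (metis cop coprime_commute coprime_dvd_mult_right_iff dvd_triv_right)
  then have "\<not> int p dvd s"
    using uv(2) dvd_trans by blast
  then have "coprime s (int p)"
    using prime_p by (metis coprime_commute prime_imp_coprime prime_nat_int_transfer)
  then show "a \<in> Zp"
    by (simp add: Zp_def p_integral_def rs)
qed

lemma Zp_of_int [simp, intro]: "of_int k \<in> Zp"
  unfolding Zp_iff using prime_p
  by (intro exI[of _ k] exI[of _ 1]) (auto simp: prime_nat_iff)

lemma Zp_of_nat [simp, intro]: "of_nat k \<in> Zp"
  using Zp_of_int[of "int k"] by simp

lemma Zp_numeral [simp, intro]: "numeral k \<in> Zp" "0 \<in> Zp" "1 \<in> Zp"
  using Zp_of_int[of "numeral k"] Zp_of_int[of 0] Zp_of_int[of 1] by simp_all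

lemma prime_int_p: "prime (int p)"
  using prime_p by simp

lemma Zp_add [simp, intro]: "a \<in> Zp \<Longrightarrow> b \<in> Zp \<Longrightarrow> a + b \<in> Zp"
proof -
  assume "a \<in> Zp" "b \<in> Zp"
  then obtain u v u' v' where "a = of_int u / of_int v" "\<not> int p dvd v"
      "b = of_int u' / of_int v'" "\<not> int p dvd v'"
    unfolding Zp_iff by blast
  moreover from this have "v \<noteq> 0" "v' \<noteq> 0" by auto
  ultimately have "a + b = of_int (u * v' + u' * v) / of_int (v * v')" "\<not> int p dvd v * v'"
    using prime_int_p by (simp_all add: add_frac_eq prime_dvd_mult_iff)
  then show ?thesis unfolding Zp_iff by blast
qed

lemma Zp_mult [simp, intro]: "a \<in> Zp \<Longrightarrow> b \<in> Zp \<Longrightarrow> a * b \<in> Zp"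
proof -
  assume "a \<in> Zp" "b \<in> Zp"
  then obtain u v u' v' where "a = of_int u / of_int v" "\<not> int p dvd v"
      "b = of_int u' / of_int v'" "\<not> int p dvd v'"
    unfolding Zp_iff by blast
  then show ?thesis
    unfolding Zp_iff using prime_int_p
    by (intro exI[of _ "u * u'"] exI[of _ "v * v'"]) (auto simp: prime_dvd_mult_iff)
qed

lemma Zp_uminus [simp, intro]: "a \<in> Zp \<Longrightarrow> - a \<in> Zp"
  using Zp_mult[of "-1" a] Zp_of_int[of "-1"] by simp

lemma Zp_diff [simp, intro]: "a \<in> Zp \<Longrightarrow> b \<in> Zp \<Longrightarrow> a - b \<in> Zp"
  using Zp_add[of a "- b"] by simp

lemma Zp_power [simp, intro]: "a \<in> Zp \<Longrightarrow> a ^ k \<in> Zp"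
  by (induction k) auto

lemma Zp_sum [intro]: "(\<And>i. i \<in> S \<Longrightarrow> f i \<in> Zp) \<Longrightarrow> sum f S \<in> Zp"
  by (induction S rule: infinite_finite_induct) auto

lemma Zp_prod [intro]: "(\<And>i. i \<in> S \<Longrightarrow> f i \<in> Zp) \<Longrightarrow> prod f S \<in> Zp"
  by (induction S rule: infinite_finite_induct) auto

text \<open>The units of the local ring. The condition \<open>a \<noteq> 0\<close> keeps out 0,
  whose \<open>inverse\<close> is 0 by convention.\<close>

definition Up :: "rat set" where
  "Up = {a \<in> Zp. a \<noteq> 0 \<and> inverse a \<in> Zp}"

lemma UpD: "a \<in> Up \<Longrightarrow> a \<in> Zp" "a \<in> Up \<Longrightarrow> a \<noteq> 0" "a \<in> Up \<Longrightarrow> inverse a \<in> Zp"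
  by (auto simp: Up_def)

lemma Zp_divide [simp, intro]: "a \<in> Zp \<Longrightarrow> b \<in> Up \<Longrightarrow> a / b \<in> Zp"
  by (simp add: divide_inverse UpD)

lemma Up_of_int: "\<not> int p dvd k \<Longrightarrow> of_int k \<in> Up"
proof -
  assume *: "\<not> int p dvd k"
  then have "k \<noteq> 0" by auto
  moreover have "inverse (of_int k) \<in> Zp"
    unfolding Zp_iff using * by (intro exI[of _ 1] exI[of _ k]) (auto simp: divide_inverse)
  ultimately show ?thesis by (auto simp: Up_def)
qed

lemma Up_of_nat: "\<not> p dvd k \<Longrightarrow> of_nat k \<in> Up"
  using Up_of_int[of "int k"] by simp

lemma Up_mult [simp, intro]: "a \<in> Up \<Longrightarrow> b \<in> Up \<Longrightarrow> a * b \<in> Up"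
  by (auto simp: Up_def)

lemma Up_inverse [simp, intro]: "a \<in> Up \<Longrightarrow> inverse a \<in> Up"
  by (auto simp: Up_def)

lemma Up_divide [simp, intro]: "a \<in> Up \<Longrightarrow> b \<in> Up \<Longrightarrow> a / b \<in> Up"
  by (simp add: divide_inverse)

lemma Up_1 [simp, intro]: "1 \<in> Up"
  by (auto simp: Up_def)

lemma Up_uminus [simp, intro]: "a \<in> Up \<Longrightarrow> - a \<in> Up"
  by (auto simp: Up_def)

lemma Up_power [simp, intro]: "a \<in> Up \<Longrightarrow> a ^ k \<in> Up"
  by (induction k) auto

text \<open>Unlike \<open>rat_cong\<close>, this asks for integrality of neither side, so additive
  steps carry no side conditions; \<open>rat_congI\<close> restores it at the end.\<close>

definition pcong :: "nat \<Rightarrow> rat \<Rightarrow> rat \<Rightarrow> bool" where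
  "pcong m a b \<longleftrightarrow> (\<exists>z\<in>Zp. a = b + of_nat p ^ m * z)"

lemma p_nonzero [simp]: "p \<noteq> 0" "(of_nat p :: rat) \<noteq> 0" "p > 0"
  using prime_p by (auto simp: prime_gt_0_nat)

lemma pcong_iff: "pcong m a b \<longleftrightarrow> (a - b) / of_nat p ^ m \<in> Zp"
  unfolding pcong_def
  by (auto simp: field_simps intro!: bexI[of _ "(a - b) / of_nat p ^ m"])

lemma pcongI: "a - b = of_nat p ^ m * z \<Longrightarrow> z \<in> Zp \<Longrightarrow> pcong m a b"
  unfolding pcong_def by (auto simp: algebra_simps)

lemma pcong_refl [simp, intro]: "pcong m a a"
  by (simp add: pcong_iff)

lemma pcong_sym: "pcong m a b \<Longrightarrow> pcong m b a"
  unfolding pcong_iff using Zp_uminus[of "(a - b) / of_nat p ^ m"] by (simp add: minus_divide_left)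

lemma pcong_trans [trans]: "pcong m a b \<Longrightarrow> pcong m b c \<Longrightarrow> pcong m a c"
  unfolding pcong_iff using Zp_add[of "(a - b) / of_nat p ^ m" "(b - c) / of_nat p ^ m"]
  by (simp add: add_divide_distrib[symmetric])

lemma pcong_add: "pcong m a b \<Longrightarrow> pcong m a' b' \<Longrightarrow> pcong m (a + a') (b + b')"
  unfolding pcong_iff using Zp_add[of "(a - b) / of_nat p ^ m" "(a' - b') / of_nat p ^ m"]
  by (simp add: add_divide_distrib[symmetric] algebra_simps)

lemma pcong_uminus: "pcong m a b \<Longrightarrow> pcong m (- a) (- b)"
  unfolding pcong_iff using Zp_uminus[of "(a - b) / of_nat p ^ m"]
  by (simp add: minus_divide_left)

lemma pcong_diff: "pcong m a b \<Longrightarrow> pcong m a' b' \<Longrightarrow> pcong m (a - a') (b - b')"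
  using pcong_add[of m a b "- a'" "- b'"] pcong_uminus by simp

lemma pcong_mult_left: "pcong m a b \<Longrightarrow> c \<in> Zp \<Longrightarrow> pcong m (c * a) (c * b)"
  unfolding pcong_iff using Zp_mult[of c "(a - b) / of_nat p ^ m"]
  by (simp add: right_diff_distrib)

lemma pcong_mult_right: "pcong m a b \<Longrightarrow> c \<in> Zp \<Longrightarrow> pcong m (a * c) (b * c)"
  using pcong_mult_left[of m a b c] by (simp add: mult.commute)

lemma pcong_mult: "pcong m a b \<Longrightarrow> pcong m a' b' \<Longrightarrow> a' \<in> Zp \<Longrightarrow> b \<in> Zp \<Longrightarrow> pcong m (a * a') (b * b')"
  using pcong_mult_right[of m a b a'] pcong_mult_left[of m a' b' b] pcong_trans by blast

lemma pcong_Zp: "pcong m a b \<Longrightarrow> a \<in> Zp \<longleftrightarrow> b \<in> Zp"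
  unfolding pcong_def
proof (elim bexE)
  fix z assume z: "z \<in> Zp" and a: "a = b + of_nat p ^ m * z"
  then have "of_nat p ^ m * z \<in> Zp" by auto
  then show ?thesis using a Zp_add Zp_diff[of a "of_nat p ^ m * z"] by auto
qed

lemma pcong_power: "pcong m a b \<Longrightarrow> a \<in> Zp \<Longrightarrow> pcong m (a ^ k) (b ^ k)"
  by (induction k) (auto intro!: pcong_mult simp: pcong_Zp)

lemma pcong_sum: "(\<And>i. i \<in> S \<Longrightarrow> pcong m (f i) (g i)) \<Longrightarrow> pcong m (sum f S) (sum g S)"
  by (induction S rule: infinite_finite_induct) (auto intro: pcong_add)

lemma pcong_prod:
  assumes "\<And>i. i \<in> S \<Longrightarrow> pcong m (f i) (g i)" "\<And>i. i \<in> S \<Longrightarrow> f i \<in> Zp"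
  shows "pcong m (prod f S) (prod g S)"
  using assms
proof (induction S rule: infinite_finite_induct)
  case (insert x F)
  have "f x \<in> Zp" "pcong m (f x) (g x)"
    using insert.prems by auto
  then have "g x \<in> Zp" using pcong_Zp by blast
  then show ?case using insert by (auto intro!: pcong_mult Zp_prod)
qed auto

lemma pcong_mono: "pcong m a b \<Longrightarrow> k \<le> m \<Longrightarrow> pcong k a b"
proof -
  assume "pcong m a b" "k \<le> m"
  then obtain z where z: "z \<in> Zp" "a = b + of_nat p ^ m * z" by (auto simp: pcong_def)
  then have "a - b = of_nat p ^ k * (of_nat p ^ (m - k) * z)"
    using \<open>k \<le> m\<close> by (simp add: power_add[symmetric] mult.assoc[symmetric])
  then show ?thesis using z(1) by (auto intro: pcongI)
qed

lemma pcong_p_mult: "pcong m a b \<Longrightarrow> pcong (Suc m) (of_nat p * a) (of_nat p * b)"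
  unfolding pcong_def by (auto simp: algebra_simps)

text \<open>Orders of vanishing add. With \<open>k = m = 1\<close> this lifts a reflection known
  modulo \<open>p\<close> to precision \<open>p ^ 2\<close>.\<close>

lemma pcong_mult_mult:
  "pcong k a 0 \<Longrightarrow> pcong m b 0 \<Longrightarrow> pcong (k + m) (a * b) 0"
  unfolding pcong_def by (fastforce simp: power_add intro: Zp_mult)

lemma pcong_0_iff: "pcong m a b \<longleftrightarrow> pcong m (a - b) 0"
  by (simp add: pcong_iff)

lemma pcong_p_0: "z \<in> Zp \<Longrightarrow> pcong (Suc 0) (of_nat p * z) 0"
  by (auto simp: pcong_def)

text \<open>Invertibility depends only on the residue modulo \<open>p\<close>: the quotient
  \<open>b / a\<close> is 1 minus a multiple of \<open>p\<close>, so its numerator is prime to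
  \<open>p\<close>.\<close>

lemma Up_pcong: "pcong (Suc m) a b \<Longrightarrow> a \<in> Up \<Longrightarrow> b \<in> Up"
proof -
  assume *: "pcong (Suc m) a b" and a: "a \<in> Up"
  have b: "b \<in> Zp" using * a pcong_Zp UpD by blast
  have "pcong 1 a b" using * by (rule pcong_mono) simp
  then obtain z where z: "z \<in> Zp" "a = b + of_nat p * z" by (auto simp: pcong_def)
  define w where "w = b / a"
  have w: "w \<in> Zp" "w = 1 - of_nat p * (z / a)"
    using a b z by (auto simp: w_def field_simps UpD(2))
  obtain u v where uv: "z / a = of_int u / of_int v" "\<not> int p dvd v"
    using Zp_divide[OF z(1) a] Zp_iff by auto
  have "w = of_int (v - int p * u) / of_int v"
    using uv(2) unfolding w(2) uv(1) by (cases "v = 0") (simp_all add: field_simps)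
  moreover have "\<not> int p dvd v - int p * u"
    using uv(2) by (metis dvd_triv_left dvd_diff_left_iff)
  ultimately have "w \<in> Up"
    using Up_divide[OF Up_of_int Up_of_int] uv(2) by metis
  then have "w * a \<in> Up" using a by auto
  then show ?thesis using a by (simp add: w_def UpD)
qed

lemma pcong_divide:
  assumes "pcong m a b" "pcong m c d" "a \<in> Zp" "c \<in> Up" "d \<in> Up"
  shows "pcong m (a / c) (b / d)"
proof -
  have b: "b \<in> Zp" using assms pcong_Zp by blast
  have "pcong m (a * d) (b * c)"
    using assms b by (intro pcong_mult pcong_sym[of m c d]) (auto simp: UpD)
  then have "pcong m (inverse (c * d) * (a * d)) (inverse (c * d) * (b * c))"
    using assms by (intro pcong_mult_left) (auto simp: UpD simp del: inverse_mult_distrib)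
  then show ?thesis using assms by (simp add: field_simps UpD)
qed

lemma pcong_cancel:
  assumes "pcong m (c * a) (c * b)" "c \<in> Up"
  shows "pcong m a b"
  using pcong_mult_left[OF assms(1), of "inverse c"] assms(2) by (simp add: UpD mult.assoc[symmetric])

lemma pcong_of_int: "[a = b] (mod int p ^ m) \<Longrightarrow> pcong m (of_int a) (of_int b)"
proof -
  assume "[a = b] (mod int p ^ m)"
  then obtain k where "a - b = int p ^ m * k"
    by (auto simp: cong_iff_dvd_diff dvd_def)
  then have "(of_int a - of_int b :: rat) = of_nat p ^ m * of_int k"
    by (metis of_int_diff of_int_mult of_int_of_nat_eq of_int_power)
  then show ?thesis by (auto intro: pcongI)
qed

lemma pcong_of_int_iff: "pcong 1 (of_int a) (of_int b) \<longleftrightarrow> [a = b] (mod int p)"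
proof
  assume "pcong 1 (of_int a) (of_int b)"
  then obtain z where z: "z \<in> Zp" "of_int a = of_int b + of_nat p * z" by (auto simp: pcong_def)
  then obtain u v where uv: "z = of_int u / of_int v" "\<not> int p dvd v" unfolding Zp_iff by blast
  then have "(of_int ((a - b) * v) :: rat) = of_int (int p * u)"
    using z(2) by (auto simp: field_simps)
  then have "(a - b) * v = int p * u" by (simp only: of_int_eq_iff)
  then have "int p dvd a - b"
    using uv(2) prime_int_p by (metis dvd_triv_left prime_dvd_mult_iff)
  then show "[a = b] (mod int p)" by (simp add: cong_iff_dvd_diff)
qed (use pcong_of_int[of a b 1] in simp)

lemma rat_cong_iff: "rat_cong p m a b \<longleftrightarrow> a \<in> Zp \<and> b \<in> Zp \<and> pcong m a b"
  by (auto simp: rat_cong_def pcong_iff Zp_def)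

lemma rat_congI: "pcong m a b \<Longrightarrow> b \<in> Zp \<Longrightarrow> rat_cong p m a b"
  using pcong_Zp by (auto simp: rat_cong_iff)

end

section \<open>Central binomial coefficients and Legendre polynomials\<close>

text \<open>The coefficient of \<open>x ^ k\<close> in (1 - x)^(-1/2).\<close>

definition cbin :: "nat \<Rightarrow> rat" where
  "cbin k = of_nat ((2 * k) choose k) / 4 ^ k"

lemma central_binomial_Suc: "Suc k * ((2 * Suc k) choose Suc k) = 2 * (2 * k + 1) * ((2 * k) choose k)"
proof -
  have "Suc k * (Suc (Suc (2 * k)) choose Suc k) = Suc (Suc (2 * k)) * (Suc (2 * k) choose k)"
    by (rule Suc_times_binomial)
  moreover have "Suc k * (Suc (2 * k) choose k) = Suc (2 * k) * ((2 * k) choose k)"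
    using binomial_absorb_comp[of "Suc (2 * k)" k] by (simp add: Suc_diff_le)
  ultimately have "Suc k * (Suc k * (Suc (Suc (2 * k)) choose Suc k))
      = Suc k * (2 * (2 * k + 1) * ((2 * k) choose k))"
    by (simp add: algebra_simps)
  then show ?thesis
    by (simp only: mult_Suc_right mult_cancel1) simp
qed

lemma cbin_0 [simp]: "cbin 0 = 1"
  by (simp add: cbin_def)

lemma cbin_Suc: "cbin (Suc k) = cbin k * (2 * of_nat k + 1) / (2 * of_nat k + 2)"
proof -
  have *: "(of_nat k + 1 :: rat) * of_nat ((2 * Suc k) choose Suc k) = 2 * (2 * of_nat k + 1) * of_nat ((2 * k) choose k)"
    using central_binomial_Suc[of k, THEN arg_cong[where f = "of_nat :: nat \<Rightarrow> rat"]]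
    by (simp only: of_nat_mult of_nat_Suc of_nat_add of_nat_numeral of_nat_1) (simp only: ac_simps)
  have "b = 4 * (2 * x + 1) * a / (2 * x + 2)" if "(x + 1) * b = 2 * (2 * x + 1) * a" "x + 1 \<noteq> 0" for a b x :: rat
  proof -
    have "2 * x + 2 \<noteq> 0" using that(2) by (metis distrib_left mult_2 mult_eq_0_iff one_add_one zero_neq_numeral mult.right_neutral)
    moreover have "b * (2 * x + 2) = 2 * ((x + 1) * b)" by (simp add: algebra_simps)
    ultimately show ?thesis using that(1) by (simp add: nonzero_eq_divide_eq)
  qed
  from this[OF *] have "of_nat ((2 * Suc k) choose Suc k) = 4 * (2 * of_nat k + 1) * of_nat ((2 * k) choose k) / (2 * of_nat k + (2::rat))"
    by (metis of_nat_Suc of_nat_eq_0_iff nat.simps(3) add.commute)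
  moreover have "4 * u * a / w / (4 * q) = a / q * u / w" for a q u w :: rat
    by (simp add: ac_simps)
  ultimately show ?thesis
    unfolding cbin_def power_Suc by (simp only:)
qed

lemma cbin_gbinomial: "cbin k = (- 1) ^ k * ((- 1 / 2) gchoose k)"
proof (induction k)
  case (Suc k)
  have "of_nat (Suc k) * ((- 1 / 2 :: rat) gchoose Suc k) = (- 1 / 2 - of_nat k) * ((- 1 / 2) gchoose k)"
    using gbinomial_mult_1[of "- 1 / 2 :: rat" k] by (simp add: algebra_simps)
  moreover have "s * g * (2 * x + 1) / (2 * x + 2) = - 1 * s * g'"
    if "(x + 1) * g' = (- 1 / 2 - x) * g" "x + 1 \<noteq> 0" for s g g' x :: rat
  proof -
    have e1: "g' = (- 1 / 2 - x) * g / (x + 1)"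
      using that by (simp add: nonzero_eq_divide_eq mult.commute)
    have e2: "2 * x + 2 = 2 * (x + 1)" and e3: "(- 1 / 2 - x) = - (2 * x + 1) / 2"
      by (simp_all add: field_simps)
    have "s * g * h / (2 * w) = - 1 * s * (- h / 2 * g / w)" for h w
      by (simp add: ac_simps)
    then show ?thesis unfolding e1 e2 e3 by (simp only:)
  qed
  ultimately show ?case
    unfolding cbin_Suc Suc power_Suc by (metis of_nat_Suc of_nat_eq_0_iff nat.simps(3) add.commute)
qed simp

text \<open>Compares coefficients in (1 + x)^(-1/2) (1 - x)^(-1/2) = (1 - x^2)^(-1/2). The two sides
  are seen to have equal squares, and the constant terms decide the sign.\<close>

lemma cbin_convolution_alternating:
  "(\<Sum>k\<le>N. (- 1) ^ k * cbin k * cbin (N - k)) = (if even N then cbin (N div 2) else 0)"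
proof -
  define E where "E = Abs_fps cbin"
  define F where "F = fps_binomial (- 1 / 2 :: rat)"
  define H where "H = E oo fps_X\<^sup>2"
  have E2: "E\<^sup>2 * (1 - fps_X) = 1"
  proof -
    have "(\<Sum>i = 0..k. cbin i * cbin (k - i)) = 1" for k
    proof -
      have "(\<Sum>i = 0..k. cbin i * cbin (k - i)) = (\<Sum>i\<le>k. (- 1) ^ k * (((- 1 / 2) gchoose i) * ((- 1 / 2) gchoose (k - i))))"
        by (rule sum.cong) (auto simp: cbin_gbinomial power_add[symmetric])
      also have "\<dots> = (- 1) ^ k * ((- 1 / 2 + - 1 / 2) gchoose k)"
        by (simp only: sum_distrib_left[symmetric] atMost_atLeast0 gbinomial_Vandermonde)
      also have "\<dots> = 1"
        using gbinomial_minus[of "1 :: rat" k]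
        by (simp add: binomial_gbinomial[symmetric] power_mult_distrib[symmetric])
      finally show ?thesis .
    qed
    then have "E\<^sup>2 = Abs_fps (\<lambda>_. 1)"
      by (intro fps_ext) (simp add: E_def power2_eq_square fps_mult_nth)
    then show ?thesis
      using inverse_mult_eq_1'[of "Abs_fps (\<lambda>_. 1 :: rat)"] by (simp add: fps_inverse_gp')
  qed
  have F2: "F\<^sup>2 * (1 + fps_X) = 1"
  proof -
    have "F\<^sup>2 = inverse (1 + fps_X)"
      unfolding F_def power2_eq_square fps_binomial_add_mult[symmetric] by (simp add: fps_binomial_minus_one)
    then show ?thesis by (simp add: inverse_mult_eq_1)
  qed
  have "H\<^sup>2 * (1 - fps_X\<^sup>2) = (E\<^sup>2 * (1 - fps_X)) oo fps_X\<^sup>2"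
    unfolding H_def by (simp add: fps_compose_mult_distrib fps_compose_sub_distrib power2_eq_square)
  then have H2: "H\<^sup>2 * (1 - fps_X\<^sup>2) = 1" by (simp add: E2)
  have "(F * E)\<^sup>2 * (1 - fps_X\<^sup>2) = (F\<^sup>2 * (1 + fps_X)) * (E\<^sup>2 * (1 - fps_X))"
    by (simp add: power2_eq_square algebra_simps)
  then have "(F * E)\<^sup>2 * (1 - fps_X\<^sup>2) = H\<^sup>2 * (1 - fps_X\<^sup>2)" by (simp add: E2 F2 H2)
  then have "(F * E)\<^sup>2 = H\<^sup>2" using H2 by (metis mult_cancel_right mult_zero_right zero_neq_one)
  then have "F * E = H \<or> F * E = - H" by (simp add: power2_eq_iff)
  moreover have "fps_nth (F * E) 0 = 1" "fps_nth H 0 = 1" by (simp_all add: F_def E_def H_def)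
  ultimately have "F * E = H" by (metis fps_neg_nth neg_equal_iff_equal one_neq_neg_one)
  then have "fps_nth (F * E) N = fps_nth H N" by simp
  moreover have "fps_nth (F * E) N = (\<Sum>k\<le>N. (- 1) ^ k * cbin k * cbin (N - k))"
    by (auto simp: F_def E_def fps_mult_nth cbin_gbinomial atMost_atLeast0 mult.assoc[symmetric] power_mult_distrib[symmetric] intro!: sum.cong)
  moreover have "fps_nth H N = (if even N then cbin (N div 2) else 0)"
  proof -
    have "fps_nth H N = (\<Sum>i = 0..N. cbin i * (if 2 * i = N then 1 else 0))"
      unfolding H_def E_def fps_compose_nth power_mult[symmetric] fps_X_power_nth
      by (intro sum.cong) auto
    also have "\<dots> = (\<Sum>i\<in>(if even N then {N div 2} else {}). cbin i)"
      by (rule sum.mono_neutral_cong_right) (auto split: if_splits)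
    finally show ?thesis by auto
  qed
  ultimately show ?thesis by simp
qed

text \<open>The coefficient of \<open>x ^ k\<close> in -(1 - x)^(1/2).\<close>

definition dbin :: "nat \<Rightarrow> rat" where
  "dbin k = cbin k / (2 * of_nat k - 1)"

lemma two_of_nat_minus_1_nonzero: "2 * of_nat k - 1 \<noteq> (0 :: rat)"
proof -
  have "(2 * of_nat k - 1 :: rat) = of_int (2 * int k - 1)" by simp
  moreover have "2 * int k - 1 \<noteq> 0" by presburger
  ultimately show ?thesis by (metis of_int_eq_0_iff)
qed

lemma cbin_dbin: "cbin k = (2 * of_nat k - 1) * dbin k"
  using two_of_nat_minus_1_nonzero[of k] by (simp add: dbin_def)

lemma dbin_0 [simp]: "dbin 0 = - 1"
  by (simp add: dbin_def)

lemma dbin_Suc: "dbin (Suc k) = cbin k / (2 * of_nat k + 2)"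
proof -
  have "2 * of_nat k + 1 \<noteq> (0 :: rat)"
    using two_of_nat_minus_1_nonzero[of "Suc k"] by simp
  then show ?thesis
    unfolding dbin_def cbin_Suc by (simp add: ac_simps add_divide_distrib)
qed

lemma two_of_nat_plus_2_nonzero: "2 * of_nat k + 2 \<noteq> (0 :: rat)"
  by (metis of_nat_Suc of_nat_eq_0_iff nat.simps(3) add.commute distrib_left mult_eq_0_iff
      mult.right_neutral zero_neq_numeral)

lemma dbin_Suc_rec: "dbin (Suc k) * (2 * of_nat k + 2) = dbin k * (2 * of_nat k - 1)"
  using two_of_nat_plus_2_nonzero by (simp add: dbin_Suc cbin_dbin)

text \<open>The coefficient form of -(1 - x)^(1/2) = (x - 1) (1 - x)^(-1/2); it reduces convolutions
  with \<open>dbin\<close> to convolutions of \<open>cbin\<close>, and later gives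
  integrality.\<close>

lemma dbin_Suc_diff: "dbin (Suc k) = cbin k - cbin (Suc k)"
proof -
  have *: "y / w = y - y * u / w" if "u = w - 1" "w \<noteq> 0" for y u w :: rat
    using that(2) unfolding that(1) by (simp add: right_diff_distrib diff_divide_distrib)
  show ?thesis
    unfolding dbin_Suc cbin_Suc by (rule *[OF _ two_of_nat_plus_2_nonzero]) simp
qed

text \<open>The generating function is -(1 + x)^(1/2) (1 - x)^(-1/2) = -(1 + x) (1 - x^2)^(-1/2),
  whose coefficients at \<open>2 m\<close> and \<open>2 m + 1\<close> coincide.\<close>

lemma dbin_cbin_convolution_alternating:
  "(\<Sum>k\<le>N. (- 1) ^ k * dbin k * cbin (N - k)) = - cbin (N div 2)"
proof (cases N)
  case (Suc M)
  have "(\<Sum>k\<le>Suc M. (- 1) ^ k * dbin k * cbin (Suc M - k))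
      = - cbin (Suc M) + (\<Sum>k\<le>M. (- 1) ^ Suc k * (cbin k - cbin (Suc k)) * cbin (M - k))"
    by (subst sum.atMost_Suc_shift) (simp add: dbin_Suc_diff)
  also have "\<dots> = - cbin (Suc M) - (\<Sum>k\<le>M. (- 1) ^ k * cbin k * cbin (M - k))
      - (\<Sum>k\<le>M. (- 1) ^ Suc k * cbin (Suc k) * cbin (Suc M - Suc k))"
  proof -
    have "(\<Sum>k\<le>M. (- 1) ^ Suc k * (cbin k - cbin (Suc k)) * cbin (M - k))
        = (\<Sum>k\<le>M. - ((- 1) ^ k * cbin k * cbin (M - k)) - (- 1) ^ Suc k * cbin (Suc k) * cbin (Suc M - Suc k))"
      by (intro sum.cong refl) (simp add: algebra_simps)
    then show ?thesis by (simp only: sum_subtractf sum_negf)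
  qed
  also have "\<dots> = - (\<Sum>k\<le>M. (- 1) ^ k * cbin k * cbin (M - k))
      - (\<Sum>k\<le>Suc M. (- 1) ^ k * cbin k * cbin (Suc M - k))"
    by (subst sum.atMost_Suc_shift) simp
  also have "\<dots> = - cbin (Suc M div 2)"
    unfolding cbin_convolution_alternating by auto
  finally show ?thesis using Suc by simp
qed simp

section \<open>Legendre polynomials: recurrence, reflection, values at 0\<close>

definition leg :: "nat \<Rightarrow> nat \<Rightarrow> rat" where
  "leg N k = of_nat (N choose k) * of_nat ((N + k) choose k)"

text \<open>\<open>legP N x\<close> is the Legendre polynomial of degree \<open>N\<close> at \<open>1 + 2 * x\<close>.\<close>
definition legP :: "nat \<Rightarrow> rat \<Rightarrow> rat" where
  "legP N x = (\<Sum>k\<le>N. leg N k * x ^ k)"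

lemma leg_0 [simp]: "leg N 0 = 1"
  by (simp add: leg_def)

lemma leg_eq_0: "N < k \<Longrightarrow> leg N k = 0"
  by (simp add: leg_def)

lemma Suc_times_choose_Suc: "Suc k * (N choose Suc k) = (N - k) * (N choose k)"
  by (simp only: binomial_absorption binomial_absorb_comp)

lemma leg_Suc_right: "leg N (Suc k) * of_nat (Suc k) ^ 2 = leg N k * (of_nat N - of_nat k) * (of_nat N + of_nat k + 1)"
proof (cases "k \<le> N")
  case True
  have "Suc k * (N choose Suc k) = (N choose k) * (N - k)"
    by (simp only: Suc_times_choose_Suc mult.commute[of "N - k"])
  moreover have "Suc k * ((N + Suc k) choose Suc k) = (N + k + 1) * ((N + k) choose k)"
    using Suc_times_binomial[of k "N + k"] by simp
  ultimately have "(Suc k * (N choose Suc k)) * (Suc k * ((N + Suc k) choose Suc k))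
     = ((N choose k) * (N - k)) * ((N + k + 1) * ((N + k) choose k))" by simp
  then have "rat_of_nat ((Suc k * (N choose Suc k)) * (Suc k * ((N + Suc k) choose Suc k)))
     = of_nat (((N choose k) * (N - k)) * ((N + k + 1) * ((N + k) choose k)))" by simp
  then show ?thesis
    using True unfolding leg_def of_nat_mult power2_eq_square by (simp add: of_nat_diff ac_simps)
qed (simp add: leg_eq_0)

lemma leg_Suc_left: "leg (Suc N) k * (of_nat N + 1 - of_nat k) = leg N k * (of_nat N + 1 + of_nat k)"
proof (cases "k \<le> N")
  case True
  have "(Suc N choose k) * (Suc N - k) = Suc N * (N choose k)"
    using binomial_absorb_comp[of "Suc N" k] by (simp add: mult.commute)
  moreover have "((Suc N + k) choose k) * Suc N = (Suc N + k) * ((N + k) choose k)"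
    using binomial_absorb_comp[of "Suc N + k" k] by (simp add: mult.commute)
  ultimately have "(Suc N choose k) * (Suc N - k) * (((Suc N + k) choose k) * Suc N) = 
     Suc N * (N choose k) * ((Suc N + k) * ((N + k) choose k))" by simp
  then have "Suc N * ((Suc N choose k) * (Suc N - k) * ((Suc N + k) choose k)) = 
     Suc N * ((N choose k) * ((Suc N + k) * ((N + k) choose k)))" by (simp only: ac_simps)
  then have "(Suc N choose k) * (Suc N - k) * ((Suc N + k) choose k) = 
     (N choose k) * ((Suc N + k) * ((N + k) choose k))" by (metis mult_cancel1 nat.simps(3))
  then have "rat_of_nat ((Suc N choose k) * (Suc N - k) * ((Suc N + k) choose k)) = 
     of_nat ((N choose k) * ((Suc N + k) * ((N + k) choose k)))" by simp
  then show ?thesis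
    using True unfolding leg_def of_nat_mult by (simp add: of_nat_diff ac_simps)
next
  case False
  then show ?thesis by (cases "k = Suc N") (simp_all add: leg_eq_0)
qed

text \<open>Bonnet's recurrence, coefficient by coefficient: multiplication by
  \<open>1 + 2 * x\<close> adds twice the preceding coefficient.\<close>

lemma leg_recurrence:
  "(of_nat N + 2) * leg (N + 2) k + (of_nat N + 1) * leg N k =
   (2 * of_nat N + 3) * (leg (N + 1) k + 2 * (if k = 0 then 0 else leg (N + 1) (k - 1)))"
proof (cases k)
  case 0
  then show ?thesis by simp
next
  case (Suc i)
  define x where "x = rat_of_nat N"
  define y where "y = rat_of_nat i"
  have k: "of_nat k = y + 1" using Suc by (simp add: y_def)
  \<comment> \<open>Generically all coefficients are rational multiples of
    \<open>leg (N + 1) k\<close>. Near the top degree some of them vanish, and the two boundary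
    cases are computed directly.\<close>
  consider "i < N" | "i = N" | "i = N + 1" | "i > N + 1" by linarith
  then show ?thesis
  proof cases
    case 1
    then have nz: "x + 1 - y \<noteq> 0" "x + y + 2 \<noteq> 0" "x - y \<noteq> 0"
      unfolding x_def y_def
      by (metis add.commute less_Suc_eq nat_neq_iff of_nat_Suc of_nat_eq_iff right_minus_eq,
          metis of_nat_add of_nat_eq_0_iff of_nat_numeral add_eq_0_iff_both_eq_0 zero_neq_numeral, simp)
    have a: "leg (N + 1) k * (y + 1)\<^sup>2 = leg (N + 1) i * (x + 1 - y) * (x + y + 2)"
      using leg_Suc_right[of "N + 1" i] Suc by (simp add: x_def y_def algebra_simps)
    have b: "leg (N + 2) k * (x + 1 - y) = leg (N + 1) k * (x + y + 3)"
      using leg_Suc_left[of "N + 1" k] k by (simp add: x_def algebra_simps)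
    have c: "leg (N + 1) k * (x - y) = leg N k * (x + y + 2)"
      using leg_Suc_left[of "N" k] k by (simp add: x_def algebra_simps)
    define g where "g = leg (N + 1) k"
    have a': "leg (N + 1) i = g * (y + 1)\<^sup>2 / ((x + 1 - y) * (x + y + 2))"
      by (subst nonzero_eq_divide_eq) (use a nz in \<open>simp_all add: mult.assoc g_def\<close>)
    have b': "leg (N + 2) k = g * (x + y + 3) / (x + 1 - y)"
      by (subst nonzero_eq_divide_eq) (use b nz in \<open>simp_all add: g_def\<close>)
    have c': "leg N k = g * (x - y) / (x + y + 2)"
      by (subst nonzero_eq_divide_eq) (use c nz in \<open>simp_all add: g_def\<close>)
    have "(x + 2) * (g * (x + y + 3) / (x + 1 - y)) + (x + 1) * (g * (x - y) / (x + y + 2)) =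
       (2 * x + 3) * (g + 2 * (g * (y + 1)\<^sup>2 / ((x + 1 - y) * (x + y + 2))))"
      using nz by (simp add: divide_simps) (simp add: algebra_simps power2_eq_square)
    then show ?thesis
      using Suc unfolding a'[symmetric] b'[symmetric] c'[symmetric] by (simp add: g_def x_def)
  next
    case 2
    have a: "leg (N + 1) (Suc N) * (x + 1)\<^sup>2 = leg (N + 1) N * (2 * x + 2)"
      using leg_Suc_right[of "N + 1" N] by (simp add: x_def algebra_simps)
    have b: "leg (N + 2) (Suc N) = leg (N + 1) (Suc N) * (2 * x + 3)"
      using leg_Suc_left[of "N + 1" "Suc N"] by (simp add: x_def algebra_simps)
    have nz: "x + 1 \<noteq> 0" unfolding x_def by (metis of_nat_Suc of_nat_eq_0_iff nat.simps(3) add.commute)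
    have "(x + 1) * (leg (N + 1) (Suc N) * (x + 1)) = (x + 1) * (2 * leg (N + 1) N)"
      using a by (simp add: power2_eq_square algebra_simps)
    then have "leg (N + 1) (Suc N) * (x + 1) = 2 * leg (N + 1) N"
      using nz by (simp only: mult_cancel_left) simp
    then have "(x + 2) * leg (N + 2) (Suc N) = (2 * x + 3) * (leg (N + 1) (Suc N) + 2 * leg (N + 1) N)"
      unfolding b by (simp only: \<open>leg (N + 1) (Suc N) * (x + 1) = 2 * leg (N + 1) N\<close>[symmetric]) (simp add: algebra_simps)
    then show ?thesis using 2 Suc by (simp add: x_def leg_eq_0)
  next
    case 3
    have a: "leg (N + 2) (N + 2) * (x + 2)\<^sup>2 = leg (N + 2) (N + 1) * (2 * x + 4)"
      using leg_Suc_right[of "N + 2" "N + 1"] by (simp add: x_def algebra_simps)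
    have b: "leg (N + 2) (N + 1) = leg (N + 1) (N + 1) * (2 * x + 3)"
      using leg_Suc_left[of "N + 1" "Suc N"] by (simp add: x_def algebra_simps)
    have nz: "x + 2 \<noteq> 0" unfolding x_def
      by (metis of_nat_add of_nat_eq_0_iff of_nat_numeral add_eq_0_iff_both_eq_0 zero_neq_numeral)
    have "(x + 2) * ((x + 2) * leg (N + 2) (N + 2)) = (x + 2) * (2 * leg (N + 2) (N + 1))"
      using a by (simp add: power2_eq_square algebra_simps)
    then have "(x + 2) * leg (N + 2) (N + 2) = 2 * leg (N + 2) (N + 1)"
      using nz by (simp only: mult_cancel_left) simp
    then have "(x + 2) * leg (N + 2) (N + 2) = (2 * x + 3) * (2 * leg (N + 1) (N + 1))"
      unfolding b by (simp only: ac_simps)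
    then show ?thesis using 3 Suc by (simp add: x_def leg_eq_0)
  next
    case 4
    then show ?thesis using Suc by (simp add: leg_eq_0)
  qed
qed

lemma legP_extend: "N \<le> K \<Longrightarrow> legP N x = (\<Sum>k\<le>K. leg N k * x ^ k)"
  unfolding legP_def by (rule sum.mono_neutral_left) (auto simp: leg_eq_0)

lemma legP_recurrence:
  "(of_nat N + 2) * legP (N + 2) x = (2 * of_nat N + 3) * (1 + 2 * x) * legP (N + 1) x - (of_nat N + 1) * legP N x"
proof -
  have shift: "x * legP (N + 1) x = (\<Sum>k\<le>N + 2. (if k = 0 then 0 else leg (N + 1) (k - 1)) * x ^ k)"
  proof -
    have "N + 2 = Suc (N + 1)" by simp
    show ?thesis
      unfolding \<open>N + 2 = Suc (N + 1)\<close> sum.atMost_Suc_shift legP_def sum_distrib_left by (simp add: ac_simps)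
  qed
  have "(of_nat N + 2) * legP (N + 2) x + (of_nat N + 1) * legP N x =
     (\<Sum>k\<le>N + 2. ((of_nat N + 2) * leg (N + 2) k + (of_nat N + 1) * leg N k) * x ^ k)"
    using legP_extend[of N "N + 2" x] legP_extend[of "N + 2" "N + 2" x]
    by (simp only: sum_distrib_left sum.distrib distrib_right mult.assoc le_add1 order_refl)
  also have "\<dots> = (2 * of_nat N + 3) * (legP (N + 1) x + 2 * (x * legP (N + 1) x))"
    using legP_extend[of "N + 1" "N + 2" x] unfolding shift leg_recurrence
    by (simp only: sum_distrib_left sum.distrib distrib_right distrib_left mult.assoc)
  finally show ?thesis by (simp add: algebra_simps)
qed

lemma legP_0 [simp]: "legP 0 x = 1"
  by (simp add: legP_def)

lemma legP_1 [simp]: "legP (Suc 0) x = 1 + 2 * x"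
  by (simp add: legP_def leg_def)

lemma of_nat_add_2_nonzero: "of_nat N + 2 \<noteq> (0 :: rat)"
  by (metis of_nat_add of_nat_eq_0_iff of_nat_numeral add_eq_0_iff_both_eq_0 zero_neq_numeral)

text \<open>Since \<open>1 + 2 * (- 1 - x)\<close> is the negative of \<open>1 + 2 * x\<close>, this
  is the parity of Legendre polynomials. It is invisible in the expansion in powers of
  \<open>x\<close> and is read off from the recurrence.\<close>

lemma legP_reflect: "legP N (- 1 - x) = (- 1) ^ N * legP N x"
proof (induction N rule: induct_nat_012)
  case (ge2 N)
  have "(of_nat N + 2) * legP (N + 2) (- 1 - x) = (of_nat N + 2) * ((- 1) ^ N * legP (N + 2) x)"
  proof -
    have "1 + 2 * (- 1 - x) = - (1 + 2 * x)" by simp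
    moreover have "legP (N + 1) (- 1 - x) = - ((- 1) ^ N * legP (N + 1) x)"
      using ge2 by simp
    moreover have "c * - u * - (s * q) - d * (s * r) = s * (c * u * q - d * r)" for c u s q d r :: rat
      by (simp add: algebra_simps)
    ultimately show ?thesis
      unfolding mult.left_commute[of "of_nat N + 2" "(- 1) ^ N"] legP_recurrence ge2(1) by metis
  qed
  then have "legP (N + 2) (- 1 - x) = (- 1) ^ N * legP (N + 2) x"
    by (simp only: mult_cancel_left of_nat_add_2_nonzero) simp
  then show ?case by simp
qed simp_all

text \<open>At \<open>x = - 1 / 2\<close> the factor \<open>1 + 2 * x\<close> is 0, so the middle
  term of the recurrence disappears and even and odd degrees decouple.\<close>

lemma legP_minus_half:
  "legP (2 * j) (- 1 / 2) = (- 1) ^ j * cbin j \<and> legP (2 * j + 1) (- 1 / 2) = 0"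
proof (induction j)
  case (Suc j)
  have "(of_nat (2 * j) + 2) * legP (2 * j + 2) (- 1 / 2) = - (of_nat (2 * j) + 1) * ((- 1) ^ j * cbin j)"
    using Suc legP_recurrence[of "2 * j" "- 1 / 2"] by (simp add: algebra_simps)
  moreover have "(of_nat (2 * j) + 2) * cbin (Suc j) = (of_nat (2 * j) + 1) * cbin j"
    using two_of_nat_plus_2_nonzero[of j] by (simp add: cbin_Suc ac_simps)
  then have "(of_nat (2 * j) + 2) * ((- 1) ^ Suc j * cbin (Suc j)) = - (of_nat (2 * j) + 1) * ((- 1) ^ j * cbin j)"
    by (simp only: mult.left_commute[of "of_nat (2 * j) + 2"]) (simp add: algebra_simps)
  ultimately have "(of_nat (2 * j) + 2) * legP (2 * j + 2) (- 1 / 2)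
     = (of_nat (2 * j) + 2) * ((- 1) ^ Suc j * cbin (Suc j))"
    by (simp only:)
  then have "legP (2 * j + 2) (- 1 / 2) = (- 1) ^ Suc j * cbin (Suc j)"
    by (simp only: mult_cancel_left of_nat_add_2_nonzero) simp
  moreover have "(of_nat (2 * j + 1) + 2) * legP (2 * j + 1 + 2) (- 1 / 2) = 0"
    using Suc legP_recurrence[of "2 * j + 1" "- 1 / 2"] by simp
  then have "legP (2 * j + 1 + 2) (- 1 / 2) = 0"
    by (simp only: mult_eq_0_iff of_nat_add_2_nonzero) simp
  ultimately show ?case by simp
qed (use legP_1[of "- 1 / 2"] in simp)

text \<open>The auxiliary function \<open>g\<close> in the proof is the Wilf-Zeilberger certificate of the recurrence in \<open>M\<close>.\<close>
lemma kummer_terminating: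
  fixes a :: rat
  assumes "a > - 1"
  shows "(\<Sum>k\<le>M. of_nat (M choose k) * pochhammer a k / pochhammer (1 + a + of_nat M) k)
    = pochhammer (1 + a) M / pochhammer (1 + a / 2) M"
proof (induction M)
  case (Suc M)
  define c where "c = 1 + a + of_nat M"
  define f where "f M k = of_nat (M choose k) * pochhammer a k / pochhammer (1 + a + of_nat M) k" for M k
  define g where "g k = (if k = 0 then 0 else of_nat (M choose (k - 1))) * pochhammer a k * c / pochhammer c k" for k
  have c: "c > 0" using assms unfolding c_def by (simp add: add_pos_nonneg)
  have "1 + a / 2 > 0" using assms by simp
  moreover have "c - a / 2 = 1 + a / 2 + of_nat M" by (simp add: c_def)
  ultimately have ca: "c - a / 2 \<noteq> 0" by (metis add_pos_nonneg less_irrefl of_nat_0_le_iff)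
  have pos: "pochhammer c k > 0" "pochhammer (c + 1) k > 0" for k
    using c by (simp_all add: pochhammer_pos)
  have step: "(c - a / 2) * f (Suc M) k - c * f M k = g k / 2 - g (Suc k) / 2" for k
  proof -
    define A where "A = rat_of_nat (M choose k)"
    define B where "B = (if k = 0 then 0 else rat_of_nat (M choose (k - 1)))"
    define q where "q = pochhammer a k"
    define r where "r = pochhammer c k"
    have r: "r > 0" "c + of_nat k > 0" using c pos by (simp_all add: r_def add_pos_nonneg)
    have AB: "rat_of_nat (Suc M choose k) = A + B"
      unfolding A_def B_def by (cases k) simp_all
    have "B * (of_nat M + 1 - of_nat k) = A * of_nat k"
    proof (cases k)
      case (Suc i)
      show ?thesis
      proof (cases "i \<le> M")
        case True
        have "Suc i * (M choose Suc i) = (M choose i) * (M - i)"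
          by (simp only: Suc_times_choose_Suc mult.commute[of "M - i"])
        from arg_cong[OF this, of rat_of_nat] show ?thesis
          unfolding A_def B_def Suc of_nat_mult using True by (simp add: of_nat_diff ac_simps)
      qed (simp add: A_def B_def Suc not_le binomial_eq_0)
    qed (simp add: B_def)
    then have key: "(c - a / 2) * (A + B) - (c + of_nat k) * A = (B * (c + of_nat k) - A * (a + of_nat k)) / 2"
      unfolding c_def by (simp add: field_simps)
    have "pochhammer (c + 1) k = pochhammer c (Suc k) / c"
      using c by (simp add: pochhammer_rec)
    then have p1: "pochhammer (c + 1) k = r * (c + of_nat k) / c"
      by (simp add: pochhammer_Suc r_def)
    have "f (Suc M) k = (A + B) * q * c / (r * (c + of_nat k))"
    proof -
      have "1 + a + of_nat (Suc M) = c + 1" by (simp add: c_def)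
      then show ?thesis unfolding f_def q_def AB by (simp only: p1) simp
    qed
    moreover have "f M k = A * q / r"
      by (simp add: f_def A_def q_def r_def c_def)
    moreover have "g k = B * q * c / r" "g (Suc k) = A * (q * (a + of_nat k)) * c / (r * (c + of_nat k))"
      by (simp_all add: g_def B_def A_def q_def r_def pochhammer_Suc)
    moreover have "(c - a / 2) * ((A + B) * q * c / (r * (c + of_nat k))) - c * (A * q / r)
       = B * q * c / r / 2 - A * (q * (a + of_nat k)) * c / (r * (c + of_nat k)) / 2"
    proof -
      define w where "w = c + of_nat k"
      have w: "w \<noteq> 0" "r \<noteq> 0" using r by (simp_all add: w_def)
      have "(c - a / 2) * ((A + B) * q * c / (r * w)) - c * (A * q / r)
         = q * c * ((c - a / 2) * (A + B) - w * A) / (r * w)"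
        using w by (simp add: field_simps)
      also have "\<dots> = q * c * ((B * w - A * (a + of_nat k)) / 2) / (r * w)"
        by (simp only: w_def key)
      also have "\<dots> = B * q * c / r / 2 - A * (q * (a + of_nat k)) * c / (r * w) / 2"
        using w by (simp add: field_simps)
      finally show ?thesis by (simp add: w_def)
    qed
    ultimately show ?thesis by simp
  qed
  \<comment> \<open>\<open>g\<close> is 0 at both ends: at 0 by its default value, at
    \<open>M + 2\<close> because \<open>M choose (M + 1)\<close> is 0. Summing \<open>f M\<close> up
    to \<open>Suc M\<close> adds only a zero term.\<close>
  have "(\<Sum>k\<le>Suc M. (c - a / 2) * f (Suc M) k - c * f M k) = g 0 / 2 - g (Suc (Suc M)) / 2"
    unfolding step by (rule sum_telescope)
  also have "\<dots> = 0" by (simp add: g_def)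
  finally have "(c - a / 2) * (\<Sum>k\<le>Suc M. f (Suc M) k) = c * (\<Sum>k\<le>Suc M. f M k)"
    by (simp only: sum_subtractf sum_distrib_left)
  also have "(\<Sum>k\<le>Suc M. f M k) = pochhammer (1 + a) M / pochhammer (1 + a / 2) M"
    using Suc by (simp add: f_def)
  finally have "(\<Sum>k\<le>Suc M. f (Suc M) k) = c * (pochhammer (1 + a) M / pochhammer (1 + a / 2) M) / (c - a / 2)"
    using ca by (subst nonzero_eq_divide_eq) (simp_all add: mult.commute)
  also have "\<dots> = pochhammer (1 + a) (Suc M) / pochhammer (1 + a / 2) (Suc M)"
  proof -
    have e: "c - a / 2 = 1 + a / 2 + of_nat M" by (simp add: c_def)
    show ?thesis unfolding e unfolding pochhammer_Suc c_def[symmetric] by (simp only: times_divide_eq_right divide_divide_eq_left mult.commute[of c])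
  qed
  finally show ?case by (simp add: f_def)
qed simp

section \<open>Character sums and sums of two squares\<close>

locale odd_prime_modulus = prime_modulus +
  assumes odd_p: "odd p"
begin

lemma p_gt_2: "p > 2"
  using prime_p odd_p prime_ge_2_nat[of p] by (cases "p = 2") auto

definition half :: nat where
  "half = (p - 1) div 2"

lemma p_half: "p = 2 * half + 1"
  using odd_p p_gt_2 unfolding half_def by presburger

definition chi :: "int \<Rightarrow> int" where
  "chi a = Legendre a (int p)"

lemma chi_cong: "[a = b] (mod int p) \<Longrightarrow> chi a = chi b"
proof -
  assume h: "[a = b] (mod int p)"
  then have "[c = a] (mod int p) \<longleftrightarrow> [c = b] (mod int p)" for c
    by (meson cong_sym cong_trans)
  moreover from h have "[a = 0] (mod int p) \<longleftrightarrow> [b = 0] (mod int p)"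
    by (meson cong_sym cong_trans)
  ultimately show ?thesis
    unfolding chi_def Legendre_def QuadRes_def by simp
qed

lemma chi_mod: "chi (a mod int p) = chi a"
  by (rule chi_cong) simp

lemma chi_eq_0_iff: "chi a = 0 \<longleftrightarrow> int p dvd a"
  by (auto simp: chi_def Legendre_def cong_0_iff)

lemma chi_0 [simp]: "chi 0 = 0"
  by (simp add: chi_eq_0_iff)

lemma chi_cases: "chi a = 0 \<or> chi a = 1 \<or> chi a = - 1"
  by (auto simp: chi_def Legendre_def)

lemma chi_euler: "[chi a = a ^ half] (mod int p)"
proof -
  have "nat (int p) = p" by simp
  then show ?thesis
    unfolding chi_def half_def using euler_criterion[of p a] prime_p p_gt_2 by simp
qed

lemma chi_unique: "[chi a = e] (mod int p) \<Longrightarrow> e \<in> {-1, 0, 1} \<Longrightarrow> chi a = e"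
proof -
  assume "[chi a = e] (mod int p)" "e \<in> {-1, 0, 1}"
  then have "int p dvd chi a - e" "\<bar>chi a - e\<bar> < int p"
    using chi_cases[of a] p_gt_2 by (auto simp: cong_iff_dvd_diff)
  then show "chi a = e"
    using dvd_imp_le_int[of "chi a - e" "int p"] by fastforce
qed

lemma chi_mult: "chi (a * b) = chi a * chi b"
proof (rule chi_unique)
  have "[chi a * chi b = a ^ half * b ^ half] (mod int p)"
    by (intro cong_mult chi_euler)
  then show "[chi (a * b) = chi a * chi b] (mod int p)"
    using chi_euler[of "a * b"] by (simp add: power_mult_distrib) (meson cong_sym cong_trans)
  show "chi a * chi b \<in> {-1, 0, 1}"
    using chi_cases[of a] chi_cases[of b] by auto
qed

lemma chi_1 [simp]: "chi 1 = 1"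
  using p_gt_2 by (intro chi_unique) (use chi_euler[of 1] in auto)

lemma chi_square: "\<not> int p dvd a \<Longrightarrow> chi a * chi a = 1"
  using chi_cases[of a] by (auto simp: chi_eq_0_iff)

abbreviation residues :: "int set" where "residues \<equiv> {0..<int p}"

lemma sum_residues_affine:
  fixes f :: "int \<Rightarrow> int"
  assumes f: "\<And>t. f (t mod int p) = f t" and a: "\<not> int p dvd a"
  shows "(\<Sum>t\<in>residues. f (a * t + b)) = (\<Sum>t\<in>residues. f t)"
proof -
  have inj: "inj_on (\<lambda>t. (a * t + b) mod int p) residues"
  proof (rule inj_onI)
    fix s t assume st: "s \<in> residues" "t \<in> residues" "(a * s + b) mod int p = (a * t + b) mod int p"
    then have "int p dvd a * (s - t)"
      by (simp add: mod_eq_dvd_iff algebra_simps)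
    then have "int p dvd s - t"
      using a prime_int_p by (simp add: prime_dvd_mult_iff)
    then have "s mod int p = t mod int p" by (simp add: mod_eq_dvd_iff)
    then show "s = t" using st by simp
  qed
  have "(\<lambda>t. (a * t + b) mod int p) ` residues \<subseteq> residues" by auto
  then have "(\<lambda>t. (a * t + b) mod int p) ` residues = residues"
    using inj by (intro endo_inj_surj) auto
  then have "bij_betw (\<lambda>t. (a * t + b) mod int p) residues residues"
    using inj by (simp add: bij_betw_def)
  then show ?thesis
    using sum.reindex_bij_betw[of "\<lambda>t. (a * t + b) mod int p" residues residues f] by (simp add: f)
qed

text \<open>
  The generator is normalised to have order \<open>p - 1\<close> modulo the square of \<open>p\<close>, so that its powers are the
  Teichmueller representatives and power sums over them can be evaluated to that precision.
\<close>
lemma primitive_root_exists: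
  "\<exists>G :: int. [G ^ (p - 1) = 1] (mod int p ^ 2) \<and> (\<forall>k. [G ^ k = 1] (mod int p) \<longleftrightarrow> (p - 1) dvd k)"
proof -
  obtain g where g: "residue_primroot p g"
    using prime_primitive_root_exists[of p] prime_p prime_gt_1_nat by auto
  then have cop: "coprime p g" and ord: "ord p g = p - 1"
    using prime_p by (auto simp: residue_primroot_def totient_prime)
  have "[g ^ totient (p ^ 2) = 1] (mod p ^ 2)"
    using cop by (intro euler_theorem) (simp add: coprime_commute)
  moreover have "totient (p ^ 2) = p * (p - 1)"
    using prime_p by (simp add: totient_prime_power)
  ultimately have "[int (g ^ (p * (p - 1))) = int 1] (mod int (p ^ 2))"
    by (simp only: cong_int_iff)
  then have 1: "[(int g ^ p) ^ (p - 1) = 1] (mod int p ^ 2)"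
    by (simp add: power_mult)
  have 2: "[(int g ^ p) ^ k = 1] (mod int p) \<longleftrightarrow> (p - 1) dvd k" for k
  proof -
    have "[(int g ^ p) ^ k = 1] (mod int p) \<longleftrightarrow> [int (g ^ (p * k)) = int 1] (mod int p)"
      by (simp add: power_mult)
    also have "\<dots> \<longleftrightarrow> (p - 1) dvd p * k"
      by (simp only: cong_int_iff ord_divides ord)
    also have "\<dots> \<longleftrightarrow> (p - 1) dvd k"
    proof -
      have "coprime (p - 1) p"
        by (rule coprime_diff_one_left_nat) (rule prime_gt_0_nat[OF prime_p])
      then show ?thesis by (simp add: coprime_dvd_mult_right_iff)
    qed
    finally show ?thesis .
  qed
  show ?thesis using 1 2 by blast
qed

definition G :: int where
  "G = (SOME G. [G ^ (p - 1) = 1] (mod int p ^ 2) \<and> (\<forall>k. [G ^ k = 1] (mod int p) \<longleftrightarrow> (p - 1) dvd k))"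

lemma G_power_p2: "[G ^ (p - 1) = 1] (mod int p ^ 2)"
  and G_power_eq_1_iff: "[G ^ k = 1] (mod int p) \<longleftrightarrow> (p - 1) dvd k"
  using someI_ex[OF primitive_root_exists] unfolding G_def by blast+

lemma not_dvd_G: "\<not> int p dvd G"
proof
  assume "int p dvd G"
  then have "int p dvd G ^ (p - 1)" using p_gt_2 prime_int_p by (simp add: prime_dvd_power_iff)
  moreover have "int p dvd G ^ (p - 1) - 1"
    using G_power_eq_1_iff[of "p - 1"] by (simp add: cong_iff_dvd_diff)
  ultimately have "int p dvd G ^ (p - 1) - (G ^ (p - 1) - 1)" by (rule dvd_diff)
  then show False using p_gt_2 by simp
qed

lemma not_dvd_G_power: "\<not> int p dvd G ^ k"
  using not_dvd_G prime_int_p prime_dvd_power by blast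

lemma bij_betw_G_power: "bij_betw (\<lambda>i. G ^ i mod int p) {..<p - 1} (residues - {0})"
proof -
  have neq: "G ^ a mod int p \<noteq> G ^ b mod int p" if "a < b" "b < p - 1" for a b
  proof
    assume "G ^ a mod int p = G ^ b mod int p"
    then have "int p dvd G ^ b - G ^ a" by (metis mod_eq_dvd_iff)
    moreover have "G ^ b - G ^ a = G ^ a * (G ^ (b - a) - 1)"
      using that(1) by (simp add: right_diff_distrib power_add[symmetric])
    ultimately have "int p dvd G ^ (b - a) - 1"
      using not_dvd_G_power prime_int_p by (simp add: prime_dvd_mult_iff)
    then have "(p - 1) dvd b - a" using G_power_eq_1_iff by (simp add: cong_iff_dvd_diff)
    then show False using that by (auto dest: dvd_imp_le)
  qed
  have inj: "inj_on (\<lambda>i. G ^ i mod int p) {..<p - 1}"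
    by (rule inj_onI) (metis neq lessThan_iff linorder_neqE_nat)
  have sub: "(\<lambda>i. G ^ i mod int p) ` {..<p - 1} \<subseteq> residues - {0}"
    using not_dvd_G_power by (auto simp: dvd_eq_mod_eq_0)
  have "card (residues - {0}) = p - 1" by (simp add: card_Diff_singleton)
  then have "(\<lambda>i. G ^ i mod int p) ` {..<p - 1} = residues - {0}"
    using sub card_image[OF inj] by (intro card_subset_eq) auto
  then show ?thesis using inj by (simp add: bij_betw_def)
qed

lemma sum_residues_G:
  fixes f :: "int \<Rightarrow> int"
  assumes f: "\<And>t. f (t mod int p) = f t"
  shows "(\<Sum>t\<in>residues. f t) = f 0 + (\<Sum>i<p - 1. f (G ^ i))"
proof -
  have "(\<Sum>t\<in>residues. f t) = f 0 + (\<Sum>t\<in>residues - {0}. f t)"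
    by (rule sum.remove) auto
  also have "(\<Sum>t\<in>residues - {0}. f t) = (\<Sum>i<p - 1. f (G ^ i mod int p))"
    by (rule sum.reindex_bij_betw[OF bij_betw_G_power, symmetric])
  finally show ?thesis by (simp add: f)
qed

lemma chi_G: "chi G = - 1"
proof -
  have "chi G \<noteq> 1"
  proof
    assume "chi G = 1"
    then have "[G ^ half = 1] (mod int p)" using chi_euler[of G] by (simp add: cong_sym)
    then have "(p - 1) dvd half" by (simp add: G_power_eq_1_iff)
    then show False using p_half p_gt_2 by (auto dest!: dvd_imp_le)
  qed
  moreover have "chi G \<noteq> 0" using not_dvd_G by (simp add: chi_eq_0_iff)
  ultimately show ?thesis using chi_cases by blast
qed

lemma sum_chi: "(\<Sum>t\<in>residues. chi t) = 0"
proof -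
  have "(\<Sum>t\<in>residues. chi t) = (\<Sum>t\<in>residues. chi (G * t + 0))"
    using sum_residues_affine[of chi G 0] not_dvd_G by (simp add: chi_mod)
  also have "\<dots> = - (\<Sum>t\<in>residues. chi t)"
    by (simp add: chi_mult chi_G sum_negf)
  finally show ?thesis by simp
qed

lemma sum_chi_affine: "\<not> int p dvd a \<Longrightarrow> (\<Sum>t\<in>residues. chi (a * t + b)) = 0"
  using sum_residues_affine[of chi a b] by (simp add: chi_mod sum_chi)

lemma sum_chi_square: "(\<Sum>t\<in>residues. chi t * chi t) = int p - 1"
proof -
  have "(\<Sum>t\<in>residues. chi t * chi t) = (\<Sum>t\<in>residues. if t = 0 then 0 else 1)"
    by (rule sum.cong) (auto simp: chi_square zdvd_not_zless)
  also have "\<dots> = (\<Sum>t\<in>residues - {0}. 1)"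
    by (rule sum.mono_neutral_cong_right) auto
  finally show ?thesis using p_gt_2 by (simp add: card_Diff_singleton of_nat_diff)
qed

text \<open>Scaling \<open>u\<close> by \<open>c\<close> shows that the value is the same for all
  \<open>c\<close> prime to \<open>p\<close>. Summed over all \<open>c\<close> the total is 0, and
  the case \<open>c = 0\<close> contributes \<open>p - 1\<close>; this determines the common
  value.\<close>

lemma sum_chi_quadratic:
  "(\<Sum>u\<in>residues. chi (u * (u + c))) = (if int p dvd c then int p else 0) - 1"
proof -
  define T where "T c = (\<Sum>u\<in>residues. chi (u * (u + c)))" for c
  have Tdvd: "T c = int p - 1" if "int p dvd c" for c
  proof -
    have "chi (u * (u + c)) = chi u * chi u" for u
      using that chi_cong[of "u + c" u] by (simp add: chi_mult cong_iff_dvd_diff)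
    then show ?thesis by (simp add: T_def sum_chi_square)
  qed
  have T1: "T c = T 1" if "\<not> int p dvd c" for c
  proof -
    have "T c = (\<Sum>u\<in>residues. chi ((c * u + 0) * ((c * u + 0) + c)))"
      unfolding T_def
      by (rule sum_residues_affine[symmetric, where f = "\<lambda>u. chi (u * (u + c))"])
         (use that in \<open>auto intro!: chi_cong cong_mult cong_add\<close>)
    also have "\<dots> = (\<Sum>u\<in>residues. chi c * chi c * chi (u * (u + 1)))"
      by (intro sum.cong refl) (simp add: chi_mult[symmetric] algebra_simps)
    finally show ?thesis by (simp add: T_def chi_square[OF that])
  qed
  have "(\<Sum>c\<in>residues. T c) = (\<Sum>u\<in>residues. \<Sum>c\<in>residues. chi u * chi (1 * c + u))"
    unfolding T_def chi_mult by (subst sum.swap) (simp add: add.commute)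
  also have "\<dots> = 0"
  proof -
    have "(\<Sum>c\<in>residues. chi (1 * c + u)) = 0" for u
      using p_gt_2 by (intro sum_chi_affine) (simp add: zdvd_not_zless)
    then show ?thesis by (simp only: sum_distrib_left[symmetric]) simp
  qed
  finally have "(\<Sum>c\<in>residues. T c) = 0" .
  moreover have "(\<Sum>c\<in>residues. T c) = T 0 + (\<Sum>c\<in>residues - {0}. T c)"
    by (rule sum.remove) auto
  moreover have "(\<Sum>c\<in>residues - {0}. T c) = (\<Sum>c\<in>residues - {0}. T 1)"
    by (intro sum.cong refl T1) (auto simp: zdvd_not_zless)
  ultimately have "(int p - 1) * (T 1 + 1) = 0"
    using Tdvd[of 0] p_gt_2 by (simp add: card_Diff_singleton of_nat_diff algebra_simps)
  then have "T 1 = - 1" using p_gt_2 by auto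
  then show ?thesis using Tdvd T1 unfolding T_def by auto
qed

end

section \<open>Jacobsthal sums for primes congruent to 1 modulo 4\<close>

locale prime_1_mod_4 = odd_prime_modulus +
  fixes j :: nat
  assumes p_4j: "p = 4 * j + 1"
begin

lemma half_eq: "half = 2 * j"
  using p_half p_4j by linarith

lemma chi_euler_j: "[chi a = a ^ (2 * j)] (mod int p)"
  using chi_euler[of a] unfolding half_eq .

lemma j_pos: "j > 0"
  using p_4j p_gt_2 by (cases j) auto

lemma G_power_half: "[G ^ (2 * j) = - 1] (mod int p)"
  using chi_euler_j[of G] by (simp add: chi_G cong_sym)

lemma chi_minus [simp]: "chi (- a) = chi a"
proof -
  have "chi (- 1) = 1"
    by (rule chi_unique) (use chi_euler_j[of "- 1"] in auto)
  then show ?thesis using chi_mult[of "- 1" a] by simp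
qed

text \<open>Jacobsthal's sum; its negative is the trace of Frobenius of the curve s^2 = t^3 + a t
  when \<open>p\<close> does not divide \<open>a\<close>.\<close>

definition phi :: "int \<Rightarrow> int" where
  "phi a = (\<Sum>t\<in>residues. chi (t * (t\<^sup>2 + a)))"

lemma phi_term_mod: "chi (t mod int p * ((t mod int p)\<^sup>2 + a)) = chi (t * (t\<^sup>2 + a))"
  by (intro chi_cong cong_mult cong_add cong_pow) auto

lemma phi_cong: "[a = b] (mod int p) \<Longrightarrow> phi a = phi b"
  unfolding phi_def by (intro sum.cong refl chi_cong cong_mult cong_add cong_refl)

lemma phi_times_square:
  assumes "\<not> int p dvd c"
  shows "phi (a * c\<^sup>2) = chi c * phi a"
proof -
  have "phi (a * c\<^sup>2) = (\<Sum>t\<in>residues. chi ((c * t + 0) * ((c * t + 0)\<^sup>2 + a * c\<^sup>2)))"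
    unfolding phi_def
    by (rule sum_residues_affine[symmetric, where f = "\<lambda>t. chi (t * (t\<^sup>2 + a * c\<^sup>2))"])
       (use assms phi_term_mod in auto)
  also have "\<dots> = (\<Sum>t\<in>residues. chi c * chi (t * (t\<^sup>2 + a)))"
  proof (intro sum.cong refl)
    fix t
    have "(c * t + 0) * ((c * t + 0)\<^sup>2 + a * c\<^sup>2) = c * ((c * c) * (t * (t\<^sup>2 + a)))"
      by (simp add: power2_eq_square algebra_simps)
    then show "chi ((c * t + 0) * ((c * t + 0)\<^sup>2 + a * c\<^sup>2)) = chi c * chi (t * (t\<^sup>2 + a))"
      by (simp only: chi_mult[of c] chi_mult[of "c * c"] chi_square[OF assms] mult_1_left)
  qed
  finally show ?thesis by (simp add: phi_def sum_distrib_left)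
qed

text \<open>So the square of \<open>phi\<close> takes at most two values on nonzero residues, one
  for each quadratic class.\<close>

lemma phi_square_class: "\<not> int p dvd c \<Longrightarrow> (phi (a * c\<^sup>2))\<^sup>2 = (phi a)\<^sup>2"
  using chi_square[of c] by (simp add: phi_times_square power_mult_distrib) (simp add: power2_eq_square)

lemma residues_square_eq:
  assumes "s \<in> residues - {0}"
  shows "{t \<in> residues. int p dvd t\<^sup>2 - s\<^sup>2} = {s, int p - s}" "s \<noteq> int p - s"
proof -
  have "t = s \<or> t = int p - s" if t: "t \<in> residues" "int p dvd t\<^sup>2 - s\<^sup>2" for t
  proof -
    have "t\<^sup>2 - s\<^sup>2 = (t - s) * (t + s)" by (simp add: power2_eq_square algebra_simps)
    then have "int p dvd t - s \<or> int p dvd t + s"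
      using t(2) prime_int_p by (simp add: prime_dvd_mult_iff)
    then show ?thesis
    proof
      assume "int p dvd t - s"
      then have "t - s = 0" using t(1) assms dvd_imp_le_int[of "t - s" "int p"] by fastforce
      then show ?thesis by simp
    next
      assume "int p dvd t + s"
      then have "int p dvd t + s - int p" by simp
      then have "t + s - int p = 0" using t(1) assms dvd_imp_le_int[of "t + s - int p" "int p"] by fastforce
      then show ?thesis by simp
    qed
  qed
  moreover have "int p dvd (int p - s)\<^sup>2 - s\<^sup>2"
  proof -
    have "(int p - s)\<^sup>2 - s\<^sup>2 = int p * (int p - 2 * s)" by (simp add: power2_eq_square algebra_simps)
    then show ?thesis by simp
  qed
  ultimately show "{t \<in> residues. int p dvd t\<^sup>2 - s\<^sup>2} = {s, int p - s}"
    using assms by auto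
  show "s \<noteq> int p - s" using odd_p by presburger
qed

text \<open>Expanding the square and summing over \<open>a\<close> first leaves a quadratic
  character sum. Its constant part -1 contributes a multiple of the squared sum of
  \<open>chi\<close>, which is 0, and only the diagonals \<open>t = s\<close> and
  \<open>t = - s\<close> remain.\<close>

lemma sum_phi_squares: "(\<Sum>a\<in>residues. (phi a)\<^sup>2) = 2 * int p * (int p - 1)"
proof -
  have inner: "(\<Sum>a\<in>residues. chi (s\<^sup>2 + a) * chi (t\<^sup>2 + a)) = (if int p dvd t\<^sup>2 - s\<^sup>2 then int p else 0) - 1" for s t
  proof -
    have "(\<Sum>a\<in>residues. chi (s\<^sup>2 + a) * chi (t\<^sup>2 + a))
       = (\<Sum>a\<in>residues. chi ((1 * a + s\<^sup>2) * ((1 * a + s\<^sup>2) + (t\<^sup>2 - s\<^sup>2))))"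
      by (intro sum.cong refl) (simp add: chi_mult add.commute)
    also have "\<dots> = (\<Sum>a\<in>residues. chi (a * (a + (t\<^sup>2 - s\<^sup>2))))"
      using p_gt_2 by (intro sum_residues_affine[where f = "\<lambda>a. chi (a * (a + (t\<^sup>2 - s\<^sup>2)))"])
        (auto intro!: chi_cong cong_mult cong_add simp: zdvd_not_zless)
    finally show ?thesis by (simp add: sum_chi_quadratic)
  qed
  have sq: "(phi a)\<^sup>2 = (\<Sum>s\<in>residues. \<Sum>t\<in>residues. chi s * chi t * (chi (s\<^sup>2 + a) * chi (t\<^sup>2 + a)))" for a
    unfolding phi_def power2_eq_square[of "sum _ _"] sum_product by (simp add: chi_mult ac_simps)
  have "(\<Sum>a\<in>residues. (phi a)\<^sup>2)
     = (\<Sum>s\<in>residues. \<Sum>t\<in>residues. \<Sum>a\<in>residues. chi s * chi t * (chi (s\<^sup>2 + a) * chi (t\<^sup>2 + a)))"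
    unfolding sq by (rule trans[OF sum.swap], rule sum.cong[OF refl], rule sum.swap)
  also have "\<dots> = (\<Sum>s\<in>residues. \<Sum>t\<in>residues. chi s * chi t * ((if int p dvd t\<^sup>2 - s\<^sup>2 then int p else 0) - 1))"
    by (simp only: sum_distrib_left[symmetric] inner)
  also have "\<dots> = (\<Sum>s\<in>residues. chi s * (\<Sum>t\<in>residues. if int p dvd t\<^sup>2 - s\<^sup>2 then int p * chi t else 0))
      - (\<Sum>s\<in>residues. chi s * (\<Sum>t\<in>residues. chi t))"
    unfolding sum_distrib_left sum_subtractf[symmetric] by (intro sum.cong refl) (simp add: algebra_simps)
  also have "(\<Sum>s\<in>residues. chi s * (\<Sum>t\<in>residues. chi t)) = 0"
    by (simp add: sum_chi)
  also have "(\<Sum>s\<in>residues. chi s * (\<Sum>t\<in>residues. if int p dvd t\<^sup>2 - s\<^sup>2 then int p * chi t else 0))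
      = (\<Sum>s\<in>residues. 2 * int p * (chi s * chi s))"
  proof (intro sum.cong refl)
    fix s assume s: "s \<in> residues"
    show "chi s * (\<Sum>t\<in>residues. if int p dvd t\<^sup>2 - s\<^sup>2 then int p * chi t else 0) = 2 * int p * (chi s * chi s)"
    proof (cases "s = 0")
      case False
      have "(\<Sum>t\<in>residues. if int p dvd t\<^sup>2 - s\<^sup>2 then int p * chi t else 0)
         = (\<Sum>t\<in>{t \<in> residues. int p dvd t\<^sup>2 - s\<^sup>2}. int p * chi t)"
        by (rule sum.inter_filter[symmetric]) simp
      also have "\<dots> = int p * chi s + int p * chi (int p - s)"
        using residues_square_eq[of s] s False by simp
      also have "chi (int p - s) = chi (- s)"
        by (rule chi_cong) (simp add: cong_iff_dvd_diff)
      finally show ?thesis by (simp add: algebra_simps)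
    qed simp
  qed
  finally show ?thesis by (simp add: sum_distrib_left[symmetric] sum_chi_square)
qed

lemma phi_0: "phi 0 = 0"
proof -
  have "chi (t * (t\<^sup>2 + 0)) = chi t" for t
    using chi_cases[of t] by (auto simp: chi_mult power2_eq_square)
  then show ?thesis by (simp add: phi_def sum_chi)
qed

text \<open>The second moment distributes over two quadratic classes of equal size, represented by
  \<open>- 1\<close> and \<open>G\<close>.\<close>

lemma phi_norm: "(phi (- 1))\<^sup>2 + (phi G)\<^sup>2 = 4 * int p"
proof -
  have even_odd: "(\<Sum>i<2 * m. f i) = (\<Sum>i<m. f (2 * i) + f (2 * i + 1))" for m and f :: "nat \<Rightarrow> int"
    by (induction m) simp_all
  have even: "(phi (G ^ (2 * i)))\<^sup>2 = (phi (- 1))\<^sup>2" for i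
  proof -
    \<comment> \<open>Even powers of \<open>G\<close> are moved into the class of \<open>- 1\<close>
      by means of \<open>G ^ (2 * j) = - 1\<close> modulo \<open>p\<close>.\<close>
    have "[G ^ (2 * i) = - 1 * (G ^ (i + j))\<^sup>2] (mod int p)"
    proof -
      have "[G ^ (2 * i) * (- 1 * G ^ (2 * j)) = G ^ (2 * i) * (- 1 * - 1)] (mod int p)"
        by (intro cong_mult G_power_half cong_refl)
      moreover have "G ^ (2 * i) * (- 1 * G ^ (2 * j)) = - 1 * (G ^ (i + j))\<^sup>2"
        by (simp add: power_add[symmetric] power_mult[symmetric] algebra_simps)
      ultimately show ?thesis by (simp add: cong_sym)
    qed
    then show ?thesis
      using phi_square_class[OF not_dvd_G_power, of "- 1" "i + j"] phi_cong by metis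
  qed
  have odd: "(phi (G ^ (2 * i + 1)))\<^sup>2 = (phi G)\<^sup>2" for i
  proof -
    have "G ^ (2 * i + 1) = G * (G ^ i)\<^sup>2" by (simp add: power_mult[symmetric] mult.commute[of i])
    then show ?thesis using phi_square_class[OF not_dvd_G_power, of G i] by (simp only:)
  qed
  have mod: "phi (a mod int p) = phi a" for a
    by (rule phi_cong) simp
  have "(\<Sum>a\<in>residues. (phi a)\<^sup>2) = (phi 0)\<^sup>2 + (\<Sum>i<p - 1. (phi (G ^ i))\<^sup>2)"
    by (rule sum_residues_G) (simp add: mod)
  also have "(\<Sum>i<p - 1. (phi (G ^ i))\<^sup>2) = (\<Sum>i<2 * (2 * j). (phi (G ^ i))\<^sup>2)"
    using p_4j by (intro sum.cong) auto
  also have "\<dots> = int (2 * j) * ((phi (- 1))\<^sup>2 + (phi G)\<^sup>2)"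
    unfolding even_odd even odd by simp
  finally have "2 * int p * (int p - 1) = int (2 * j) * ((phi (- 1))\<^sup>2 + (phi G)\<^sup>2)"
    unfolding sum_phi_squares phi_0 by simp
  moreover have "int p - 1 = int (2 * j) * 2" using p_4j by simp
  ultimately have "int (2 * j) * (4 * int p) = int (2 * j) * ((phi (- 1))\<^sup>2 + (phi G)\<^sup>2)"
    by simp
  then show ?thesis using j_pos by (simp only: mult_cancel_left) simp
qed

lemma phi_eq_sum_G: "phi a = (\<Sum>i<4 * j. chi (G ^ i * ((G ^ i)\<^sup>2 + a)))"
proof -
  have "phi a = chi (0 * (0\<^sup>2 + a)) + (\<Sum>i<p - 1. chi (G ^ i * ((G ^ i)\<^sup>2 + a)))"
    unfolding phi_def by (rule sum_residues_G) (rule phi_term_mod)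
  moreover have "p - 1 = 4 * j" using p_4j by simp
  ultimately show ?thesis by (simp only:) simp
qed

lemma sum_lessThan_add: "(\<Sum>i<m + k. f i) = (\<Sum>i<m. f i) + (\<Sum>i<k. f (i + m))" for f :: "nat \<Rightarrow> int"
  by (induction k) (simp_all add: add.commute[of m])

text \<open>The shift of the exponent by \<open>2 * j\<close> is \<open>t \<mapsto> - t\<close>,
  under which the argument of \<open>chi\<close> changes only its sign. Halving \<open>phi\<close>
  thus yields integers, and \<open>phi_norm\<close> becomes a representation of \<open>p\<close> by
  two squares.\<close>

lemma phi_even: "phi a = 2 * (\<Sum>i<2 * j. chi (G ^ i * ((G ^ i)\<^sup>2 + a)))"
proof -
  have "chi (G ^ (i + 2 * j) * ((G ^ (i + 2 * j))\<^sup>2 + a)) = chi (G ^ i * ((G ^ i)\<^sup>2 + a))" for i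
  proof -
    have "[G ^ (i + 2 * j) = G ^ i * - 1] (mod int p)"
      unfolding power_add by (intro cong_mult G_power_half cong_refl)
    then have "chi (G ^ (i + 2 * j) * ((G ^ (i + 2 * j))\<^sup>2 + a)) = chi ((G ^ i * - 1) * ((G ^ i * - 1)\<^sup>2 + a))"
      by (intro chi_cong cong_mult cong_add cong_pow cong_refl)
    then show ?thesis by simp
  qed
  moreover have "4 * j = 2 * j + 2 * j" by simp
  ultimately show ?thesis
    unfolding phi_eq_sum_G[of a] by (simp only: sum_lessThan_add mult_2)
qed

definition X :: int where
  "X = (\<Sum>i<2 * j. chi (G ^ i * ((G ^ i)\<^sup>2 - 1)))"

lemma phi_X: "phi (- 1) = 2 * X"
  using phi_even[of "- 1"] by (simp add: X_def)

text \<open>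
  The involution \<open>t \<mapsto> 1 / t\<close> fixes, up to sign, only \<open>1\<close> and the square root of \<open>- 1\<close>,
  which contribute \<open>0\<close> and \<open>1\<close>.
\<close>
lemma X_mod_4: "[X = 2 * int j - 1] (mod 4)"
proof -
  define a where "a i = chi (G ^ i * ((G ^ i)\<^sup>2 - 1))" for i
  have a0: "a 0 = 0" by (simp add: a_def)
  have aj: "a j = 1"
  proof -
    have G2: "[(G ^ j)\<^sup>2 = - 1] (mod int p)"
      using G_power_half by (simp add: power_mult[symmetric] mult.commute)
    have "\<not> int p dvd 1 - G ^ j"
    proof
      assume "int p dvd 1 - G ^ j"
      then have "[G ^ j = 1] (mod int p)" by (metis cong_iff_dvd_diff cong_sym)
      then have "(p - 1) dvd j" by (simp add: G_power_eq_1_iff)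
      then show False using j_pos p_4j by (auto dest: dvd_imp_le)
    qed
    \<comment> \<open>With \<open>i = G ^ j\<close> a square root of -1, the value
      \<open>i * (i^2 - 1) = - 2 * i\<close> is the square of \<open>1 - i\<close>.\<close>
    then have "1 = chi ((1 - G ^ j) * (1 - G ^ j))" by (simp add: chi_mult chi_square)
    also have "\<dots> = chi (1 - 2 * G ^ j + (G ^ j)\<^sup>2)"
      by (simp add: power2_eq_square algebra_simps)
    also have "\<dots> = chi (1 - 2 * G ^ j + - 1)"
      by (intro chi_cong cong_add G2 cong_refl)
    also have "\<dots> = chi (G ^ j * (- 1 - 1))" by (simp add: algebra_simps)
    also have "\<dots> = a j"
      unfolding a_def by (intro chi_cong cong_mult cong_diff cong_sym[OF G2] cong_refl)
    finally show ?thesis by simp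
  qed
  have reflect: "a (2 * j - i) = a i" if "i < 2 * j" for i
  proof -
    have e': "G ^ i * G ^ (2 * j - i) = G ^ (2 * j)"
      using that by (simp add: power_add[symmetric])
    have "a (2 * j - i) = chi (G ^ i * G ^ i) * a (2 * j - i)"
      using not_dvd_G_power by (simp add: chi_mult chi_square)
    also have "\<dots> = chi (G ^ i * G ^ i) * (chi (G ^ i * G ^ i) * a (2 * j - i))"
      using not_dvd_G_power by (simp add: chi_mult chi_square)
    also have "\<dots> = chi ((G ^ i * (G ^ i * G ^ (2 * j - i))) * ((G ^ i * G ^ (2 * j - i))\<^sup>2 - (G ^ i)\<^sup>2))"
      unfolding a_def by (simp only: chi_mult[symmetric]) (simp add: power2_eq_square algebra_simps)
    also have "\<dots> = chi ((G ^ i * - 1) * ((- 1)\<^sup>2 - (G ^ i)\<^sup>2))"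
      unfolding e' by (intro chi_cong cong_mult cong_diff cong_pow G_power_half cong_refl)
    also have "\<dots> = a i"
      unfolding a_def by (simp add: algebra_simps)
    finally show ?thesis .
  qed
  have odd: "odd (a i)" if "0 < i" "i < 2 * j" for i
  proof -
    have "\<not> int p dvd (G ^ i)\<^sup>2 - 1"
    proof
      assume "int p dvd (G ^ i)\<^sup>2 - 1"
      then have "[G ^ (i * 2) = 1] (mod int p)" by (simp add: power_mult cong_iff_dvd_diff)
      then have "(p - 1) dvd i * 2" by (simp only: G_power_eq_1_iff)
      then show False using that p_4j by (auto dest: dvd_imp_le)
    qed
    then have "a i \<noteq> 0"
      unfolding a_def using not_dvd_G_power prime_int_p by (simp add: chi_eq_0_iff prime_dvd_mult_iff)
    moreover have "a i = 0 \<or> a i = 1 \<or> a i = - 1" unfolding a_def by (rule chi_cases)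
    ultimately show ?thesis by auto
  qed
  have split: "(\<Sum>i<j. f i) = f 0 + (\<Sum>i\<in>{1..<j}. f i)" for f :: "nat \<Rightarrow> int"
    using j_pos by (simp add: lessThan_atLeast0 sum.atLeast_Suc_lessThan)
  have "X = (\<Sum>i<j + j. a i)" by (simp add: X_def a_def mult_2)
  also have "\<dots> = 1 + (\<Sum>i\<in>{1..<j}. a i) + (\<Sum>i\<in>{1..<j}. a (i + j))"
    unfolding sum_lessThan_add split[of a] split[of "\<lambda>i. a (i + j)"] using a0 aj by simp
  also have "(\<Sum>i\<in>{1..<j}. a (i + j)) = (\<Sum>i\<in>{1..<j}. a (2 * j - i))"
    by (rule sum.reindex_bij_witness[of _ "\<lambda>i. j - i" "\<lambda>i. j - i"]) (auto simp: add.commute)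
  also have "\<dots> = (\<Sum>i\<in>{1..<j}. a i)"
    by (intro sum.cong refl reflect) auto
  \<comment> \<open>Every \<open>a i\<close> here is odd, so each difference is even and the factor
    2 in front gives divisibility by 4.\<close>
  finally have "X - (2 * int j - 1) = 2 * (\<Sum>i\<in>{1..<j}. a i - 1)"
    using j_pos by (simp add: sum_subtractf of_nat_diff)
  moreover have "even (\<Sum>i\<in>{1..<j}. a i - 1)"
    by (rule dvd_sum) (use odd in auto)
  ultimately show ?thesis by (auto simp: cong_iff_dvd_diff elim!: evenE)
qed

text \<open>Uniqueness of the representation of \<open>p\<close> as a sum of two squares identifies
  \<open>x\<close> with \<open>X\<close> up to sign, and residues modulo 4 fix the sign.\<close>

lemma two_squares_phi:
  assumes xy: "int p = x\<^sup>2 + y\<^sup>2" and x: "[x = 1] (mod 4)" and y: "even y"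
  shows "2 * x = - ((- 1) ^ j * phi (- 1))"
proof -
  define Y where "Y = (\<Sum>i<2 * j. chi (G ^ i * ((G ^ i)\<^sup>2 + G)))"
  have XY: "int p = X\<^sup>2 + Y\<^sup>2"
    using phi_norm phi_X phi_even[of G] by (simp add: Y_def power_mult_distrib)
  have oddX: "odd X" using X_mod_4 by (auto simp: cong_iff_dvd_diff elim!: dvdE) presburger
  have oddx: "odd x" using x by (auto simp: cong_iff_dvd_diff elim!: dvdE) presburger
  have evenY: "even Y"
    using XY oddX odd_p by (metis even_add even_of_nat even_power zero_less_numeral)
  have e: "y\<^sup>2 = int p - x\<^sup>2" "Y\<^sup>2 = int p - X\<^sup>2" using xy XY by simp_all
  have "(x * Y - y * X) * (x * Y + y * X) = int p * (x\<^sup>2 - X\<^sup>2)"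
  proof -
    have "(x * Y - y * X) * (x * Y + y * X) = x\<^sup>2 * Y\<^sup>2 - y\<^sup>2 * X\<^sup>2"
      by (simp add: power2_eq_square algebra_simps)
    also have "\<dots> = x\<^sup>2 * (int p - X\<^sup>2) - (int p - x\<^sup>2) * X\<^sup>2" by (simp only: e)
    finally show ?thesis by (simp add: algebra_simps)
  qed
  then have "int p dvd x * Y - y * X \<or> int p dvd x * Y + y * X"
    using prime_int_p by (metis dvd_triv_left prime_dvd_mult_iff)
  moreover have bound: "x * Y - s * y * X = 0" if "int p dvd x * Y - s * y * X" "s = 1 \<or> s = - 1" for s
  proof (rule ccontr)
    assume nz: "x * Y - s * y * X \<noteq> 0"
    \<comment> \<open>Parity supplies the factor 2 that excludes the value \<open>p\<close> itself,
      which would correspond to interchanging the two squares. The two-squares product identity then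
      bounds the expression by \<open>p\<close>.\<close>
    have "even (x * Y - s * y * X)" using evenY y by simp
    then have "2 * int p dvd x * Y - s * y * X"
      using that(1) odd_p by (intro divides_mult) auto
    then have "2 * int p \<le> \<bar>x * Y - s * y * X\<bar>"
      using nz dvd_imp_le_int[of "x * Y - s * y * X" "2 * int p"] by simp
    then have "(2 * int p)\<^sup>2 \<le> (x * Y - s * y * X)\<^sup>2"
      by (metis abs_le_square_iff abs_of_nonneg of_nat_0_le_iff mult_nonneg_nonneg zero_le_numeral)
    also have "\<dots> \<le> (x * Y - s * y * X)\<^sup>2 + (x * X + s * y * Y)\<^sup>2" by simp
    also have "\<dots> = (x\<^sup>2 + y\<^sup>2) * (X\<^sup>2 + Y\<^sup>2)"
      using that(2) by (auto simp: power2_eq_square algebra_simps)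
    also have "\<dots> = int p * int p" by (simp only: xy[symmetric] XY[symmetric])
    finally show False using p_gt_2 by (simp add: power2_eq_square)
  qed
  ultimately have "x * Y = y * X \<or> x * Y = - (y * X)"
    using bound[of 1] bound[of "- 1"] by auto
  then have "x\<^sup>2 * Y\<^sup>2 = y\<^sup>2 * X\<^sup>2" by (metis power2_minus power_mult_distrib)
  then have "x\<^sup>2 * (int p - X\<^sup>2) = (int p - x\<^sup>2) * X\<^sup>2"
    unfolding e .
  then have "int p * x\<^sup>2 = int p * X\<^sup>2" by (simp add: algebra_simps)
  then have "x\<^sup>2 = X\<^sup>2" using p_gt_2 by simp
  then have xX: "x = X \<or> x = - X" by (simp add: power2_eq_iff)
  \<comment> \<open>\<open>X\<close> is \<open>2 * j - 1\<close> modulo 4, that is -1 for even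
    \<open>j\<close> and 1 for odd \<open>j\<close>, whereas \<open>x\<close> is 1.\<close>
  show ?thesis
  proof (cases "even j")
    case True
    then have "[X = - 1] (mod 4)"
      using X_mod_4 by (auto simp: cong_iff_dvd_diff elim!: evenE dvdE) presburger
    then have "x \<noteq> X" using x by (auto simp: cong_iff_dvd_diff) presburger
    then show ?thesis using xX True phi_X by simp
  next
    case False
    then have "[X = 1] (mod 4)"
      using X_mod_4 by (auto simp: cong_iff_dvd_diff elim!: oddE dvdE) presburger
    then have "x \<noteq> - X" using x by (auto simp: cong_iff_dvd_diff) presburger
    then show ?thesis using xX False phi_X by simp
  qed
qed

text \<open>A geometric sum: \<open>G ^ m\<close> is a root of unity of order dividing
  \<open>p - 1\<close> even modulo \<open>p ^ 2\<close>, and \<open>G ^ m - 1\<close> is invertible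
  unless \<open>p - 1\<close> divides \<open>m\<close>.\<close>

lemma sum_G_powers:
  "[(\<Sum>i<4 * j. G ^ (i * m)) = (if 4 * j dvd m then 4 * int j else 0)] (mod int p ^ 2)"
proof (cases "4 * j dvd m")
  case True
  then obtain k where k: "m = 4 * j * k" by (elim dvdE)
  have "[G ^ (i * m) = 1] (mod int p ^ 2)" for i
  proof -
    have "p - 1 = 4 * j" using p_4j by simp
    then have "[(G ^ (4 * j)) ^ (i * k) = 1 ^ (i * k)] (mod int p ^ 2)"
      using G_power_p2 by (intro cong_pow) simp
    then show ?thesis by (simp add: k power_mult[symmetric] ac_simps)
  qed
  then have "[(\<Sum>i<4 * j. G ^ (i * m)) = (\<Sum>i<4 * j. 1)] (mod int p ^ 2)"
    by (intro cong_sum)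
  then show ?thesis using True by simp
next
  case False
  have p1: "p - 1 = 4 * j" using p_4j by simp
  have "(G ^ m - 1) * (\<Sum>i<4 * j. (G ^ m) ^ i) = (G ^ m) ^ (4 * j) - 1"
    by (rule power_diff_1_eq[symmetric])
  also have "(G ^ m) ^ (4 * j) = (G ^ (4 * j)) ^ m" by (simp add: power_mult[symmetric] mult.commute)
  finally have "(G ^ m - 1) * (\<Sum>i<4 * j. G ^ (i * m)) = (G ^ (4 * j)) ^ m - 1"
    by (simp add: power_mult[symmetric] mult.commute)
  moreover have "[(G ^ (4 * j)) ^ m = 1 ^ m] (mod int p ^ 2)"
    using G_power_p2 p1 by (intro cong_pow) simp
  ultimately have "int p ^ 2 dvd (G ^ m - 1) * (\<Sum>i<4 * j. G ^ (i * m))"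
    by (simp add: cong_iff_dvd_diff)
  moreover have "\<not> int p dvd G ^ m - 1"
    using False G_power_eq_1_iff[of m] p1 by (simp add: cong_iff_dvd_diff)
  then have "coprime (int p ^ 2) (G ^ m - 1)"
    using prime_int_p by (simp add: prime_imp_coprime)
  ultimately have "int p ^ 2 dvd (\<Sum>i<4 * j. G ^ (i * m))"
    by (simp add: coprime_dvd_mult_right_iff)
  then show ?thesis using False by (simp add: cong_0_iff)
qed

text \<open>In the binomial expansion only the terms whose total degree \<open>N + 2 * k\<close> is
  a multiple of \<open>p - 1\<close> survive.\<close>

lemma sum_G_cubic_power:
  "[(\<Sum>i<4 * j. (G ^ i * ((G ^ i)\<^sup>2 - 1)) ^ N)
    = 4 * int j * (\<Sum>k\<in>{k. k \<le> N \<and> 4 * j dvd N + 2 * k}. int (N choose k) * (- 1) ^ (N - k))] (mod int p ^ 2)"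
proof -
  have "(G ^ i * ((G ^ i)\<^sup>2 - 1)) ^ N = (\<Sum>k\<le>N. int (N choose k) * (- 1) ^ (N - k) * G ^ (i * (N + 2 * k)))" for i
  proof -
    have "(G ^ i * ((G ^ i)\<^sup>2 - 1)) ^ N = (G ^ i) ^ N * ((G ^ i)\<^sup>2 + - 1) ^ N"
      by (simp add: power_mult_distrib)
    also have "\<dots> = (\<Sum>k\<le>N. (G ^ i) ^ N * (int (N choose k) * ((G ^ i)\<^sup>2) ^ k * (- 1) ^ (N - k)))"
      unfolding binomial_ring sum_distrib_left by simp
    also have "\<dots> = (\<Sum>k\<le>N. int (N choose k) * (- 1) ^ (N - k) * G ^ (i * (N + 2 * k)))"
      by (intro sum.cong refl) (simp add: power_mult[symmetric] power_add algebra_simps)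
    finally show ?thesis .
  qed
  then have e1: "(\<Sum>i<4 * j. (G ^ i * ((G ^ i)\<^sup>2 - 1)) ^ N)
      = (\<Sum>k\<le>N. int (N choose k) * (- 1) ^ (N - k) * (\<Sum>i<4 * j. G ^ (i * (N + 2 * k))))"
    by (simp only: sum_distrib_left) (rule sum.swap)
  have c: "[(\<Sum>k\<le>N. int (N choose k) * (- 1) ^ (N - k) * (\<Sum>i<4 * j. G ^ (i * (N + 2 * k))))
      = (\<Sum>k\<le>N. int (N choose k) * (- 1) ^ (N - k) * (if 4 * j dvd N + 2 * k then 4 * int j else 0))] (mod int p ^ 2)"
    by (intro cong_sum cong_mult cong_refl sum_G_powers)
  have e2: "(\<Sum>k\<le>N. int (N choose k) * (- 1) ^ (N - k) * (if 4 * j dvd N + 2 * k then 4 * int j else 0))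
      = (\<Sum>k\<in>{k. k \<le> N \<and> 4 * j dvd N + 2 * k}. 4 * int j * (int (N choose k) * (- 1) ^ (N - k)))"
    by (rule sum.mono_neutral_cong_right) auto
  show ?thesis using c unfolding e1 e2 by (simp only: sum_distrib_left)
qed

text \<open>If \<open>s\<close> differs from a sign by a multiple of \<open>p\<close>, then
  \<open>3 * s - s ^ 3\<close> differs from twice that sign by a multiple of \<open>p ^ 2\<close>;
  apply this to \<open>s = u ^ (2 * j)\<close>. If \<open>p\<close> divides \<open>u\<close>, the
  exponent is at least 2 and both powers vanish.\<close>

lemma two_chi: "[2 * chi u = 3 * u ^ (2 * j) - u ^ (6 * j)] (mod int p ^ 2)"
proof (cases "int p dvd u")
  case True
  have "int p ^ 2 dvd u ^ (2 * j)"
    using dvd_power_same[OF True, of 2] j_pos by (metis dvd_trans le_imp_power_dvd mult_le_mono2 nat_mult_1_right One_nat_def Suc_leI mult.commute)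
  moreover have "u ^ (6 * j) = u ^ (2 * j) * u ^ (4 * j)" by (simp add: power_add[symmetric])
  ultimately show ?thesis using True chi_eq_0_iff[of u] by (simp add: cong_iff_dvd_diff)
next
  case False
  obtain z where z: "u ^ (2 * j) = chi u + int p * z"
    using chi_euler_j[of u] by (metis cong_iff_lin cong_sym)
  have e: "chi u * chi u = 1" using chi_square[OF False] .
  have "u ^ (6 * j) = (u ^ (2 * j)) ^ 3" by (simp add: power_mult[symmetric])
  then have "3 * u ^ (2 * j) - u ^ (6 * j) = 3 * (chi u + int p * z) - (chi u + int p * z) ^ 3"
    by (simp only: z)
  also have "\<dots> = (3 * (chi u + int p * z) - chi u * (chi u * chi u) - 3 * (chi u * chi u) * (int p * z))
     - int p ^ 2 * (z ^ 2 * (3 * chi u + int p * z))"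
    by (simp add: power2_eq_square power3_eq_cube algebra_simps)
  also have "\<dots> = 2 * chi u - int p ^ 2 * (z ^ 2 * (3 * chi u + int p * z))"
    by (simp add: e)
  finally show ?thesis by (simp add: cong_iff_dvd_diff)
qed

text \<open>\<open>two_chi\<close> needs the power sums for \<open>N = 2 * j\<close> and
  \<open>N = 6 * j\<close>. Degrees divisible by \<open>4 * j\<close> leave \<open>k = j\<close> in
  the first and \<open>k = j, 3 * j, 5 * j\<close> in the second, all with the sign
  \<open>(- 1) ^ j\<close>.\<close>

lemma two_phi:
  "[2 * phi (- 1) = 4 * int j * (- 1) ^ j *
     (3 * int (2 * j choose j) - 2 * int (6 * j choose j) - int (6 * j choose (3 * j)))] (mod int p ^ 2)"
proof -
  have s2: "{k. k \<le> 2 * j \<and> 4 * j dvd 2 * j + 2 * k} = {j}"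
  proof (intro equalityI subsetI)
    fix k assume k: "k \<in> {k. k \<le> 2 * j \<and> 4 * j dvd 2 * j + 2 * k}"
    then obtain q where q: "2 * j + 2 * k = 4 * j * q" by (auto elim: dvdE)
    have "q = 1"
    proof (rule ccontr)
      assume "q \<noteq> 1"
      then have "q = 0 \<or> q \<ge> 2" by linarith
      then show False
      proof
        assume "q \<ge> 2"
        then have "4 * j * 2 \<le> 4 * j * q" by (intro mult_le_mono2)
        moreover have "k \<le> 2 * j" using k by simp
        ultimately show False using q j_pos by linarith
      qed (use q j_pos in simp)
    qed
    then show "k \<in> {j}" using q by simp
  qed simp
  have s6: "{k. k \<le> 6 * j \<and> 4 * j dvd 6 * j + 2 * k} = {j, 3 * j, 5 * j}"
  proof (intro equalityI subsetI)
    fix k assume k: "k \<in> {k. k \<le> 6 * j \<and> 4 * j dvd 6 * j + 2 * k}"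
    then obtain q where q: "6 * j + 2 * k = 4 * j * q" by (auto elim: dvdE)
    have k6: "k \<le> 6 * j" using k by simp
    have "\<not> 5 \<le> q"
    proof
      assume "5 \<le> q"
      then have "4 * j * 5 \<le> 4 * j * q" by (intro mult_le_mono2)
      then show False using q k6 j_pos by linarith
    qed
    moreover have "\<not> q \<le> 1"
    proof
      assume "q \<le> 1"
      then have "4 * j * q \<le> 4 * j * 1" by (intro mult_le_mono2)
      then show False using q k6 j_pos by linarith
    qed
    ultimately have "q = 2 \<or> q = 3 \<or> q = 4" by linarith
    then show "k \<in> {j, 3 * j, 5 * j}" using q by auto
  next
    fix k assume "k \<in> {j, 3 * j, 5 * j}"
    then consider "k = j" | "k = 3 * j" | "k = 5 * j" by blast
    then show "k \<in> {k. k \<le> 6 * j \<and> 4 * j dvd 6 * j + 2 * k}"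
    proof cases
      case 1 then show ?thesis by (auto intro!: dvdI[of _ _ 2])
    next
      case 2 then show ?thesis by (auto intro!: dvdI[of _ _ 3])
    next
      case 3 then show ?thesis by (auto intro!: dvdI[of _ _ 4])
    qed
  qed
  have sgn: "(- 1 :: int) ^ (3 * j) = (- 1) ^ j" "(- 1 :: int) ^ (5 * j) = (- 1) ^ j"
    by (simp_all add: minus_one_power_iff)
  have sym: "6 * j choose (5 * j) = 6 * j choose j"
    using binomial_symmetric[of "5 * j" "6 * j"] by simp
  have diffs: "2 * j - j = j" "6 * j - j = 5 * j" "6 * j - 3 * j = 3 * j" "6 * j - 5 * j = j" by simp_all
  have ne: "j \<noteq> 3 * j" "j \<noteq> 5 * j" "3 * j \<noteq> 5 * j" using j_pos by auto
  have e1: "2 * phi (- 1) = (\<Sum>i<4 * j. 2 * chi (G ^ i * ((G ^ i)\<^sup>2 - 1)))"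
    by (simp add: phi_eq_sum_G sum_distrib_left)
  have c1: "[(\<Sum>i<4 * j. 2 * chi (G ^ i * ((G ^ i)\<^sup>2 - 1))) = (\<Sum>i<4 * j. 3 * (G ^ i * ((G ^ i)\<^sup>2 - 1)) ^ (2 * j) - (G ^ i * ((G ^ i)\<^sup>2 - 1)) ^ (6 * j))] (mod int p ^ 2)"
    by (intro cong_sum two_chi)
  have e2: "(\<Sum>i<4 * j. 3 * (G ^ i * ((G ^ i)\<^sup>2 - 1)) ^ (2 * j) - (G ^ i * ((G ^ i)\<^sup>2 - 1)) ^ (6 * j))
    = 3 * (\<Sum>i<4 * j. (G ^ i * ((G ^ i)\<^sup>2 - 1)) ^ (2 * j)) - (\<Sum>i<4 * j. (G ^ i * ((G ^ i)\<^sup>2 - 1)) ^ (6 * j))"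
    by (simp only: sum_subtractf sum_distrib_left)
  have c2: "[3 * (\<Sum>i<4 * j. (G ^ i * ((G ^ i)\<^sup>2 - 1)) ^ (2 * j)) - (\<Sum>i<4 * j. (G ^ i * ((G ^ i)\<^sup>2 - 1)) ^ (6 * j))
    = 3 * (4 * int j * (\<Sum>k\<in>{j}. int (2 * j choose k) * (- 1) ^ (2 * j - k)))
      - 4 * int j * (\<Sum>k\<in>{j, 3 * j, 5 * j}. int (6 * j choose k) * (- 1) ^ (6 * j - k))] (mod int p ^ 2)"
    using sum_G_cubic_power[of "2 * j"] sum_G_cubic_power[of "6 * j"] unfolding s2 s6
    by (intro cong_diff cong_mult cong_refl)
  have e3: "3 * (4 * int j * (\<Sum>k\<in>{j}. int (2 * j choose k) * (- 1) ^ (2 * j - k)))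
      - 4 * int j * (\<Sum>k\<in>{j, 3 * j, 5 * j}. int (6 * j choose k) * (- 1) ^ (6 * j - k))
     = 4 * int j * (- 1) ^ j * (3 * int (2 * j choose j) - 2 * int (6 * j choose j) - int (6 * j choose (3 * j)))"
  proof -
    have "(\<Sum>k\<in>{j, 3 * j, 5 * j}. f k) = f j + f (3 * j) + f (5 * j)" for f :: "nat \<Rightarrow> int"
      using ne by simp
    moreover have "(\<Sum>k\<in>{j}. f k) = f j" for f :: "nat \<Rightarrow> int" by simp
    ultimately show ?thesis by (simp only: diffs sgn sym) (simp add: algebra_simps)
  qed
  show ?thesis
    using cong_trans[OF c1[unfolded e2] c2] unfolding e1 e3 .
qed

end

section \<open>The two-squares representation modulo the square of \<open>p\<close>\<close>

lemma sum_even_odd: "(\<Sum>i<2 * m. f i) = (\<Sum>i<m. f (2 * i) + f (2 * i + 1))"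
  for f :: "nat \<Rightarrow> 'a :: comm_monoid_add"
  by (induction m) (simp_all add: ac_simps)

text \<open>For \<open>n = p\<close> the inner binomial coefficients are divisible by
  \<open>p\<close>, so the real part of \<open>(1 + \<i>) ^ p\<close> gives access to powers of 2
  modulo \<open>p\<close> and, through harmonic numbers, modulo \<open>p ^ 2\<close>.\<close>

lemma sum_binomial_even_alternating:
  assumes "odd n"
  shows "real_of_int (\<Sum>m<(n + 1) div 2. (- 1) ^ m * int (n choose (2 * m))) = Re ((1 + \<i>) ^ n)"
proof -
  define K where "K = (n + 1) div 2"
  have n: "{..n} = {..<2 * K}" using assms by (auto simp: K_def)
  have "(1 + \<i>) ^ n = (\<Sum>k\<le>n. of_nat (n choose k) * \<i> ^ k)"
    using binomial_ring[of \<i> 1 n] by (simp add: add.commute)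
  also have "\<dots> = (\<Sum>m<K. of_nat (n choose (2 * m)) * (- 1) ^ m + of_nat (n choose (2 * m + 1)) * ((- 1) ^ m * \<i>))"
  proof -
    have "\<i> ^ (2 * m) = (- 1) ^ m" for m by (simp add: power_mult)
    then show ?thesis unfolding n sum_even_odd by (simp add: mult.commute)
  qed
  finally have "Re ((1 + \<i>) ^ n) = (\<Sum>m<K. Re (of_nat (n choose (2 * m)) * (- 1) ^ m + of_nat (n choose (2 * m + 1)) * ((- 1) ^ m * \<i>)))"
    by simp
  also have "\<dots> = (\<Sum>m<K. (- 1) ^ m * real (n choose (2 * m)))"
  proof (intro sum.cong refl)
    fix m
    have "(- 1 :: complex) ^ m = of_real ((- 1) ^ m)" by simp
    then show "Re (of_nat (n choose (2 * m)) * (- 1) ^ m + of_nat (n choose (2 * m + 1)) * ((- 1) ^ m * \<i>))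
      = (- 1) ^ m * real (n choose (2 * m))"
      by (simp only: plus_complex.sel times_complex.sel) (simp add: minus_one_power_iff)
  qed
  finally show ?thesis by (simp add: K_def)
qed

lemma one_plus_ii_power_4: "(1 + \<i>) ^ (4 * j) = (- 4) ^ j"
proof -
  have "(1 + \<i>) ^ 4 = - 4" by (simp add: eval_nat_numeral algebra_simps)
  then show ?thesis by (simp add: power_mult)
qed

lemma of_real_neg4_power: "(- 4 :: complex) ^ j = of_real ((- 4) ^ j)"
  by simp

lemma sum_binomial_even_alternating_1:
  "(\<Sum>m<2 * j + 1. (- 1) ^ m * int ((4 * j + 1) choose (2 * m))) = (- 4) ^ j"
proof -
  have "Re ((1 + \<i>) ^ (4 * j + 1)) = (- 4) ^ j"
    unfolding power_add one_plus_ii_power_4 of_real_neg4_power by (simp del: of_real_power)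
  moreover have "(4 * j + 1 + 1) div 2 = 2 * j + 1" by simp
  ultimately have "real_of_int (\<Sum>m<2 * j + 1. (- 1) ^ m * int ((4 * j + 1) choose (2 * m))) = real_of_int ((- 4) ^ j)"
    using sum_binomial_even_alternating[of "4 * j + 1"] by (simp only:) simp
  then show ?thesis by (simp only: of_int_eq_iff)
qed

lemma sum_binomial_even_alternating_3:
  "(\<Sum>m<2 * j + 2. (- 1) ^ m * int ((4 * j + 3) choose (2 * m))) = - 2 * (- 4) ^ j"
proof -
  have "(1 + \<i>) ^ 3 = - 2 + 2 * \<i>" by (simp add: eval_nat_numeral algebra_simps)
  then have "Re ((1 + \<i>) ^ (4 * j + 3)) = - 2 * (- 4) ^ j"
    unfolding power_add one_plus_ii_power_4 of_real_neg4_power by (simp del: of_real_power)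
  moreover have "(4 * j + 3 + 1) div 2 = 2 * j + 2" by simp
  ultimately have "real_of_int (\<Sum>m<2 * j + 2. (- 1) ^ m * int ((4 * j + 3) choose (2 * m))) = real_of_int (- 2 * (- 4) ^ j)"
    using sum_binomial_even_alternating[of "4 * j + 3"] by (simp only:) simp
  then show ?thesis by (simp only: of_int_eq_iff)
qed

section \<open>Binomial coefficients and factorials modulo \<open>p\<close> and
  \<open>p ^ 2\<close>\<close>

lemma fact_add_prod: "fact (n + k) = fact n * (\<Prod>i<k. rat_of_nat (n + 1 + i))"
  by (induction k) (simp_all add: ac_simps)

text \<open>Catalan's identity 1 - 1/2 + ... - 1/(2j) = 1/(j+1) + ... + 1/(2j), with the sign
  reversed.\<close>

lemma alternating_harmonic:
  "(\<Sum>i<2 * j. (- 1) ^ (i + 1) / rat_of_nat (i + 1)) = - (\<Sum>i<j. 1 / rat_of_nat (j + 1 + i))"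
proof (induction j)
  case (Suc j)
  define x where "x = rat_of_nat j"
  have nz: "x + 1 \<noteq> 0" unfolding x_def by (metis of_nat_Suc of_nat_eq_0_iff nat.simps(3) add.commute)
  have shift: "(\<Sum>i<Suc j. 1 / rat_of_nat (j + 1 + i)) = 1 / (x + 1) + (\<Sum>i<j. 1 / rat_of_nat (Suc j + 1 + i))"
    unfolding sum.lessThan_Suc_shift by (simp add: x_def ac_simps)
  have a: "(\<Sum>i<j. 1 / rat_of_nat (Suc j + 1 + i)) = (\<Sum>i<j. 1 / rat_of_nat (j + 1 + i)) + 1 / (2 * x + 1) - 1 / (x + 1)"
    using shift by (simp add: x_def ac_simps)
  have b: "(\<Sum>i<Suc j. 1 / rat_of_nat (Suc j + 1 + i)) = (\<Sum>i<j. 1 / rat_of_nat (Suc j + 1 + i)) + 1 / (2 * (x + 1))"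
    by (simp add: x_def ac_simps)
  have "(\<Sum>i<2 * Suc j. (- 1) ^ (i + 1) / rat_of_nat (i + 1))
     = - (\<Sum>i<j. 1 / rat_of_nat (j + 1 + i)) - 1 / (2 * x + 1) + 1 / (2 * (x + 1))"
    using Suc by (simp add: x_def ac_simps)
  also have "1 / (2 * (x + 1)) = 1 / (x + 1) - 1 / (2 * (x + 1))" using nz by (simp add: field_simps)
  finally show ?case unfolding b a by simp
qed simp

context prime_modulus
begin

lemma Up_of_nat_less: "0 < k \<Longrightarrow> k < p \<Longrightarrow> of_nat k \<in> Up"
  by (rule Up_of_nat) (auto dest: dvd_imp_le)

lemma Up_fact: "k < p \<Longrightarrow> fact k \<in> Up"
  by (induction k) (use Up_of_nat_less in \<open>auto simp del: of_nat_Suc\<close>)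

lemma pcong_prod_one_plus:
  assumes "\<And>i. i \<in> S \<Longrightarrow> a i \<in> Zp"
  shows "pcong 2 (\<Prod>i\<in>S. 1 + of_nat p * a i) (1 + of_nat p * (\<Sum>i\<in>S. a i))"
  using assms
proof (induction S rule: infinite_finite_induct)
  case (insert x F)
  have Z: "a x \<in> Zp" "sum a F \<in> Zp" using insert.prems by auto
  have "pcong 2 ((1 + of_nat p * a x) * (\<Prod>i\<in>F. 1 + of_nat p * a i)) ((1 + of_nat p * a x) * (1 + of_nat p * sum a F))"
    using insert Z by (intro pcong_mult_left) auto
  also have "pcong 2 ((1 + of_nat p * a x) * (1 + of_nat p * sum a F)) (1 + of_nat p * (a x + sum a F))"
    by (rule pcongI[of _ _ _ "a x * sum a F"]) (use Z in \<open>auto simp: power2_eq_square algebra_simps\<close>)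
  finally show ?case using insert by simp
qed auto

lemma pcong_p_mult_2: "pcong 1 a b \<Longrightarrow> pcong 2 (of_nat p * a) (of_nat p * b)"
  using pcong_p_mult[of 1 a b] by (simp add: numeral_2_eq_2)

lemma choose_p_minus_1: "k < p \<Longrightarrow> pcong 1 (of_nat ((p - 1) choose k)) ((- 1) ^ k)"
proof (induction k)
  case (Suc k)
  have "p dvd p choose Suc k" using Suc.prems prime_p by (intro dvd_choose_prime) auto
  then have "pcong 1 (of_nat (p choose Suc k)) 0"
    by (auto elim!: dvdE intro!: pcong_p_0 simp: numeral_eq_Suc)
  moreover have "p choose Suc k = ((p - 1) choose k) + ((p - 1) choose Suc k)"
    using binomial_Suc_Suc[of "p - 1" k] prime_gt_0_nat[OF prime_p] by simp
  ultimately have "pcong 1 (of_nat ((p - 1) choose k) + of_nat ((p - 1) choose Suc k)) 0"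
    by (simp only: of_nat_add)
  then have "pcong 1 (of_nat ((p - 1) choose k) + of_nat ((p - 1) choose Suc k) - of_nat ((p - 1) choose k)) (0 - (- 1) ^ k)"
    using Suc by (intro pcong_diff) auto
  then show ?case by simp
qed simp

lemma choose_p:
  assumes "0 < k" "k < p"
  shows "pcong 2 (of_nat (p choose k)) (- of_nat p * (- 1) ^ k / of_nat k)"
proof -
  obtain i where k: "k = Suc i" using assms by (cases k) auto
  have "Suc i * (p choose Suc i) = p * ((p - 1) choose i)"
    by (rule binomial_absorption)
  then have "rat_of_nat (Suc i * (p choose Suc i)) = of_nat (p * ((p - 1) choose i))" by simp
  then have e: "of_nat (p choose k) = of_nat p * (of_nat ((p - 1) choose i) / rat_of_nat k)"
    unfolding k of_nat_mult by (simp add: field_simps del: of_nat_Suc)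
  have "pcong 1 (of_nat ((p - 1) choose i) / rat_of_nat k) ((- 1) ^ i / of_nat k)"
    using assms k by (intro pcong_divide choose_p_minus_1 pcong_refl Up_of_nat_less) auto
  then have "pcong (Suc 1) (of_nat (p choose k)) (of_nat p * ((- 1) ^ i / of_nat k))"
    unfolding e by (rule pcong_p_mult)
  then show ?thesis by (simp add: k numeral_2_eq_2)
qed

text \<open>Starts from Wilson's theorem; each step trades the largest factor
  \<open>p - Suc k\<close> for \<open>- Suc k\<close>.\<close>

lemma pcong_fact_fact:
  "k < p \<Longrightarrow> pcong 1 (fact (p - 1 - k) * fact k) ((- 1) ^ (k + 1))"
proof (induction k)
  case 0
  have "[fact (p - 1) = - 1 :: int] (mod int p)" using wilson_theorem[OF prime_p] by simp
  then have "pcong 1 (of_int (fact (p - 1))) (of_int (- 1))" by (intro pcong_of_int) simp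
  then show ?case by simp
next
  case (Suc k)
  define m where "m = p - 1 - Suc k"
  have m: "p - 1 - k = Suc m" "rat_of_nat (Suc m) = of_nat p - of_nat (Suc k)"
    using Suc.prems by (auto simp: m_def of_nat_diff)
  have "fact (Suc m) * fact k = of_nat p * (fact m * fact k) - (fact m * fact (Suc k) :: rat)"
    unfolding fact_Suc m(2) by (simp add: algebra_simps)
  then have "pcong 1 (of_nat p * (fact m * fact k) - (fact m * fact (Suc k) :: rat)) ((- 1) ^ (k + 1))"
    using Suc m(1) by simp
  then have "pcong 1 (of_nat p * (fact m * fact k) - (of_nat p * (fact m * fact k) - (fact m * fact (Suc k) :: rat))) (0 - (- 1) ^ (k + 1))"
    using pcong_p_0[of "fact m * fact k"] Zp_of_nat[of "fact m * fact k"]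
    by (intro pcong_diff) auto
  then show ?case by (simp add: m_def)
qed

end

context odd_prime_modulus
begin

lemma Up_2: "2 \<in> Up"
  using Up_of_nat_less[of 2] p_gt_2 by simp

lemma Up_4: "4 \<in> Up"
proof -
  have "2 * 2 \<in> Up" by (intro Up_mult Up_2)
  then show ?thesis by simp
qed

end

context prime_1_mod_4
begin

lemma less_p: "i \<le> 4 * j \<Longrightarrow> i < p"
  using p_4j by linarith

lemma p_minus_1: "p - 1 = 4 * j"
  using p_4j by simp

text \<open>The harmonic difference H(2j) - H(j). It is the first-order term in \<open>p\<close>
  both of \<open>(- 4) ^ j\<close> and of \<open>6 * j choose j\<close>, which is why no Fermat
  quotient of 2 is left in the end.\<close>

definition hj :: rat where "hj = (\<Sum>i<j. 1 / of_nat (j + 1 + i))"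

lemma hj_Zp: "hj \<in> Zp"
  unfolding hj_def by (intro Zp_sum Zp_divide Up_of_nat_less less_p) auto

text \<open>Real part of \<open>(1 + \<i>) ^ p\<close>, with each \<open>p choose (2 * m)\<close>
  replaced by \<open>- p / (2 * m)\<close> and the alternating harmonic sum rewritten as
  \<open>hj\<close>.\<close>

lemma neg4_power: "pcong 2 ((- 4) ^ j) (1 + of_nat p * hj / 2)"
proof -
  have "(- 4) ^ j = (of_int (\<Sum>m<2 * j + 1. (- 1) ^ m * int (p choose (2 * m))) :: rat)"
    using sum_binomial_even_alternating_1[of j] unfolding p_4j[symmetric] by simp
  also have "\<dots> = (\<Sum>m<Suc (2 * j). (- 1) ^ m * of_nat (p choose (2 * m)))" by simp
  also have "\<dots> = 1 + (\<Sum>i<2 * j. (- 1) ^ (i + 1) * of_nat (p choose (2 * (i + 1))))"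
    by (subst sum.lessThan_Suc_shift) simp
  finally have e: "(- 4) ^ j = 1 + (\<Sum>i<2 * j. (- 1) ^ (i + 1) * rat_of_nat (p choose (2 * (i + 1))))" .
  have "pcong 2 (\<Sum>i<2 * j. (- 1) ^ (i + 1) * rat_of_nat (p choose (2 * (i + 1))))
     (\<Sum>i<2 * j. (- 1) ^ (i + 1) * (- of_nat p * (- 1) ^ (2 * (i + 1)) / of_nat (2 * (i + 1))))"
    by (intro pcong_sum pcong_mult_left choose_p less_p) auto
  also have "(\<Sum>i<2 * j. (- 1) ^ (i + 1) * (- of_nat p * (- 1) ^ (2 * (i + 1)) / of_nat (2 * (i + 1))))
      = - of_nat p / 2 * (\<Sum>i<2 * j. (- 1) ^ (i + 1) / rat_of_nat (i + 1))"
    unfolding sum_distrib_left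
  proof (intro sum.cong refl)
    fix i
    have "(- 1 :: rat) ^ (2 * (i + 1)) = 1" by (simp add: power_mult)
    moreover have "rat_of_nat (2 * (i + 1)) = 2 * of_nat (i + 1)" by simp
    moreover have "s * (- q * 1 / (2 * y)) = - q / 2 * (s / y)" for s q y :: rat by simp
    ultimately show "(- 1) ^ (i + 1) * (- of_nat p * (- 1) ^ (2 * (i + 1)) / of_nat (2 * (i + 1)))
      = - of_nat p / 2 * ((- 1) ^ (i + 1) / rat_of_nat (i + 1))"
      by (simp only:)
  qed
  also have "\<dots> = of_nat p * hj / 2"
    unfolding alternating_harmonic by (simp add: hj_def)
  finally show ?thesis unfolding e by (intro pcong_add pcong_refl)
qed

definition cj :: rat where "cj = of_nat (2 * j choose j)"

lemma cj_fact: "cj = fact (2 * j) / (fact j * fact j)"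
  unfolding cj_def by (simp add: binomial_fact mult_2)

lemma Up_cj: "cj \<in> Up"
  unfolding cj_fact by (intro Up_divide Up_mult Up_fact less_p) auto

lemma rat_of_nat_p: "rat_of_nat p = 4 * of_nat j + 1"
  by (subst p_4j) simp

lemma inverse_2j: "pcong 1 (1 / (2 * of_nat j)) (- 2)"
proof -
  have "1 / (2 * of_nat j) - (- 2) = of_nat p ^ 1 * (1 / (2 * of_nat j :: rat))"
    using j_pos by (simp add: rat_of_nat_p field_simps)
  moreover have "1 / (2 * of_nat j :: rat) \<in> Zp"
    using Up_of_nat_less[of "2 * j"] j_pos less_p[of "2 * j"] by auto
  ultimately show ?thesis by (rule pcongI)
qed

text \<open>The numerator factors are \<open>5 * j + 1 + i = p + (j + i)\<close>; pulling out
  \<open>j + i\<close> leaves a product of the form 1 plus multiples of \<open>p\<close>. The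
  constant -2 is the residue of \<open>1 / (2 * j)\<close>, because \<open>4 * j\<close> is -1
  modulo \<open>p\<close>.\<close>

lemma choose_6j_j: "pcong 2 (of_nat (6 * j choose j)) (cj / 2 * (1 + of_nat p * (hj - 2)))"
proof -
  have "rat_of_nat (6 * j choose j) = fact (5 * j + j) / (fact j * fact (5 * j))"
    using binomial_fact[of j "6 * j", where 'a = rat] by simp
  also have "\<dots> = (\<Prod>i<j. rat_of_nat (5 * j + 1 + i)) / fact j"
    unfolding fact_add_prod by simp
  also have "\<dots> = (\<Prod>i<j. rat_of_nat (j + i)) / fact j * (\<Prod>i<j. 1 + of_nat p * (1 / rat_of_nat (j + i)))"
  proof -
    have "rat_of_nat (5 * j + 1 + i) = rat_of_nat (j + i) * (1 + of_nat p * (1 / rat_of_nat (j + i)))" for i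
      using j_pos by (simp add: rat_of_nat_p field_simps)
    then show ?thesis by (simp add: prod.distrib)
  qed
  also have "(\<Prod>i<j. rat_of_nat (j + i)) / fact j = cj / 2"
  proof -
    obtain l where l: "j = Suc l" using j_pos by (cases j) auto
    have "fact (l + j) = fact l * (\<Prod>i<j. rat_of_nat (j + i))"
      unfolding fact_add_prod by (simp add: l)
    moreover have "fact (2 * j) = rat_of_nat (2 * j) * fact (l + j)"
    proof -
      have "2 * j = Suc (l + j)" using l by simp
      then show ?thesis by (simp only: fact_Suc)
    qed
    moreover have "fact j = rat_of_nat j * fact l" unfolding l fact_Suc ..
    ultimately have "cj = rat_of_nat (2 * j) * (fact l * (\<Prod>i<j. rat_of_nat (j + i))) / (fact j * (rat_of_nat j * fact l))"
      unfolding cj_fact by simp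
    then show ?thesis using j_pos by simp
  qed
  finally have e: "rat_of_nat (6 * j choose j) = cj / 2 * (\<Prod>i<j. 1 + of_nat p * (1 / rat_of_nat (j + i)))" .
  have Z: "1 / rat_of_nat (j + i) \<in> Zp" if "i < j" for i
    using that j_pos by (intro Zp_divide Up_of_nat_less less_p) auto
  have c2: "cj / 2 \<in> Zp" using Up_cj Up_2 by (auto dest: UpD)
  have "pcong 2 (rat_of_nat (6 * j choose j)) (cj / 2 * (1 + of_nat p * (\<Sum>i<j. 1 / rat_of_nat (j + i))))"
    unfolding e using Z c2 by (intro pcong_mult_left pcong_prod_one_plus) auto
  also have "(\<Sum>i<j. 1 / rat_of_nat (j + i)) = hj + 1 / (2 * of_nat j)"
  proof -
    have "(\<Sum>i<Suc j. 1 / rat_of_nat (j + i)) = 1 / of_nat j + hj"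
      by (subst sum.lessThan_Suc_shift) (simp add: hj_def)
    then show ?thesis by (simp add: mult_2[symmetric] field_simps)
  qed
  also have "pcong 2 (cj / 2 * (1 + of_nat p * (hj + 1 / (2 * of_nat j)))) (cj / 2 * (1 + of_nat p * (hj - 2)))"
  proof -
    have "pcong (Suc 1) (of_nat p * (hj + 1 / (2 * of_nat j))) (of_nat p * (hj + - 2))"
      by (intro pcong_p_mult pcong_add pcong_refl inverse_2j)
    then have "pcong 2 (1 + of_nat p * (hj + 1 / (2 * of_nat j))) (1 + of_nat p * (hj + - 2))"
      by (intro pcong_add[of _ 1 1] pcong_refl) (simp add: numeral_2_eq_2)
    from pcong_mult_left[OF this c2] show ?thesis by simp
  qed
  finally show ?thesis .
qed

text \<open>The factor \<open>p\<close> in \<open>fact (6 * j)\<close> is explicit, so its cofactor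
  matters only modulo \<open>p\<close>, where Wilson's theorem evaluates it.\<close>

lemma choose_6j_3j: "pcong 2 (of_nat (6 * j choose (3 * j))) (- 2 * of_nat p / cj)"
proof -
  obtain l where l: "2 * j = Suc l" using j_pos by (cases "2 * j") auto
  define Q where "Q = (\<Prod>i<l. rat_of_nat (p + 1 + i))"
  have "fact (p + l) = fact p * Q" unfolding fact_add_prod Q_def by simp
  moreover have "fact p = rat_of_nat p * fact (4 * j)"
    using fact_Suc[of "4 * j", where 'a = rat] p_4j by (simp only: Suc_eq_plus1)
  moreover have "p + l = 6 * j" using l p_4j by linarith
  ultimately have f6: "fact (6 * j) = of_nat p * (fact (4 * j) * Q)" by simp
  have Q: "pcong 1 Q (fact l)"
  proof -
    have "pcong 1 Q (\<Prod>i<l. rat_of_nat (0 + 1 + i))"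
      unfolding Q_def
    proof (rule pcong_prod)
      fix i
      show "pcong 1 (rat_of_nat (p + 1 + i)) (rat_of_nat (0 + 1 + i))"
        by (rule pcongI[of _ _ _ 1]) auto
    qed simp
    then show ?thesis using fact_add_prod[of 0 l] by simp
  qed
  have w4: "pcong 1 (fact (4 * j)) (- 1)"
    using pcong_fact_fact[of 0] p_minus_1 by simp
  have w2: "pcong 1 (fact (2 * j) * fact (2 * j)) (- 1)"
    using pcong_fact_fact[of "2 * j"] less_p[of "2 * j"] unfolding p_minus_1 by simp
  have w3: "pcong 1 ((fact (3 * j) * fact j) ^ 2) 1"
  proof -
    have "pcong 1 ((fact (3 * j) * fact j) ^ 2) (((- 1) ^ (j + 1)) ^ 2)"
      using pcong_fact_fact[of j] Zp_of_nat[of "fact (3 * j) * fact j"] less_p[of j] unfolding p_minus_1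
      by (intro pcong_power) simp_all
    then show ?thesis by (simp add: power_mult[symmetric])
  qed
  have Uf: "fact (3 * j) \<in> Up" "fact j \<in> Up" "fact (2 * j) \<in> Up" "fact l \<in> Up" "fact (4 * j) \<in> Up"
    using l by (auto intro!: Up_fact less_p simp del: fact_Suc)
  have QZ: "Q \<in> Zp" unfolding Q_def by (intro Zp_prod) (rule Zp_of_nat)
  define B where "B = fact (4 * j) * Q / (fact (3 * j) * fact (3 * j))"
  have C: "rat_of_nat (6 * j choose (3 * j)) = of_nat p * B"
    using binomial_fact[of "3 * j" "6 * j", where 'a = rat] by (simp add: f6 B_def)
  have fl: "fact (2 * j) = 2 * rat_of_nat j * fact l"
    using fact_Suc[of l, where 'a = rat] unfolding l[symmetric] by simp
  have "cj * B = fact (4 * j) * Q * fact (2 * j) / (fact (3 * j) * fact j) ^ 2"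
    by (simp add: cj_fact B_def power2_eq_square ac_simps)
  also have "pcong 1 \<dots> (- 1 * fact l * fact (2 * j) / 1)"
    by (intro pcong_divide pcong_mult w4 w3 Q pcong_refl) (use Uf QZ in \<open>auto dest: UpD intro!: Zp_mult\<close>)
  also have "- 1 * fact l * fact (2 * j) / 1 = - (fact (2 * j) * fact (2 * j)) * (1 / (2 * rat_of_nat j))"
    unfolding fl using j_pos by simp
  also have "pcong 1 \<dots> (- (- 1) * - 2)"
    by (intro pcong_mult pcong_uminus w2 inverse_2j) (use pcong_Zp[OF inverse_2j] in auto)
  finally have "pcong 1 (cj * B) (cj * (- 2 / cj))" using Up_cj by (simp add: UpD)
  then have "pcong 1 B (- 2 / cj)" by (rule pcong_cancel) (rule Up_cj)
  then have "pcong (Suc 1) (of_nat p * B) (of_nat p * (- 2 / cj))" by (rule pcong_p_mult)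
  then show ?thesis unfolding C by (simp add: numeral_2_eq_2 ac_simps)
qed

text \<open>The value \<open>legP (2 * j) (- 1 / 2)\<close>, that is, P_2j at 0.\<close>

definition Aj :: rat where "Aj = (- 1) ^ j * cbin j"

lemma Aj_eq: "Aj = cj / (- 4) ^ j"
proof -
  have "(- 4 :: rat) ^ j = (- 1) ^ j * 4 ^ j" by (metis mult_minus1 power_mult_distrib)
  moreover have "s * (c / q) = c / (s * q)" if "s * s = 1" for s c q :: rat
  proof -
    have "s \<noteq> 0" using that by auto
    then have "s = 1 / s" using that by (simp add: field_simps)
    then show ?thesis by (metis divide_divide_eq_left mult.commute times_divide_eq_right mult_1)
  qed
  moreover have "(- 1 :: rat) ^ j * (- 1) ^ j = 1" by (simp add: minus_one_power_iff)
  ultimately have "(- 1) ^ j * (cj / 4 ^ j) = cj / ((- 1) ^ j * 4 ^ j)" "(- 4 :: rat) ^ j = (- 1) ^ j * 4 ^ j"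
    by blast+
  then show ?thesis by (simp add: Aj_def cbin_def cj_def)
qed

lemma Up_Aj: "Aj \<in> Up"
  unfolding Aj_eq by (intro Up_divide Up_power Up_uminus Up_4 Up_cj)

lemma Aj_pcong: "pcong 2 Aj (cj * (1 - of_nat p * hj / 2))"
proof -
  define u where "u = 1 + of_nat p * hj / 2"
  have n4: "(- 4) ^ j \<in> Up" by (intro Up_power Up_uminus Up_4)
  have u: "u \<in> Up"
    using neg4_power n4 Up_pcong[of 1 "(- 4) ^ j" u] by (simp add: u_def numeral_2_eq_2)
  have "pcong 2 Aj (cj / u)"
    unfolding Aj_eq using neg4_power n4 u Up_cj by (intro pcong_divide pcong_refl) (auto simp: u_def UpD)
  also have "pcong 2 (cj / u) (cj * (1 - of_nat p * hj / 2))"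
  proof (rule pcongI)
    have "cj / u - cj * (1 - of_nat p * hj / 2) = cj * (1 - u * (1 - of_nat p * hj / 2)) / u"
      using UpD(2)[OF u] by (simp add: field_simps)
    also have "1 - u * (1 - of_nat p * hj / 2) = of_nat p ^ 2 * (hj\<^sup>2 / 4)"
      by (simp add: u_def power2_eq_square algebra_simps)
    finally show "cj / u - cj * (1 - of_nat p * hj / 2) = of_nat p ^ 2 * (cj * (hj\<^sup>2 / 4) / u)"
      by simp
    show "cj * (hj\<^sup>2 / 4) / u \<in> Zp"
      using u Up_4 Up_cj hj_Zp by (auto dest: UpD)
  qed
  finally show ?thesis .
qed

lemma Aj_pcong_1: "pcong 1 Aj cj"
proof -
  have "pcong 1 Aj (cj * (1 - of_nat p * hj / 2))" by (rule pcong_mono[OF Aj_pcong]) simp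
  also have "pcong 1 (cj * (1 - of_nat p * hj / 2)) cj"
    by (rule pcongI[of _ _ _ "- (cj * (hj / 2))"])
       (use Up_cj hj_Zp Up_2 in \<open>auto simp: algebra_simps UpD\<close>)
  finally show ?thesis .
qed

text \<open>The Chowla-Dwork-Evans congruence. Normalising by \<open>(- 4) ^ j\<close> absorbs the
  power of 2 of its usual form.\<close>

lemma two_squares_pcong:
  assumes "int p = x\<^sup>2 + y\<^sup>2" "[x = 1] (mod 4)" "even y"
  shows "pcong 2 (2 * of_int x) (Aj + of_nat p / Aj)"
proof -
  define P where "P = rat_of_nat p"
  define C1 where "C1 = rat_of_nat (6 * j choose j)"
  define C3 where "C3 = rat_of_nat (6 * j choose (3 * j))"
  define s :: rat where "s = (- 1) ^ j"
  have ss: "s * s = 1" by (simp add: s_def minus_one_power_iff)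
  have sZ: "s \<in> Zp" by (simp add: s_def)
  have cZ: "cj \<in> Zp" using Up_cj by (simp add: UpD)
  have c0: "cj \<noteq> 0" using Up_cj by (simp add: UpD)
  have PZ: "P \<in> Zp" by (simp add: P_def)
  have j4: "4 * rat_of_nat j = P - 1" by (simp add: P_def rat_of_nat_p)
  have x4: "4 * rat_of_int x = - s * rat_of_int (2 * phi (- 1))"
  proof -
    have "4 * x = 2 * (2 * x)" by simp
    also have "2 * (2 * x) = 2 * - ((- 1) ^ j * phi (- 1))" by (simp only: two_squares_phi[OF assms])
    finally have "4 * x = - ((- 1) ^ j * (2 * phi (- 1)))" by (simp only: mult_minus_right mult.left_commute)
    then have "rat_of_int (4 * x) = rat_of_int (- ((- 1) ^ j * (2 * phi (- 1))))" by (simp only:)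
    then show ?thesis
      by (simp only: s_def of_int_mult of_int_minus of_int_power of_int_numeral of_int_1 mult_minus_left)
  qed
  have "pcong 2 (rat_of_int (2 * phi (- 1)))
      (rat_of_int (4 * int j * (- 1) ^ j * (3 * int (2 * j choose j) - 2 * int (6 * j choose j) - int (6 * j choose (3 * j)))))"
    by (rule pcong_of_int[OF two_phi])
  also have "rat_of_int (4 * int j * (- 1) ^ j * (3 * int (2 * j choose j) - 2 * int (6 * j choose j) - int (6 * j choose (3 * j))))
      = (P - 1) * s * (3 * cj - 2 * C1 - C3)"
    by (simp add: s_def cj_def C1_def C3_def j4)
  finally have "pcong 2 (- s * rat_of_int (2 * phi (- 1))) (- s * ((P - 1) * s * (3 * cj - 2 * C1 - C3)))"
    using sZ by (intro pcong_mult_left) auto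
  also have "- s * ((P - 1) * s * (3 * cj - 2 * C1 - C3)) = (s * s) * ((1 - P) * (3 * cj - 2 * C1 - C3))"
    by (simp add: algebra_simps)
  finally have "pcong 2 (4 * rat_of_int x) ((1 - P) * (3 * cj - 2 * C1 - C3))"
    by (simp add: x4 ss)
  also have "pcong 2 \<dots> ((1 - P) * (3 * cj - 2 * (cj / 2 * (1 + P * (hj - 2))) - (- 2 * P / cj)))"
    unfolding C1_def C3_def P_def
    by (rule pcong_mult_left, intro pcong_diff pcong_refl pcong_mult_left choose_6j_j choose_6j_3j) auto
  \<comment> \<open>The factor \<open>1 - P\<close>, coming from \<open>4 * j = P - 1\<close>,
    cancels the correction -2 of \<open>choose_6j_j\<close>; the remaining \<open>hj\<close> is
    exactly that of \<open>Aj_pcong\<close>.\<close>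
  also have "pcong 2 \<dots> (2 * (cj * (1 - P * hj / 2)) + 2 * (P * (1 / cj)))"
  proof (rule pcongI)
    show "(1 - P) * (3 * cj - 2 * (cj / 2 * (1 + P * (hj - 2))) - (- 2 * P / cj)) - (2 * (cj * (1 - P * hj / 2)) + 2 * (P * (1 / cj)))
       = of_nat p ^ 2 * (cj * hj - 2 * cj - 2 / cj)"
      unfolding P_def[symmetric] using c0 by (simp add: power2_eq_square field_simps)
    show "cj * hj - 2 * cj - 2 / cj \<in> Zp" using cZ hj_Zp Up_cj by auto
  qed
  also have "pcong 2 \<dots> (2 * Aj + 2 * (P * (1 / Aj)))"
  proof -
    have "pcong 1 (1 / cj) (1 / Aj)"
      by (intro pcong_divide pcong_refl pcong_sym[OF Aj_pcong_1] Up_cj Up_Aj) simp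
    then have "pcong 2 (of_nat p * (1 / cj)) (of_nat p * (1 / Aj))" by (rule pcong_p_mult_2)
    then have a: "pcong 2 (2 * (P * (1 / cj))) (2 * (P * (1 / Aj)))"
      unfolding P_def by (rule pcong_mult_left) simp
    have b: "pcong 2 (2 * (cj * (1 - P * hj / 2))) (2 * Aj)"
      unfolding P_def by (rule pcong_mult_left[OF pcong_sym[OF Aj_pcong]]) simp
    show ?thesis by (rule pcong_add[OF b a])
  qed
  finally have "pcong 2 (2 * (2 * rat_of_int x)) (2 * (Aj + of_nat p / Aj))"
    by (simp add: P_def algebra_simps)
  then show ?thesis by (rule pcong_cancel) (rule Up_2)
qed

end

section \<open>The truncated sums\<close>

context odd_prime_modulus
begin

lemma Up_int_less: "\<lbrakk>k \<noteq> 0; \<bar>k\<bar> < int p\<rbrakk> \<Longrightarrow> of_int k \<in> Up"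
  by (rule Up_of_int) (auto dest: dvd_imp_le_int)

lemma Up_2k_minus_1: "k \<le> half \<Longrightarrow> 2 * of_nat k - 1 \<in> Up"
proof -
  assume "k \<le> half"
  moreover have "int p = 2 * int half + 1" using p_half by linarith
  ultimately have "\<bar>2 * int k - 1\<bar> < int p" using p_gt_2 by linarith
  moreover have "2 * int k - 1 \<noteq> 0" by presburger
  ultimately have "of_int (2 * int k - 1) \<in> Up" by (intro Up_int_less)
  then show ?thesis by simp
qed

lemma Up_2k_plus_2: "k + 1 < p \<Longrightarrow> 2 * of_nat k + 2 \<in> Up"
proof -
  assume "k + 1 < p"
  then have "2 * of_nat (k + 1) \<in> Up" by (intro Up_mult Up_2 Up_of_nat_less) auto
  then show ?thesis by (simp add: distrib_left add.commute)
qed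

lemma cbin_Zp [simp]: "cbin k \<in> Zp"
  unfolding cbin_def by (intro Zp_divide Up_power Up_4) auto

lemma dbin_Zp: "k < p \<Longrightarrow> dbin k \<in> Zp"
  by (cases k) (auto simp: dbin_Suc Up_2k_plus_2)

lemma p_eq: "rat_of_nat p = 2 * of_nat half + 1"
  by (subst p_half) (simp only: of_nat_add of_nat_mult of_nat_numeral of_nat_1)

lemma pcong_chi: "pcong 1 (of_int a ^ half) (of_int (chi a))"
  using pcong_of_int_iff[of "a ^ half" "chi a"] chi_euler[of a] by (simp add: cong_sym)

lemma four_power_half: "pcong 1 (4 ^ half) 1"
proof -
  have "chi (2 * 2) = 1" unfolding chi_mult using p_gt_2 by (intro chi_square) (auto dest: zdvd_imp_le)
  then show ?thesis using pcong_chi[of 4] by simp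
qed

lemma cbin_half: "pcong 1 (cbin half) ((- 1) ^ half)"
proof -
  have "2 * half = p - 1" using p_half by simp
  then have "pcong 1 (cbin half) ((- 1) ^ half / 1)"
    unfolding cbin_def using p_half
    by (intro pcong_divide four_power_half Up_power Up_4 Up_1) (simp_all only: choose_p_minus_1 Zp_of_nat)
  then show ?thesis by simp
qed

text \<open>Modulo \<open>p\<close>, \<open>half\<close> equals -1/2, so \<open>cbin k\<close> is
  \<open>(- 1) ^ k\<close> times \<open>half choose k\<close>, and the binomial coefficient is
  symmetric. The induction expresses this through ratios of consecutive terms.\<close>

lemma cbin_reflect: "k \<le> half \<Longrightarrow> pcong 1 (cbin (half - k)) ((- 1) ^ half * cbin k)"
proof (induction k)
  case 0
  then show ?case using cbin_half by simp
next
  case (Suc k)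
  define m where "m = half - Suc k"
  have m: "half - k = Suc m" using Suc.prems by (simp add: m_def)
  have mk: "2 * rat_of_nat m = of_nat p - 3 - 2 * of_nat k"
  proof -
    have "half = m + k + 1" using Suc.prems by (simp add: m_def)
    then have "rat_of_nat half = of_nat m + of_nat k + 1" by (metis of_nat_1 of_nat_add)
    then show ?thesis using p_eq by simp
  qed
  have U1: "2 * rat_of_nat m + 1 \<in> Up"
    using Up_2k_minus_1[of "Suc m"] m by (simp add: add.commute)
  have U2: "2 * rat_of_nat k + 2 \<in> Up"
    using Suc.prems p_half by (intro Up_2k_plus_2) linarith
  have "cbin m = cbin (Suc m) * (2 * of_nat m + 2) / (2 * of_nat m + 1)"
    using UpD(2)[OF U1] two_of_nat_plus_2_nonzero[of m] by (simp add: cbin_Suc)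
  also have "\<dots> = cbin (half - k) * (of_nat p - 1 - 2 * of_nat k) / (of_nat p - 2 - 2 * of_nat k)"
    unfolding m mk by (simp add: algebra_simps)
  finally have e: "cbin m = cbin (half - k) * (of_nat p - 1 - 2 * of_nat k) / (of_nat p - 2 - 2 * of_nat k)" .
  have c1: "pcong 1 (of_nat p - 1 - 2 * of_nat k) (- (2 * of_nat k + 1))"
    by (rule pcongI[of _ _ _ 1]) auto
  have c2: "pcong 1 (of_nat p - 2 - 2 * of_nat k) (- (2 * of_nat k + 2))"
    by (rule pcongI[of _ _ _ 1]) auto
  have U3: "of_nat p - 2 - 2 * rat_of_nat k \<in> Up" using U1 unfolding mk by (simp add: algebra_simps)
  have "pcong 1 (cbin m) ((- 1) ^ half * cbin k * - (2 * of_nat k + 1) / - (2 * of_nat k + 2))"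
    unfolding e using Suc.IH Suc.prems U2 U3 Up_uminus[OF U2]
    by (intro pcong_divide pcong_mult c1 c2) (auto intro!: Zp_mult Zp_diff Zp_uminus Zp_add)
  moreover have "s * c * - a / - b = s * (c * a / b)" for s c a b :: rat by simp
  ultimately show ?case unfolding m_def cbin_Suc by (simp only:)
qed

lemma dbin_Suc_half: "dbin (Suc half) = cbin half / (of_nat p + 1)"
  unfolding dbin_Suc p_eq by (simp add: algebra_simps)

lemma cbin_Suc_half: "cbin (Suc half) = of_nat p * dbin (Suc half)"
  unfolding cbin_dbin[of "Suc half"] p_eq by simp

lemma pcong_p_plus_1: "pcong 1 (of_nat p + 1) 1"
  by (rule pcongI[of _ _ _ 1]) auto

lemma Up_p_plus_1: "of_nat p + 1 \<in> Up"
  using Up_pcong[OF pcong_sym[OF pcong_p_plus_1[unfolded One_nat_def]]] by simp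

lemma dbin_Suc_half_pcong: "pcong 1 (dbin (Suc half)) ((- 1) ^ half)"
proof -
  have "pcong 1 (dbin (Suc half)) ((- 1) ^ half / 1)"
    unfolding dbin_Suc_half by (intro pcong_divide cbin_half pcong_p_plus_1 Up_p_plus_1) auto
  then show ?thesis by simp
qed

text \<open>The same with 1/2, which is \<open>Suc half\<close> modulo \<open>p\<close>; hence the
  centre of symmetry moves by one half.\<close>

lemma dbin_reflect: "k \<le> Suc half \<Longrightarrow> pcong 1 (dbin (Suc half - k)) (- ((- 1) ^ half) * dbin k)"
proof (induction k)
  case 0
  then show ?case using dbin_Suc_half_pcong by simp
next
  case (Suc k)
  define m where "m = half - k"
  have m: "Suc half - k = Suc m" using Suc.prems by (simp add: m_def)
  have mk: "2 * rat_of_nat m = of_nat p - 1 - 2 * of_nat k"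
  proof -
    have "half = m + k" using Suc.prems by (simp add: m_def)
    then have "rat_of_nat half = of_nat m + of_nat k" by (metis of_nat_add)
    then show ?thesis using p_eq by simp
  qed
  have U1: "2 * rat_of_nat m - 1 \<in> Up"
    by (intro Up_2k_minus_1) (simp add: m_def)
  have U2: "2 * rat_of_nat k + 2 \<in> Up"
    using Suc.prems p_half p_gt_2 by (intro Up_2k_plus_2) linarith
  have "dbin m = dbin (Suc m) * (2 * of_nat m + 2) / (2 * of_nat m - 1)"
    using UpD(2)[OF U1] dbin_Suc_rec[of m] by simp
  also have "\<dots> = dbin (Suc half - k) * (of_nat p + 1 - 2 * of_nat k) / (of_nat p - 2 - 2 * of_nat k)"
    unfolding m mk by (simp add: algebra_simps)
  finally have e: "dbin m = dbin (Suc half - k) * (of_nat p + 1 - 2 * of_nat k) / (of_nat p - 2 - 2 * of_nat k)" .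
  have c1: "pcong 1 (of_nat p + 1 - 2 * of_nat k) (- (2 * of_nat k - 1))"
    by (rule pcongI[of _ _ _ 1]) auto
  have c2: "pcong 1 (of_nat p - 2 - 2 * of_nat k) (- (2 * of_nat k + 2))"
    by (rule pcongI[of _ _ _ 1]) auto
  have U3: "of_nat p - 2 - 2 * rat_of_nat k \<in> Up" using U1 unfolding mk by (simp add: algebra_simps)
  have Z: "dbin k \<in> Zp" "dbin (Suc half - k) \<in> Zp"
    using Suc.prems p_half p_gt_2 by (auto intro!: dbin_Zp)
  have "pcong 1 (dbin m) (- ((- 1) ^ half) * dbin k * - (2 * of_nat k - 1) / - (2 * of_nat k + 2))"
    unfolding e using Suc.IH Suc.prems U2 U3 Z Up_uminus[OF U2]
    by (intro pcong_divide pcong_mult c1 c2) (auto intro!: Zp_mult Zp_diff Zp_uminus Zp_add)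
  moreover have "dbin (Suc k) = dbin k * (2 * of_nat k - 1) / (2 * of_nat k + 2)"
    using UpD(2)[OF U2] dbin_Suc_rec[of k] by (simp add: nonzero_eq_divide_eq)
  moreover have "- s * c * - a / - b = - s * (c * a / b)" for s c a b :: rat by simp
  moreover have "Suc half - Suc k = m" by (simp add: m_def)
  ultimately show ?case by (simp only:)
qed

text \<open>The ratio of consecutive coefficients contains \<open>p\<close> only in
  \<open>p^2 - (2 * k + 1)^2\<close>, which explains the precision \<open>p ^ 2\<close>.\<close>

lemma leg_half: "k \<le> half \<Longrightarrow> pcong 2 (leg half k) ((- 1) ^ k * (cbin k)\<^sup>2)"
proof (induction k)
  case (Suc k)
  have U: "(2 * rat_of_nat k + 2)\<^sup>2 \<in> Up"
    using Suc.prems p_half by (intro Up_power Up_2k_plus_2) linarith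
  have "leg half (Suc k) * (2 * of_nat k + 2)\<^sup>2 = 4 * (leg half (Suc k) * of_nat (Suc k) ^ 2)"
    by (simp add: power2_eq_square algebra_simps)
  also have "\<dots> = leg half k * (2 * (of_nat half - of_nat k)) * (2 * (of_nat half + of_nat k + 1))"
    unfolding leg_Suc_right by (simp only: ac_simps)
  also have "\<dots> = leg half k * ((of_nat p)\<^sup>2 - (2 * of_nat k + 1)\<^sup>2)"
    unfolding p_eq by (simp add: power2_eq_square algebra_simps)
  finally have e: "leg half (Suc k) = leg half k * ((of_nat p)\<^sup>2 - (2 * of_nat k + 1)\<^sup>2) / (2 * of_nat k + 2)\<^sup>2"
    by (rule eq_divide_imp[OF UpD(2)[OF U]])
  have c: "pcong 2 ((of_nat p)\<^sup>2 - (2 * of_nat k + 1)\<^sup>2) (- ((2 * of_nat k + 1)\<^sup>2))"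
    by (rule pcongI[of _ _ _ 1]) auto
  have Z: "leg half k \<in> Zp" by (simp add: leg_def)
  have "pcong 2 (leg half (Suc k)) ((- 1) ^ k * (cbin k)\<^sup>2 * (- ((2 * of_nat k + 1)\<^sup>2)) / (2 * of_nat k + 2)\<^sup>2)"
    unfolding e using Suc U Z
    by (intro pcong_divide pcong_mult c pcong_refl) (auto intro!: Zp_mult Zp_diff Zp_uminus Zp_add Zp_power)
  then show ?case by (simp add: cbin_Suc power_divide power_mult_distrib mult.assoc)
qed simp

text \<open>The factor \<open>p\<close> enters at \<open>k = Suc half\<close> as
  \<open>2 * k - 1\<close>, and no denominator below \<open>p\<close> removes it.\<close>

lemma cbin_gt_half: "half < k \<Longrightarrow> k < p \<Longrightarrow> pcong 1 (cbin k) 0"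
proof (induction k)
  case (Suc k)
  show ?case
  proof (cases "k = half")
    case True
    then show ?thesis
      using Suc.prems unfolding True cbin_Suc_half One_nat_def by (auto intro!: pcong_p_0 dbin_Zp)
  next
    case False
    have U: "2 * rat_of_nat k + 2 \<in> Up" using Suc.prems by (intro Up_2k_plus_2) simp
    have "pcong 1 (cbin (Suc k)) (0 * (2 * of_nat k + 1) / (2 * of_nat k + 2))"
      unfolding cbin_Suc using Suc False U
      by (intro pcong_divide pcong_mult pcong_refl) (auto intro!: Zp_mult Zp_add)
    then show ?thesis by simp
  qed
qed simp

lemma binom_sum_eq:
  assumes "m \<noteq> 0"
  shows "binom_sum p m = (\<Sum>k<p. cbin k * dbin k * (16 / m) ^ k)"
  unfolding binom_sum_def
proof (intro sum.cong refl)
  fix k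
  have "(16 / m) ^ k = 4 ^ k * 4 ^ k / m ^ k"
    by (simp add: power_divide power_mult_distrib[symmetric])
  then show "(of_nat (2 * k choose k))\<^sup>2 / ((2 * of_nat k - 1) * m ^ k) = cbin k * dbin k * (16 / m) ^ k"
    by (simp add: cbin_def dbin_def power2_eq_square)
qed

text \<open>Beyond \<open>Suc half\<close> both \<open>cbin k\<close> and \<open>dbin k\<close> are
  divisible by \<open>p\<close>. At \<open>Suc half\<close> itself the denominator
  \<open>2 * k - 1\<close> is \<open>p\<close>, so that term must be kept.\<close>

lemma binom_sum_pcong:
  assumes "m \<noteq> 0" "- 16 / m = x" "x \<in> Zp"
  shows "pcong 2 (binom_sum p m) (\<Sum>k\<le>Suc half. cbin k * dbin k * (- x) ^ k)"
proof -
  have x: "16 / m = - x" using assms(2) by auto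
  have split: "{..<p} = {..Suc half} \<union> {Suc half<..<p}" using p_half p_gt_2 by auto
  have "(\<Sum>k<p. cbin k * dbin k * (- x) ^ k)
    = (\<Sum>k\<le>Suc half. cbin k * dbin k * (- x) ^ k) + (\<Sum>k\<in>{Suc half<..<p}. cbin k * dbin k * (- x) ^ k)"
    unfolding split by (rule sum.union_disjoint) auto
  also have "pcong 2 \<dots> ((\<Sum>k\<le>Suc half. cbin k * dbin k * (- x) ^ k) + (\<Sum>k\<in>{Suc half<..<p}. 0))"
  proof (intro pcong_add pcong_refl pcong_sum)
    fix k assume k: "k \<in> {Suc half<..<p}"
    then obtain i where i: "k = Suc i" by (cases k) auto
    have "pcong 1 (cbin i) 0" using k i by (intro cbin_gt_half) auto
    then have "pcong 1 (cbin i / (2 * of_nat i + 2)) (0 / (2 * of_nat i + 2))"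
      using k i by (intro pcong_divide pcong_refl Up_2k_plus_2) auto
    then have "pcong 1 (dbin k) 0" by (simp add: i dbin_Suc)
    moreover have "pcong 1 (cbin k) 0" using k by (intro cbin_gt_half) auto
    ultimately have "pcong (1 + 1) (cbin k * dbin k) 0" by (intro pcong_mult_mult)
    then have "pcong 2 (cbin k * dbin k * (- x) ^ k) (0 * (- x) ^ k)"
      using assms(3) by (intro pcong_mult_right) (auto simp: numeral_2_eq_2)
    then show "pcong 2 (cbin k * dbin k * (- x) ^ k) 0" by simp
  qed
  finally show ?thesis unfolding binom_sum_eq[OF assms(1)] x by simp
qed

text \<open>Isolates the boundary term, where \<open>cbin\<close> is \<open>p\<close> times
  \<open>dbin\<close> and \<open>dbin\<close> squares to 1 modulo \<open>p\<close>. It is the origin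
  of the explicit multiples of \<open>p\<close> beside the values of \<open>R\<close>.\<close>

lemma sum_Suc_half_pcong:
  assumes "x \<in> Zp"
  shows "pcong 2 (\<Sum>k\<le>Suc half. cbin k * dbin k * (- x) ^ k)
    ((\<Sum>k\<le>half. cbin k * dbin k * (- x) ^ k) + of_nat p * (- x) ^ Suc half)"
proof -
  have "Suc half < p" using p_half p_gt_2 by linarith
  then have Z: "dbin (Suc half) \<in> Zp" by (rule dbin_Zp)
  have "pcong 1 (dbin (Suc half) * dbin (Suc half)) ((- 1) ^ half * (- 1) ^ half)"
    using Z by (intro pcong_mult dbin_Suc_half_pcong) auto
  then have "pcong 1 (dbin (Suc half) * dbin (Suc half)) 1"
    by (simp add: minus_one_power_iff split: if_splits)
  then have "pcong 2 (of_nat p * (dbin (Suc half) * dbin (Suc half))) (of_nat p * 1)"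
    by (rule pcong_p_mult_2)
  then have "pcong 2 (of_nat p * (dbin (Suc half) * dbin (Suc half)) * (- x) ^ Suc half) (of_nat p * 1 * (- x) ^ Suc half)"
    by (rule pcong_mult_right) (use assms in auto)
  then show ?thesis
    unfolding sum.atMost_Suc cbin_Suc_half by (intro pcong_add pcong_refl) (simp add: ac_simps)
qed

section \<open>The truncated sums, the polynomials \<open>R\<close>, and Legendre values\<close>

lemma poly_R: "poly (R N) x = (\<Sum>k\<le>N. leg N k / (2 * of_nat k - 1) * x ^ k)"
  by (simp add: R_def poly_sum poly_monom leg_def)

lemma poly_R_pcong:
  assumes "x \<in> Zp"
  shows "pcong 2 (poly (R half) x) (\<Sum>k\<le>half. cbin k * dbin k * (- x) ^ k)"
  unfolding poly_R
proof (intro pcong_sum)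
  fix k assume "k \<in> {..half}"
  then have k: "k \<le> half" by simp
  have "pcong 2 (leg half k / (2 * of_nat k - 1) * x ^ k) ((- 1) ^ k * (cbin k)\<^sup>2 / (2 * of_nat k - 1) * x ^ k)"
    using assms k by (intro pcong_mult_right pcong_divide leg_half pcong_refl Up_2k_minus_1) (auto simp: leg_def)
  then show "pcong 2 (leg half k / (2 * of_nat k - 1) * x ^ k) (cbin k * dbin k * (- x) ^ k)"
    by (simp add: dbin_def power2_eq_square power_minus[of x] ac_simps)
qed

lemma poly_R_binom_sum:
  assumes "m \<noteq> 0" "- 16 / m = x" "x \<in> Zp"
  shows "pcong 2 (poly (R half) x + of_nat p * (- x) ^ Suc half) (binom_sum p m)"
proof -
  have "pcong 2 (poly (R half) x + of_nat p * (- x) ^ Suc half)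
     ((\<Sum>k\<le>half. cbin k * dbin k * (- x) ^ k) + of_nat p * (- x) ^ Suc half)"
    by (intro pcong_add poly_R_pcong assms pcong_refl)
  also have "pcong 2 \<dots> (binom_sum p m)"
    using sum_Suc_half_pcong[OF assms(3)] binom_sum_pcong[OF assms] by (meson pcong_sym pcong_trans)
  finally show ?thesis .
qed

lemma leg_diag: "leg N N = 4 ^ N * cbin N"
  by (simp add: leg_def cbin_def mult_2)

text \<open>The neighbours have ratios \<open>(n - k) / (n + k)\<close> and
  \<open>(n + 1 + k) / (n + 1 - k)\<close> to \<open>leg half k\<close>, and four times the product
  of these denominators is \<open>p^2 - (2 * k - 1)^2\<close>. With weights 1, 2, 1 the numerator is
  \<open>2 * k - 1\<close> modulo \<open>p ^ 2\<close> up to the factor 4, so the combination is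
  \<open>- 4 / (2 * k - 1)\<close> times \<open>leg half k\<close>.\<close>

lemma leg_three_term:
  assumes "k \<le> half"
  shows "(leg (half - 1) k + 2 * leg half k + leg (Suc half) k) * ((of_nat p)\<^sup>2 - (2 * of_nat k - 1)\<^sup>2)
    = 4 * leg half k * ((of_nat p)\<^sup>2 - 1 + 2 * of_nat k)"
proof -
  obtain N where N: "half = Suc N" using p_half p_gt_2 by (cases half) auto
  define n where "n = rat_of_nat half"
  define y where "y = rat_of_nat k"
  define g where "g = leg half k"
  have nN: "rat_of_nat N = n - 1" by (simp add: n_def N)
  have a: "leg (Suc half) k * (n + 1 - y) = g * (n + 1 + y)"
    using leg_Suc_left[of half k] by (simp only: n_def y_def g_def)
  have b: "g * (n - y) = leg (half - 1) k * (n + y)"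
    using leg_Suc_left[of N k] unfolding N[symmetric] nN y_def[symmetric] g_def[symmetric] by (simp add: N)
  have P: "(rat_of_nat p)\<^sup>2 - (2 * y - 1)\<^sup>2 = 4 * (n + y) * (n + 1 - y)"
    "(rat_of_nat p)\<^sup>2 - 1 + 2 * y = 4 * n * n + 4 * n + 2 * y"
    unfolding p_eq n_def[symmetric] by (simp_all add: power2_eq_square algebra_simps)
  have "(leg (half - 1) k + 2 * g + leg (Suc half) k) * (4 * (n + y) * (n + 1 - y))
     = 4 * (n + 1 - y) * (leg (half - 1) k * (n + y)) + 8 * g * (n + y) * (n + 1 - y) + 4 * (n + y) * (leg (Suc half) k * (n + 1 - y))"
    by (simp add: algebra_simps)
  also have "\<dots> = 4 * g * (4 * n * n + 4 * n + 2 * y)"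
    unfolding a b[symmetric] by (simp add: algebra_simps)
  finally show ?thesis unfolding P[symmetric] unfolding y_def g_def .
qed

lemma binom_sum_legP:
  assumes "m \<noteq> 0" "- 16 / m = x" "x \<in> Zp"
  shows "pcong 2 (binom_sum p m) (- (legP (half - 1) x + 2 * legP half x + legP (Suc half) x) / 4)"
proof -
  let ?t = "\<lambda>k. - (leg (half - 1) k + 2 * leg half k + leg (Suc half) k) / 4 * x ^ k"
  have "pcong 2 (binom_sum p m) ((\<Sum>k\<le>half. cbin k * dbin k * (- x) ^ k) + of_nat p * (- x) ^ Suc half)"
    using sum_Suc_half_pcong[OF assms(3)] binom_sum_pcong[OF assms] by (meson pcong_trans)
  also have "pcong 2 \<dots> (sum ?t {..half} + ?t (Suc half))"
  proof (intro pcong_add pcong_sum)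
    fix k assume "k \<in> {..half}"
    then have k: "k \<le> half" by simp
    define v where "v = 2 * rat_of_nat k - 1"
    have v: "v \<in> Up" using k unfolding v_def by (rule Up_2k_minus_1)
    have c1: "pcong 2 ((of_nat p)\<^sup>2 - v\<^sup>2) (- (v\<^sup>2))" by (rule pcongI[of _ _ _ 1]) auto
    have c2: "pcong 2 ((of_nat p)\<^sup>2 - 1 + 2 * of_nat k) v" by (rule pcongI[of _ _ _ 1]) (auto simp: v_def)
    have U: "(of_nat p)\<^sup>2 - v\<^sup>2 \<in> Up"
      using Up_pcong[of 1 "- (v\<^sup>2)"] pcong_sym[OF c1] v by (simp add: numeral_2_eq_2)
    have Z: "leg half k \<in> Zp" by (simp add: leg_def)
    have "leg (half - 1) k + 2 * leg half k + leg (Suc half) k = 4 * leg half k * ((of_nat p)\<^sup>2 - 1 + 2 * of_nat k) / ((of_nat p)\<^sup>2 - v\<^sup>2)"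
      by (rule eq_divide_imp[OF UpD(2)[OF U] leg_three_term[OF k, folded v_def]])
    moreover have "- (4 * l * q / d) / 4 * z = l * q / - d * z" for l q d z :: rat by simp
    ultimately have e: "?t k = leg half k * ((of_nat p)\<^sup>2 - 1 + 2 * of_nat k) / - ((of_nat p)\<^sup>2 - v\<^sup>2) * x ^ k"
      by (simp only:)
    have "pcong 2 (?t k) ((- 1) ^ k * (cbin k)\<^sup>2 * v / - (- (v\<^sup>2)) * x ^ k)"
      unfolding e using assms(3) Up_uminus[OF U] v Z
      by (intro pcong_mult_right pcong_divide pcong_mult leg_half[OF k] c2 pcong_uminus c1)
         (auto intro!: Zp_mult Zp_diff Zp_uminus Zp_add Zp_power)
    also have "(- 1) ^ k * (cbin k)\<^sup>2 * v / - (- (v\<^sup>2)) * x ^ k = cbin k * dbin k * (- x) ^ k"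
      using UpD(2)[OF v] unfolding dbin_def v_def[symmetric] by (simp add: power2_eq_square power_minus[of x])
    finally show "pcong 2 (cbin k * dbin k * (- x) ^ k) (?t k)" by (rule pcong_sym)
  next
    \<comment> \<open>In top degree only \<open>leg (Suc half)\<close> is nonzero; since
      \<open>4 ^ half\<close> is 1 modulo \<open>p\<close>, it reproduces the boundary term of the
      truncated sum.\<close>
    have "Suc half < p" using p_half p_gt_2 by linarith
    then have Z: "dbin (Suc half) \<in> Zp" by (rule dbin_Zp)
    have e: "?t (Suc half) = - (of_nat p * (4 ^ half * dbin (Suc half))) * x ^ Suc half"
      by (simp add: leg_eq_0 leg_diag cbin_Suc_half)
    have "pcong 1 (4 ^ half * dbin (Suc half)) (1 * (- 1) ^ half)"
      using Z by (intro pcong_mult four_power_half dbin_Suc_half_pcong) auto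
    then have "pcong 2 (of_nat p * (4 ^ half * dbin (Suc half))) (of_nat p * (1 * (- 1) ^ half))"
      by (rule pcong_p_mult_2)
    then have "pcong 2 (?t (Suc half)) (- (of_nat p * (1 * (- 1) ^ half)) * x ^ Suc half)"
      unfolding e using assms(3) by (intro pcong_mult_right pcong_uminus) auto
    also have "- (of_nat p * (1 * (- 1) ^ half)) * x ^ Suc half = of_nat p * (- x) ^ Suc half"
      by (simp add: power_minus[of x])
    finally show "pcong 2 (of_nat p * (- x) ^ Suc half) (?t (Suc half))" by (rule pcong_sym)
  qed
  also have "sum ?t {..half} + ?t (Suc half) = sum ?t {..Suc half}" by simp
  also have "\<dots> = - (legP (half - 1) x + 2 * legP half x + legP (Suc half) x) / 4"
  proof -
    have "sum ?t {..Suc half} = - ((\<Sum>k\<le>Suc half. leg (half - 1) k * x ^ k) + 2 * (\<Sum>k\<le>Suc half. leg half k * x ^ k) + (\<Sum>k\<le>Suc half. leg (Suc half) k * x ^ k)) / 4"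
      unfolding sum_distrib_left sum.distrib[symmetric] sum_negf[symmetric] sum_divide_distrib
      by (intro sum.cong refl) (simp add: algebra_simps)
    moreover have "legP (half - 1) x = (\<Sum>k\<le>Suc half. leg (half - 1) k * x ^ k)"
      "legP half x = (\<Sum>k\<le>Suc half. leg half k * x ^ k)"
      "legP (Suc half) x = (\<Sum>k\<le>Suc half. leg (Suc half) k * x ^ k)"
      by (rule legP_extend, simp)+
    ultimately show ?thesis by (simp only:)
  qed
  finally show ?thesis .
qed

lemma legP_half_1: "pcong 2 (legP half 1) (\<Sum>k\<le>half. (- 1) ^ k * (cbin k)\<^sup>2)"
  unfolding legP_def power_one mult_1_right by (intro pcong_sum leg_half) simp

lemma legP_half_1_even:
  assumes "even half"
  shows "pcong 2 (legP half 1) (cbin (half div 2))"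
proof -
  have reverse: "(\<Sum>k\<le>half. (- 1) ^ k * (cbin (half - k))\<^sup>2) = (\<Sum>k\<le>half. (- 1) ^ k * (cbin k)\<^sup>2)"
    by (rule sum.reindex_bij_witness[of _ "\<lambda>k. half - k" "\<lambda>k. half - k"])
       (use assms in \<open>auto simp: minus_one_power_iff\<close>)
  \<comment> \<open>Each difference vanishes modulo \<open>p\<close>, hence its square modulo
    \<open>p ^ 2\<close>. As \<open>half\<close> is even, the two sums of squares agree after
    reversal and only the mixed products have to be known.\<close>
  have "pcong 2 (\<Sum>k\<le>half. (- 1) ^ k * (cbin k - cbin (half - k))\<^sup>2) (\<Sum>k\<le>half. 0)"
  proof (intro pcong_sum)
    fix k assume "k \<in> {..half}"
    then have "pcong 1 (cbin (half - k)) (cbin k)"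
      using cbin_reflect[of k] assms by simp
    then have "pcong 1 (cbin k - cbin (half - k)) 0"
      using pcong_0_iff pcong_sym by blast
    then have "pcong (1 + 1) ((cbin k - cbin (half - k)) * (cbin k - cbin (half - k))) 0"
      by (intro pcong_mult_mult)
    then have "pcong 2 ((- 1) ^ k * (cbin k - cbin (half - k))\<^sup>2) ((- 1) ^ k * 0)"
      by (intro pcong_mult_left) (auto simp: numeral_2_eq_2)
    then show "pcong 2 ((- 1) ^ k * (cbin k - cbin (half - k))\<^sup>2) 0" by simp
  qed
  moreover have "(\<Sum>k\<le>half. (- 1) ^ k * (cbin k - cbin (half - k))\<^sup>2)
     = 2 * (\<Sum>k\<le>half. (- 1) ^ k * (cbin k)\<^sup>2) - 2 * cbin (half div 2)"
  proof -
    have "(\<Sum>k\<le>half. (- 1) ^ k * (cbin k - cbin (half - k))\<^sup>2)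
       = (\<Sum>k\<le>half. (- 1) ^ k * (cbin k)\<^sup>2) + (\<Sum>k\<le>half. (- 1) ^ k * (cbin (half - k))\<^sup>2)
          - 2 * (\<Sum>k\<le>half. (- 1) ^ k * cbin k * cbin (half - k))"
      unfolding sum_distrib_left sum.distrib[symmetric] sum_subtractf[symmetric]
      by (intro sum.cong refl) (simp add: power2_eq_square algebra_simps)
    then show ?thesis unfolding reverse cbin_convolution_alternating using assms by simp
  qed
  ultimately have "pcong 2 (2 * (\<Sum>k\<le>half. (- 1) ^ k * (cbin k)\<^sup>2)) (2 * cbin (half div 2))"
    using pcong_0_iff by simp
  then have "pcong 2 (\<Sum>k\<le>half. (- 1) ^ k * (cbin k)\<^sup>2) (cbin (half div 2))"
    by (rule pcong_cancel) (rule Up_2)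
  with legP_half_1 show ?thesis by (rule pcong_trans)
qed

text \<open>For odd \<open>half\<close> completing the square is void, since the sum of squares and
  its reverse cancel; one factor is reflected directly, at the cost of working modulo
  \<open>p\<close> only.\<close>

lemma legP_half_1_odd:
  assumes "odd half"
  shows "pcong 1 (legP half 1) 0"
proof -
  have "pcong 1 (legP half 1) (\<Sum>k\<le>half. (- 1) ^ k * (cbin k)\<^sup>2)"
    by (rule pcong_mono[OF legP_half_1]) simp
  also have "pcong 1 \<dots> (\<Sum>k\<le>half. - ((- 1) ^ k * cbin k * cbin (half - k)))"
  proof (intro pcong_sum)
    fix k assume "k \<in> {..half}"
    then have "pcong 1 (cbin (half - k)) (- cbin k)"
      using cbin_reflect[of k] assms by simp
    then have "pcong 1 (- ((- 1) ^ k * cbin k) * cbin (half - k)) (- ((- 1) ^ k * cbin k) * - cbin k)"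
      by (intro pcong_mult_left) auto
    then show "pcong 1 ((- 1) ^ k * (cbin k)\<^sup>2) (- ((- 1) ^ k * cbin k * cbin (half - k)))"
      by (intro pcong_sym[of _ "- ((- 1) ^ k * cbin k * cbin (half - k))"]) (simp add: power2_eq_square ac_simps)
  qed
  also have "(\<Sum>k\<le>half. - ((- 1) ^ k * cbin k * cbin (half - k))) = 0"
    unfolding sum_negf cbin_convolution_alternating using assms by simp
  finally show ?thesis .
qed

lemma alternating_sum_pcong_1:
  "pcong 1 (of_int (\<Sum>m<(p + 1) div 2. (- 1) ^ m * int (p choose (2 * m)))) 1"
proof -
  obtain K where K: "(p + 1) div 2 = Suc K" using p_gt_2 by (cases "(p + 1) div 2") auto
  have "of_int (\<Sum>m<(p + 1) div 2. (- 1) ^ m * int (p choose (2 * m)))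
     = 1 + (\<Sum>i<K. (- 1) ^ Suc i * rat_of_nat (p choose (2 * Suc i)))"
    unfolding K by (subst sum.lessThan_Suc_shift) simp
  also have "pcong 1 \<dots> (1 + (\<Sum>i<K. (- 1) ^ Suc i * 0))"
  proof (intro pcong_add pcong_refl pcong_sum pcong_mult_left)
    fix i assume "i \<in> {..<K}"
    then have "2 * Suc i < p" using K odd_p by (simp only: lessThan_iff) presburger
    then have "p dvd p choose (2 * Suc i)"
      using prime_p by (intro dvd_choose_prime) auto
    then show "pcong 1 (rat_of_nat (p choose (2 * Suc i))) 0"
      by (elim dvdE) (simp only: of_nat_mult One_nat_def, rule pcong_p_0, simp)
  qed auto
  finally show ?thesis by simp
qed

end

section \<open>The alternating sum of squares by perturbing Kummer's theorem\<close>

context prime_1_mod_4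
begin

lemma even_half: "even half"
  by (simp add: half_eq)

lemma minus_one_power_half [simp]: "(- 1 :: rat) ^ half = 1"
  by (simp add: half_eq power_mult)

text \<open>Minus the relative first-order change in \<open>p\<close> of the ratio of consecutive
  terms in Kummer's sum; see the ratio \<open>(P - a) * a / (b * (b + P))\<close> in
  \<open>kummer_term\<close>.\<close>

definition rho :: "nat \<Rightarrow> rat" where
  "rho i = 1 / (2 * of_nat i - 1) + 1 / (2 * of_nat i + 2)"

lemma rho_Zp: "i \<le> half \<Longrightarrow> rho i \<in> Zp"
  unfolding rho_def using p_half p_gt_2
  by (intro Zp_add Zp_divide Up_2k_minus_1 Up_2k_plus_2) auto

text \<open>Modulo \<open>p\<close> the substitution exchanges \<open>2 * i - 1\<close> with the
  negative of \<open>2 * i + 2\<close>. The partial sums \<open>Rho\<close> therefore become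
  symmetric.\<close>

lemma rho_reflect:
  assumes "i \<le> half"
  shows "pcong 1 (rho (half - i)) (- rho i)"
proof -
  define m where "m = half - i"
  have mi: "2 * rat_of_nat m = of_nat p - 1 - 2 * of_nat i"
  proof -
    have "half = m + i" using assms by (simp add: m_def)
    then have "rat_of_nat half = of_nat m + of_nat i" by (metis of_nat_add)
    then show ?thesis using p_eq by simp
  qed
  have m: "m \<le> half" by (simp add: m_def)
  have U: "2 * rat_of_nat m - 1 \<in> Up" "2 * rat_of_nat m + 2 \<in> Up" "2 * rat_of_nat i - 1 \<in> Up" "2 * rat_of_nat i + 2 \<in> Up"
    using m assms p_half p_gt_2 by (auto intro!: Up_2k_minus_1 Up_2k_plus_2)
  have c1: "pcong 1 (2 * of_nat m - 1) (- (2 * of_nat i + 2))"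
    by (rule pcongI[of _ _ _ 1]) (auto simp: mi)
  have c2: "pcong 1 (2 * of_nat m + 2) (- (2 * of_nat i - 1))"
    by (rule pcongI[of _ _ _ 1]) (auto simp: mi)
  have "pcong 1 (rho m) (1 / - (2 * of_nat i + 2) + 1 / - (2 * of_nat i - 1))"
    unfolding rho_def using U Up_uminus[OF U(3)] Up_uminus[OF U(4)]
    by (intro pcong_add pcong_divide c1 c2 pcong_refl) simp_all
  also have "1 / - (2 * of_nat i + 2) + 1 / - (2 * of_nat i - 1) = - rho i"
  proof -
    have "1 / - b + 1 / - a = - (1 / a + 1 / b)" for a b :: rat by simp
    then show ?thesis unfolding rho_def .
  qed
  finally show ?thesis by (simp only: m_def)
qed

definition Rho :: "nat \<Rightarrow> rat" where "Rho k = (\<Sum>i<k. rho i)"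

lemma Rho_Zp: "k \<le> Suc half \<Longrightarrow> Rho k \<in> Zp"
  unfolding Rho_def by (intro Zp_sum rho_Zp) auto

lemma Rho_Suc_half: "pcong 1 (Rho (Suc half)) 0"
proof -
  have "Rho (Suc half) = (\<Sum>i<Suc half. rho (half - i))"
    unfolding Rho_def by (subst sum.nat_diff_reindex[symmetric]) simp
  also have "pcong 1 \<dots> (\<Sum>i<Suc half. - rho i)"
    by (intro pcong_sum rho_reflect) auto
  also have "(\<Sum>i<Suc half. - rho i) = - Rho (Suc half)"
    by (simp only: Rho_def sum_negf)
  finally have "pcong 1 (Rho (Suc half) + Rho (Suc half)) (- Rho (Suc half) + Rho (Suc half))"
    by (intro pcong_add pcong_refl)
  then have "pcong 1 (2 * Rho (Suc half)) (2 * 0)" by simp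
  then show ?thesis by (rule pcong_cancel) (rule Up_2)
qed

lemma Rho_reflect: "k \<le> Suc half \<Longrightarrow> pcong 1 (Rho (Suc half - k)) (Rho k)"
proof (induction k)
  case 0
  then show ?case using Rho_Suc_half by (simp add: Rho_def)
next
  case (Suc k)
  then have "Suc half - k = Suc (half - k)" by simp
  then have "Rho (half - k) = Rho (Suc half - k) - rho (half - k)"
    by (simp add: Rho_def)
  moreover have "pcong 1 (Rho (Suc half - k) - rho (half - k)) (Rho k - - rho k)"
    using Suc by (intro pcong_diff rho_reflect) auto
  ultimately show ?case by (simp add: Rho_def)
qed

definition Vsum :: rat where "Vsum = (\<Sum>k\<le>Suc half. (- 1) ^ k * (dbin k)\<^sup>2)"

lemma dbin_Zp': "k \<le> Suc half \<Longrightarrow> dbin k \<in> Zp"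
  using p_half p_gt_2 by (intro dbin_Zp) linarith

lemma dbin_reflect': "k \<le> Suc half \<Longrightarrow> pcong 1 (dbin (Suc half - k)) (- dbin k)"
  using dbin_reflect[of k] by simp

lemma reverse_Suc_half:
  "(\<Sum>k\<le>Suc half. (- 1) ^ k * f (Suc half - k)) = - (\<Sum>k\<le>Suc half. (- 1) ^ k * f k)" for f :: "nat \<Rightarrow> rat"
  unfolding sum_negf[symmetric]
  by (rule sum.reindex_bij_witness[of _ "\<lambda>k. Suc half - k" "\<lambda>k. Suc half - k"])
     (use even_half in \<open>auto simp: minus_one_power_iff\<close>)

text \<open>The summand apart from its sign is symmetric modulo \<open>p\<close>, while reversal
  over an odd range changes the alternating sign, so the sum equals its own negative.\<close>

lemma sum_dbin_Rho: "pcong 1 (\<Sum>k\<le>Suc half. (- 1) ^ k * ((dbin k)\<^sup>2 * Rho k)) 0"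
proof -
  define J where "J = (\<Sum>k\<le>Suc half. (- 1) ^ k * ((dbin k)\<^sup>2 * Rho k))"
  have "pcong 1 (\<Sum>k\<le>Suc half. (- 1) ^ k * ((dbin (Suc half - k))\<^sup>2 * Rho (Suc half - k)))
     (\<Sum>k\<le>Suc half. (- 1) ^ k * ((- dbin k)\<^sup>2 * Rho k))"
    by (intro pcong_sum pcong_mult_left pcong_mult[of _ "(dbin _)\<^sup>2"] pcong_power dbin_reflect' Rho_reflect dbin_Zp' Rho_Zp Zp_power Zp_uminus)
       (auto intro!: dbin_Zp')
  then have "pcong 1 (- J) J"
    unfolding J_def reverse_Suc_half[of "\<lambda>k. (dbin k)\<^sup>2 * Rho k"] by simp
  then have "pcong 1 (J - - J) (J - J)" by (intro pcong_diff pcong_refl)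
  then have "pcong 1 (2 * J) (2 * 0)" by simp
  then show ?thesis unfolding J_def by (rule pcong_cancel) (rule Up_2)
qed

text \<open>Kummer's terms with \<open>a = - 1 / 2\<close> become exactly
  \<open>(- 1) ^ k * (dbin k)\<^sup>2\<close> if the upper parameter is formally 1/2. The actual
  value \<open>Suc half\<close> exceeds 1/2 by \<open>p / 2\<close>, and \<open>Rho\<close> records
  the linear effect.\<close>

lemma kummer_term:
  "k \<le> Suc half \<Longrightarrow> pcong 2 (of_nat (Suc half choose k) * pochhammer (- 1 / 2) k / pochhammer (1 / 2 + of_nat (Suc half)) k)
     ((- 1) ^ k * (dbin k)\<^sup>2 * (1 - of_nat p * Rho k))"
proof (induction k)
  case 0
  then show ?case by (simp add: Rho_def)
next
  case (Suc k)
  define P where "P = rat_of_nat p"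
  define a where "a = 2 * rat_of_nat k - 1"
  define b where "b = 2 * rat_of_nat k + 2"
  define u where "u k = rat_of_nat (Suc half choose k) * pochhammer (- 1 / 2) k / pochhammer (1 / 2 + of_nat (Suc half)) k" for k
  define v where "v k = (- 1) ^ k * (dbin k)\<^sup>2 * (1 - P * Rho k)" for k
  have k: "k \<le> half" using Suc.prems by simp
  have IH: "pcong 2 (u k) (v k)" using Suc by (simp only: u_def v_def P_def)
  have U: "a \<in> Up" "b \<in> Up"
    unfolding a_def b_def using k p_half p_gt_2 by (auto intro!: Up_2k_minus_1 Up_2k_plus_2)
  have bP: "b + P \<in> Up"
    using Up_pcong[of 0 b "b + P"] pcongI[of b "b + P" 1 "- 1"] U(2) by (simp add: P_def)
  have nz: "a \<noteq> 0" "b \<noteq> 0" "b + P \<noteq> 0" using U bP by (auto dest: UpD)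
  have M: "2 * rat_of_nat (Suc half) = P + 1" unfolding P_def p_eq by simp
  have ukrec: "u (Suc k) = u k * ((P - a) * a / (b * (b + P)))"
  proof -
    have "Suc k * (Suc half choose Suc k) = (Suc half - k) * (Suc half choose k)"
      by (rule Suc_times_choose_Suc)
    then have "rat_of_nat (Suc k * (Suc half choose Suc k)) = of_nat ((Suc half - k) * (Suc half choose k))"
      by (simp only:)
    then have "rat_of_nat (Suc k) * of_nat (Suc half choose Suc k) = (of_nat (Suc half) - of_nat k) * of_nat (Suc half choose k)"
      using k unfolding of_nat_mult by (simp only: of_nat_diff le_SucI)
    moreover have "rat_of_nat (Suc k) = b / 2" "of_nat (Suc half) - rat_of_nat k = (P - a) / 2"
      using M by (simp_all add: b_def a_def)
    ultimately have "b / 2 * of_nat (Suc half choose Suc k) = (P - a) / 2 * of_nat (Suc half choose k)"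
      by (simp only:)
    then have C: "of_nat (Suc half choose Suc k) = (P - a) / b * of_nat (Suc half choose k)"
      using nz by (simp add: field_simps del: binomial_Suc_Suc)
    have p1: "- 1 / 2 + rat_of_nat k = a / 2" by (simp add: a_def)
    have p2: "1 / 2 + rat_of_nat (Suc half) + rat_of_nat k = (b + P) / 2"
      using M by (simp add: b_def)
    show ?thesis
      unfolding u_def pochhammer_Suc C p1 p2 by (simp add: ac_simps)
  qed
  have "pcong 2 (u (Suc k)) (v k * ((P - a) * a / (b * (b + P))))"
    unfolding ukrec by (rule pcong_mult_right[OF IH]) (use U bP in \<open>auto simp: P_def UpD\<close>)
  also have "pcong 2 \<dots> (v (Suc k))"
  proof (rule pcongI)
    define D where "D = (- 1) ^ k * (dbin k)\<^sup>2"
    have Rk: "Rho (Suc k) = Rho k + (1 / a + 1 / b)"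
      by (simp add: Rho_def rho_def a_def b_def)
    have dk: "dbin (Suc k) = dbin k * a / b"
      using dbin_Suc_rec[of k] nz by (simp add: a_def b_def nonzero_eq_divide_eq)
    have 1: "v (Suc k) = D * (- (a\<^sup>2) / b\<^sup>2 * (1 - P * Rho k - P * (1 / a + 1 / b)))"
    proof -
      have "1 - P * (r + w) = 1 - P * r - P * w" for r w by (simp add: algebra_simps)
      moreover have "- 1 * s * (d * a / b)\<^sup>2 * t = s * d\<^sup>2 * (- (a\<^sup>2) / b\<^sup>2 * t)" for s d t
        by (simp add: power_divide power_mult_distrib)
      ultimately show ?thesis unfolding v_def D_def Rk dk power_Suc by (simp only:)
    qed
    have 2: "v k = D * (1 - P * Rho k)" by (simp add: v_def D_def)
    \<comment> \<open>First-order expansion in \<open>P\<close> with exact remainder, needed to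
      exhibit the factor \<open>P\<^sup>2\<close>.\<close>
    have core: "(P - a) / (b + P) = - (a / b) * (1 - P * (1 / a + 1 / b)) - P\<^sup>2 * ((a + b) / (b\<^sup>2 * (b + P)))"
      using nz by (simp add: divide_simps power2_eq_square) (simp add: algebra_simps)
    have "v k * ((P - a) * a / (b * (b + P))) - v (Suc k)
       = D * (a / b) * ((1 - P * Rho k) * ((P - a) / (b + P)) + a / b * (1 - P * Rho k - P * (1 / a + 1 / b)))"
    proof -
      have "D * T * (q * a / (b * w)) - D * (- (a\<^sup>2) / b\<^sup>2 * S) = D * (a / b) * (T * (q / w) + a / b * S)" for T S q w
        by (simp add: power2_eq_square distrib_left ac_simps)
      then show ?thesis unfolding 1 2 .
    qed
    also have "\<dots> = P\<^sup>2 * (D * (a / b) * (- (1 - P * Rho k) * ((a + b) / (b\<^sup>2 * (b + P))) - a / b * Rho k * (1 / a + 1 / b)))"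
    proof -
      have "D * c * ((1 - P * r) * (- c * (1 - P * w) - P\<^sup>2 * K) + c * (1 - P * r - P * w))
        = P\<^sup>2 * (D * c * (- (1 - P * r) * K - c * r * w))" for c r w K
        by (simp add: power2_eq_square algebra_simps)
      then show ?thesis unfolding core .
    qed
    finally show "v k * ((P - a) * a / (b * (b + P))) - v (Suc k)
       = of_nat p ^ 2 * (D * (a / b) * (- (1 - P * Rho k) * ((a + b) / (b\<^sup>2 * (b + P))) - a / b * Rho k * (1 / a + 1 / b)))"
      by (simp only: P_def)
    have "D \<in> Zp" unfolding D_def using k by (intro Zp_mult Zp_power dbin_Zp') auto
    moreover have "Rho k \<in> Zp" using k by (intro Rho_Zp) simp
    ultimately show "D * (a / b) * (- (1 - P * Rho k) * ((a + b) / (b\<^sup>2 * (b + P))) - a / b * Rho k * (1 / a + 1 / b)) \<in> Zp"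
      using U bP by (auto simp: P_def UpD intro!: Zp_mult Zp_diff Zp_add Zp_divide Zp_uminus Up_mult Up_power)
  qed
  finally show ?case by (simp only: u_def v_def P_def)
qed

text \<open>The linear perturbation vanishes by antisymmetry, so Kummer's closed form evaluates
  \<open>Vsum\<close> to precision \<open>p ^ 2\<close>.\<close>

lemma Vsum_kummer:
  "pcong 2 Vsum (pochhammer (1 / 2) (Suc half) / pochhammer (3 / 4) (Suc half))"
proof -
  have "pcong 2 (\<Sum>k\<le>Suc half. of_nat (Suc half choose k) * pochhammer (- 1 / 2) k / pochhammer (1 / 2 + of_nat (Suc half)) k)
     (\<Sum>k\<le>Suc half. (- 1) ^ k * (dbin k)\<^sup>2 * (1 - of_nat p * Rho k))"
    by (intro pcong_sum kummer_term) simp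
  also have "(\<Sum>k\<le>Suc half. (- 1) ^ k * (dbin k)\<^sup>2 * (1 - of_nat p * Rho k))
     = Vsum - of_nat p * (\<Sum>k\<le>Suc half. (- 1) ^ k * ((dbin k)\<^sup>2 * Rho k))"
    unfolding Vsum_def sum_distrib_left sum_subtractf[symmetric]
    by (intro sum.cong refl) (simp add: algebra_simps)
  also have "pcong 2 \<dots> (Vsum - of_nat p * 0)"
    by (intro pcong_diff pcong_refl pcong_p_mult_2 sum_dbin_Rho)
  finally have "pcong 2 (\<Sum>k\<le>Suc half. of_nat (Suc half choose k) * pochhammer (- 1 / 2) k / pochhammer (1 / 2 + of_nat (Suc half)) k) Vsum"
    by simp
  moreover have "(\<Sum>k\<le>Suc half. of_nat (Suc half choose k) * pochhammer (- 1 / 2) k / pochhammer (1 / 2 + of_nat (Suc half)) k)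
      = pochhammer (1 / 2) (Suc half) / pochhammer (3 / 4 :: rat) (Suc half)"
    using kummer_terminating[of "- 1 / 2" "Suc half"] by simp
  ultimately show ?thesis using pcong_sym by simp
qed

lemma pochhammer_half: "pochhammer (1 / 2) k = fact k * cbin k"
proof (induction k)
  case (Suc k)
  have "2 * rat_of_nat k + 2 = 2 * of_nat (Suc k)" by simp
  then have "cbin (Suc k) = cbin k * (2 * of_nat k + 1) / (2 * of_nat (Suc k))"
    unfolding cbin_Suc by (simp only:)
  then have "fact (Suc k) * cbin (Suc k) = fact k * cbin k * ((2 * of_nat k + 1) / 2)"
    by (simp del: of_nat_Suc)
  moreover have "(2 * of_nat k + 1) / 2 = 1 / 2 + rat_of_nat k" by simp
  ultimately show ?case unfolding pochhammer_Suc Suc by (simp only:)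
qed simp

text \<open>Modulo \<open>p\<close>, \<open>j\<close> is -1/4, so 3/4 is
  \<open>j + 1\<close>.\<close>

lemma pochhammer_three_quarters:
  "pcong 1 (pochhammer (3 / 4) (Suc half)) (fact (3 * j + 1) / fact j)"
proof -
  have "pcong 1 (\<Prod>i<Suc half. 3 / 4 + rat_of_nat i) (\<Prod>i<Suc half. rat_of_nat (j + 1 + i))"
  proof (rule pcong_prod)
    fix i
    show "pcong 1 (3 / 4 + rat_of_nat i) (rat_of_nat (j + 1 + i))"
      by (rule pcongI[of _ _ _ "- 1 / 4"]) (use Up_4 in \<open>auto simp: rat_of_nat_p field_simps\<close>)
    show "3 / 4 + rat_of_nat i \<in> Zp" using Up_4 by auto
  qed
  moreover have "(\<Prod>i<Suc half. rat_of_nat (j + 1 + i)) = fact (3 * j + 1) / fact j"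
  proof -
    have "3 * j + 1 = j + Suc half" by (simp add: half_eq)
    then show ?thesis by (simp only: fact_add_prod) simp
  qed
  moreover have "pochhammer (3 / 4) (Suc half) = (\<Prod>i<Suc half. 3 / 4 + rat_of_nat i)"
    by (simp add: pochhammer_prod lessThan_atLeast0)
  ultimately show ?thesis by (simp only:)
qed

lemma neg4_power_1: "pcong 1 ((- 4) ^ j) 1"
proof -
  have "pcong 1 ((- 4) ^ j) (1 + of_nat p * hj / 2)" by (rule pcong_mono[OF neg4_power]) simp
  also have "pcong 1 (1 + of_nat p * hj / 2) 1"
    by (rule pcongI[of _ _ _ "hj / 2"]) (use hj_Zp Up_2 in auto)
  finally show ?thesis .
qed

lemma cbin_j_Aj: "cbin j = (- 1) ^ j * Aj" "Aj = (- 1) ^ j * cbin j"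
  by (simp_all add: Aj_def minus_one_power_iff)

lemma Up_minus_one_power: "(- 1) ^ k \<in> Up"
  by auto

lemma Up_cbin_j: "cbin j \<in> Up"
  unfolding cbin_j_Aj(1) by (intro Up_mult Up_Aj Up_minus_one_power)

lemma cbin_j_pcong: "pcong 1 (cbin j) ((- 1) ^ j * cj)"
  unfolding cbin_j_Aj(1) by (intro pcong_mult_left Aj_pcong_1) simp

text \<open>The numerator of Kummer's value contains \<open>cbin (Suc half)\<close> and so one
  factor \<open>p\<close>; the rest is needed only modulo \<open>p\<close>, where Wilson's theorem
  applies.\<close>

lemma Vsum_pcong: "pcong 2 Vsum (2 * of_nat p / cbin j)"
proof -
  define M where "M = Suc half"
  have Mj: "M = 2 * j + 1" by (simp add: M_def half_eq)
  define B where "B = fact M * dbin M / pochhammer (3 / 4) M"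
  have Uf: "fact M \<in> Up" "fact (3 * j + 1) \<in> Up" "fact j \<in> Up" "fact (3 * j) \<in> Up" "fact (2 * j) \<in> Up"
    using j_pos by (auto simp only: Mj intro!: Up_fact less_p)
  have Upoch: "pochhammer (3 / 4) M \<in> Up"
  proof -
    have "fact (3 * j + 1) / fact j \<in> Up" using Uf by (intro Up_divide)
    then show ?thesis
      using Up_pcong[of 0] pcong_sym[OF pochhammer_three_quarters] unfolding M_def One_nat_def by blast
  qed
  have e: "pochhammer (1 / 2) M / pochhammer (3 / 4) M = of_nat p * B"
    unfolding pochhammer_half B_def unfolding M_def cbin_Suc_half by simp
  have dM: "pcong 1 (dbin M) 1"
    using dbin_Suc_half_pcong by (simp add: M_def)
  have dMZ: "dbin M \<in> Zp" unfolding M_def by (rule dbin_Zp') simp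
  have "pcong 1 B (fact M * 1 / (fact (3 * j + 1) / fact j))"
    unfolding B_def using Upoch Uf dMZ pochhammer_three_quarters
    by (intro pcong_divide pcong_mult pcong_refl dM) (auto simp: M_def UpD)
  also have "fact M * 1 / (fact (3 * j + 1) / fact j)
      = (2 * of_nat j + 1) / (3 * of_nat j + 1) * (fact (2 * j) * fact (2 * j)) / ((fact (3 * j) * fact j) * cj)"
  proof -
    have "fact M = (2 * rat_of_nat j + 1) * fact (2 * j)" "fact (3 * j + 1) = (3 * rat_of_nat j + 1) * fact (3 * j)"
      unfolding Mj by (simp_all add: add.commute)
    moreover have "(0::rat) < 3 * of_nat j + 1" by (simp add: add_nonneg_pos)
    ultimately show ?thesis by (simp add: cj_fact ac_simps)
  qed
  also have "pcong 1 \<dots> (2 * (- 1) / ((- 1) ^ (j + 1) * cj))"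
  proof -
    have w2: "pcong 1 (fact (2 * j) * fact (2 * j)) (- 1)"
      using pcong_fact_fact[of "2 * j"] less_p[of "2 * j"] unfolding p_minus_1 by simp
    have w3: "pcong 1 (fact (3 * j) * fact j) ((- 1) ^ (j + 1))"
      using pcong_fact_fact[of j] less_p[of j] unfolding p_minus_1 by simp
    have U3: "3 * rat_of_nat j + 1 \<in> Up"
      using Up_of_nat_less[of "3 * j + 1"] less_p[of "3 * j + 1"] j_pos by (simp add: add.commute)
    have r: "pcong 1 ((2 * of_nat j + 1) / (3 * of_nat j + 1)) 2"
    proof (rule pcongI)
      show "(2 * of_nat j + 1) / (3 * of_nat j + 1) - 2 = of_nat p ^ 1 * (- 1 / (3 * rat_of_nat j + 1))"
        using UpD(2)[OF U3] by (simp add: rat_of_nat_p field_simps)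
      show "- 1 / (3 * rat_of_nat j + 1) \<in> Zp" using U3 by (intro Zp_divide) auto
    qed
    have Z: "fact (2 * j) * fact (2 * j) \<in> Zp" using Uf by (auto simp: UpD)
    have Zr: "(2 * of_nat j + 1) / (3 * rat_of_nat j + 1) \<in> Zp"
      using pcong_Zp[OF r] by simp
    have Ud: "fact (3 * j) * fact j * cj \<in> Up" "(- 1) ^ (j + 1) * cj \<in> Up"
      using Uf Up_cj Up_minus_one_power[of "j + 1"] by (auto simp del: power_Suc intro!: Up_mult)
    show ?thesis
      by (intro pcong_divide pcong_mult[OF r w2] pcong_mult_right[OF w3] Ud Zp_mult Z Zr)
         (use Up_cj in \<open>auto simp: UpD\<close>)
  qed
  also have "2 * (- 1) / ((- 1) ^ (j + 1) * cj) = 2 / ((- 1) ^ j * cj)" by simp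
  also have "pcong 1 \<dots> (2 / cbin j)"
    by (intro pcong_divide pcong_refl pcong_sym[OF cbin_j_pcong] Up_cbin_j Up_mult Up_minus_one_power Up_cj) simp
  finally have "pcong 2 (of_nat p * B) (of_nat p * (2 / cbin j))" by (rule pcong_p_mult_2)
  then have "pcong 2 (pochhammer (1 / 2) M / pochhammer (3 / 4) M) (2 * of_nat p / cbin j)"
    unfolding e by (simp add: mult.commute)
  then show ?thesis using Vsum_kummer pcong_trans unfolding M_def by blast
qed

text \<open>Writing \<open>cbin k\<close> as \<open>(2 * k - 1) * dbin k\<close> turns the sum into
  weighted squares of \<open>dbin\<close>, which are averaged with their reversal.\<close>

lemma binom_sum_minus_16: "pcong 2 (binom_sum p (- 16)) (- (cbin j + of_nat p / cbin j))"
proof -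
  define T where "T = (\<Sum>k\<le>Suc half. (- 1) ^ k * (cbin k * dbin k))"
  have S: "pcong 2 (binom_sum p (- 16)) T"
    using binom_sum_pcong[of "- 16" 1] by (simp add: T_def ac_simps)
  have T1: "T = (\<Sum>k\<le>Suc half. (- 1) ^ k * ((2 * of_nat k - 1) * (dbin k)\<^sup>2))"
    unfolding T_def by (intro sum.cong refl) (simp add: cbin_dbin power2_eq_square)
  \<comment> \<open>Reversal turns the weight \<open>2 * k - 1\<close> into
    \<open>p - 2 * k\<close>, and the sign change over the odd range makes it
    \<open>2 * k - p\<close>.\<close>
  have T2: "T = (\<Sum>k\<le>Suc half. (- 1) ^ k * ((2 * of_nat k - of_nat p) * (dbin (Suc half - k))\<^sup>2))"
  proof -
    have "- T = (\<Sum>k\<le>Suc half. (- 1) ^ k * ((2 * of_nat (Suc half - k) - 1) * (dbin (Suc half - k))\<^sup>2))"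
      unfolding T1 reverse_Suc_half[of "\<lambda>k. (2 * of_nat k - 1) * (dbin k)\<^sup>2"] ..
    also have "\<dots> = - (\<Sum>k\<le>Suc half. (- 1) ^ k * ((2 * of_nat k - of_nat p) * (dbin (Suc half - k))\<^sup>2))"
      unfolding sum_negf[symmetric]
    proof (intro sum.cong refl)
      fix k assume "k \<in> {..Suc half}"
      then have "2 * rat_of_nat (Suc half - k) - 1 = - (2 * of_nat k - of_nat p)"
        unfolding p_eq by (simp add: of_nat_diff)
      then show "(- 1) ^ k * ((2 * of_nat (Suc half - k) - 1) * (dbin (Suc half - k))\<^sup>2)
        = - ((- 1) ^ k * ((2 * rat_of_nat k - of_nat p) * (dbin (Suc half - k))\<^sup>2))"
        by (simp only: mult_minus_left mult_minus_right)
    qed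
    finally show ?thesis by simp
  qed
  have V2: "(\<Sum>k\<le>Suc half. (- 1) ^ k * (dbin (Suc half - k))\<^sup>2) = - Vsum"
    unfolding Vsum_def by (rule reverse_Suc_half)
  have conv: "(\<Sum>k\<le>Suc half. (- 1) ^ k * ((2 * of_nat k - 1) * (dbin k * dbin (Suc half - k)))) = cbin j"
  proof -
    have "(\<Sum>k\<le>Suc half. (- 1) ^ k * (cbin (Suc half - k) * dbin (Suc half - (Suc half - k)))) = - cbin j"
    proof -
      have "(\<Sum>k\<le>Suc half. (- 1) ^ k * (cbin (Suc half - k) * dbin (Suc half - (Suc half - k))))
         = (\<Sum>k\<le>Suc half. (- 1) ^ k * dbin k * cbin (Suc half - k))"
        by (intro sum.cong refl) (simp add: ac_simps)
      also have "\<dots> = - cbin (Suc half div 2)" by (rule dbin_cbin_convolution_alternating)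
      also have "Suc half div 2 = j" by (simp add: half_eq)
      finally show ?thesis .
    qed
    then have "(\<Sum>k\<le>Suc half. (- 1) ^ k * (cbin k * dbin (Suc half - k))) = cbin j"
      unfolding reverse_Suc_half[of "\<lambda>k. cbin k * dbin (Suc half - k)"] by simp
    then show ?thesis by (simp add: cbin_dbin mult.assoc)
  qed
  \<comment> \<open>Completing the square with the common weight \<open>2 * k - 1\<close> leaves a
    square that vanishes modulo \<open>p ^ 2\<close>, a convolution, and the excess weight
    \<open>p - 1\<close>, which is paid for by \<open>Vsum\<close>.\<close>
  have "2 * T = T + T" by simp
  also have "\<dots> = (\<Sum>k\<le>Suc half. (- 1) ^ k * ((2 * of_nat k - 1) * (dbin k)\<^sup>2))
      + (\<Sum>k\<le>Suc half. (- 1) ^ k * ((2 * of_nat k - of_nat p) * (dbin (Suc half - k))\<^sup>2))"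
    using T1 T2 by simp
  also have "\<dots> = (\<Sum>k\<le>Suc half. (- 1) ^ k * ((2 * of_nat k - 1) * (dbin (Suc half - k) + dbin k)\<^sup>2))
      - 2 * (\<Sum>k\<le>Suc half. (- 1) ^ k * ((2 * of_nat k - 1) * (dbin k * dbin (Suc half - k))))
      - (of_nat p - 1) * (\<Sum>k\<le>Suc half. (- 1) ^ k * (dbin (Suc half - k))\<^sup>2)"
    unfolding sum_distrib_left sum.distrib[symmetric] sum_subtractf[symmetric]
    by (intro sum.cong refl) (simp add: power2_eq_square algebra_simps)
  also have "\<dots> = (\<Sum>k\<le>Suc half. (- 1) ^ k * ((2 * of_nat k - 1) * (dbin (Suc half - k) + dbin k)\<^sup>2))
      - 2 * cbin j - (of_nat p - 1) * - Vsum"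
    unfolding conv V2 ..
  also have "pcong 2 \<dots> ((\<Sum>k\<le>Suc half. 0) - 2 * cbin j - (of_nat p - 1) * - (2 * of_nat p / cbin j))"
  proof (intro pcong_diff pcong_refl pcong_sum)
    fix k assume "k \<in> {..Suc half}"
    then have "pcong 1 (dbin (Suc half - k) - - dbin k) 0"
      by (intro iffD1[OF pcong_0_iff dbin_reflect']) simp
    then have "pcong (1 + 1) ((dbin (Suc half - k) - - dbin k) * (dbin (Suc half - k) - - dbin k)) 0"
      by (intro pcong_mult_mult)
    then have "pcong 2 ((dbin (Suc half - k) + dbin k)\<^sup>2) 0"
      by (simp add: power2_eq_square numeral_2_eq_2)
    then have "pcong 2 ((- 1) ^ k * (2 * of_nat k - 1) * (dbin (Suc half - k) + dbin k)\<^sup>2) ((- 1) ^ k * (2 * of_nat k - 1) * 0)"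
      by (rule pcong_mult_left) auto
    then show "pcong 2 ((- 1) ^ k * ((2 * of_nat k - 1) * (dbin (Suc half - k) + dbin k)\<^sup>2)) 0"
      by (simp add: mult.assoc)
  next
    show "pcong 2 ((of_nat p - 1) * - Vsum) ((of_nat p - 1) * - (2 * of_nat p / cbin j))"
      by (rule pcong_mult_left[OF pcong_uminus[OF Vsum_pcong]]) auto
  qed
  also have "pcong 2 \<dots> (2 * (- (cbin j + of_nat p / cbin j)))"
    by (rule pcongI[of _ _ _ "2 / cbin j"])
       (use Up_cbin_j in \<open>auto simp: power2_eq_square algebra_simps add_divide_distrib diff_divide_distrib\<close>)
  finally have "pcong 2 T (- (cbin j + of_nat p / cbin j))"
    by (rule pcong_cancel) (rule Up_2)
  with S show ?thesis by (rule pcong_trans)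
qed

end

text \<open>The product of binomials is a multiple of the central one, and C(2k,k)/(2k-1) = 4
  C(2k-2,k-1) - C(2k,k) for positive \<open>k\<close>.\<close>

lemma leg_div_integer: "leg N k / (2 * of_nat k - 1) \<in> \<int>"
proof (cases k)
  case (Suc i)
  have "leg N k = of_nat ((N + k) choose (2 * k)) * of_nat ((2 * k) choose k)"
  proof (cases "k \<le> N")
    case True
    have "((N + k) choose (2 * k)) * ((2 * k) choose k) = ((N + k) choose k) * ((N + k - k) choose (2 * k - k))"
      using True by (intro choose_mult) auto
    then show ?thesis by (simp add: leg_def flip: of_nat_mult)
  qed (simp add: leg_eq_0)
  then have "leg N k / (2 * of_nat k - 1) = of_nat ((N + k) choose (2 * k)) * (4 ^ k * dbin k)"
    by (simp add: dbin_def cbin_def)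
  also have "4 ^ k * dbin k = 4 * of_nat ((2 * i) choose i) - of_nat ((2 * k) choose k)"
    unfolding Suc dbin_Suc_diff right_diff_distrib by (simp add: cbin_def)
  finally show ?thesis by (auto intro!: Ints_mult Ints_diff)
qed simp

lemma coeff_R_integer: "coeff (R N) i \<in> \<int>"
proof -
  have "coeff (R N) i = (\<Sum>k\<le>N. if k = i then leg N k / (2 * of_nat k - 1) else 0)"
    unfolding R_def coeff_sum by (intro sum.cong refl) (simp add: leg_def)
  also have "\<dots> \<in> \<int>"
    using leg_div_integer by (intro Ints_sum) auto
  finally show ?thesis .
qed

section \<open>The character of 2, boundary corrections, and reflection\<close>

context odd_prime_modulus
begin

lemma chi_2_power_half: "pcong 1 (2 ^ half) (of_int (chi 2))"
  using pcong_chi[of 2] by simp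

lemma chi_2_square: "chi 2 * chi 2 = 1"
  using p_gt_2 by (intro chi_square) (auto dest: zdvd_imp_le)

lemma chi_2_square_rat: "of_int (chi 2) * of_int (chi 2) = (1 :: rat)"
  by (simp only: of_int_mult[symmetric] chi_2_square of_int_1)

lemma chi_2_eq:
  assumes "pcong 1 ((- 1) ^ k * 2 ^ half) 1"
  shows "chi 2 = (- 1) ^ k"
proof -
  have "pcong 1 ((- 1) ^ k * ((- 1) ^ k * 2 ^ half)) ((- 1) ^ k * 1)"
    by (rule pcong_mult_left[OF assms]) simp
  moreover have "(- 1) ^ k * ((- 1) ^ k * 2 ^ half) = (2 ^ half :: rat)"
    by (simp add: minus_one_power_iff)
  ultimately have "pcong 1 (2 ^ half) ((- 1) ^ k)" by simp
  then have "pcong 1 (of_int (chi 2)) (of_int ((- 1) ^ k))"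
    using pcong_trans[OF pcong_sym[OF chi_2_power_half]] by simp
  then have "[chi 2 = (- 1) ^ k] (mod int p)" by (simp only: pcong_of_int_iff)
  then show ?thesis by (rule chi_unique) (simp add: minus_one_power_iff)
qed

lemma minus_half_Zp: "- (1 / 2) \<in> Zp" "- (- (1 / 2)) \<in> Zp"
  using Up_2 by auto

text \<open>The boundary term is \<open>p * 2 ^ Suc half\<close>, and Euler's criterion turns
  \<open>2 ^ half\<close> into the Legendre symbol. The value \<open>b\<close> certifies the
  integrality that \<open>rat_cong\<close> demands.\<close>

lemma R_minus_2:
  assumes "pcong 2 (binom_sum p 8) b" "b \<in> Zp"
  shows "rat_cong p 2 (poly (R half) (- 2) + 2 * of_nat p * of_int (chi 2)) (binom_sum p 8)"
proof -
  have "pcong 1 (2 * 2 ^ half) (2 * of_int (chi 2))"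
    by (rule pcong_mult_left[OF chi_2_power_half]) simp
  then have "pcong 2 (of_nat p * (2 * 2 ^ half)) (of_nat p * (2 * of_int (chi 2)))"
    by (rule pcong_p_mult_2)
  then have "pcong 2 (poly (R half) (- 2) + of_nat p * (2 * of_int (chi 2))) (poly (R half) (- 2) + of_nat p * (- (- 2)) ^ Suc half)"
    by (intro pcong_add pcong_refl) (simp add: pcong_sym)
  also have "pcong 2 \<dots> (binom_sum p 8)"
    by (rule poly_R_binom_sum) auto
  finally have "pcong 2 (poly (R half) (- 2) + 2 * of_nat p * of_int (chi 2)) (binom_sum p 8)"
    by (simp add: ac_simps)
  then show ?thesis using assms pcong_Zp by (intro rat_congI) auto
qed

lemma R_minus_half:
  assumes "pcong 2 (binom_sum p 32) b" "b \<in> Zp"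
  shows "rat_cong p 2 (poly (R half) (- (1 / 2)) + of_nat p / 2 * of_int (chi 2)) (binom_sum p 32)"
proof -
  have U: "of_int (chi 2) \<in> Up"
    using chi_cases[of 2] chi_2_square by auto
  have "pcong 1 (1 / (2 * 2 ^ half)) (1 / (2 * of_int (chi 2)))"
    by (intro pcong_divide pcong_refl pcong_mult_left chi_2_power_half Up_mult Up_2 Up_power U) auto
  also have "1 / (2 * of_int (chi 2)) = (of_int (chi 2) / 2 :: rat)"
    using chi_cases[of 2] chi_2_square by auto
  finally have "pcong 2 (of_nat p * (1 / (2 * 2 ^ half))) (of_nat p * (of_int (chi 2) / 2))"
    by (rule pcong_p_mult_2)
  then have "pcong 2 (poly (R half) (- (1 / 2)) + of_nat p * (of_int (chi 2) / 2)) (poly (R half) (- (1 / 2)) + of_nat p * (- (- (1 / 2))) ^ Suc half)"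
    by (intro pcong_add pcong_refl) (simp add: pcong_sym power_divide)
  also have "pcong 2 \<dots> (binom_sum p 32)"
    by (rule poly_R_binom_sum) (use minus_half_Zp in auto)
  finally have "pcong 2 (poly (R half) (- (1 / 2)) + of_nat p / 2 * of_int (chi 2)) (binom_sum p 32)"
    by (simp add: ac_simps)
  then show ?thesis using assms pcong_Zp by (intro rat_congI) auto
qed

text \<open>Reflection changes the weights 1, 2, 1 into 1, -2, 1, so that combination with the case
  \<open>- 16\<close> isolates \<open>legP half 1\<close>.\<close>

lemma binom_sum_8_legP:
  "pcong 2 (binom_sum p 8) ((- 1) ^ half * ((legP (half - 1) 1 - 2 * legP half 1 + legP (Suc half) 1) / 4))"
proof -
  have r: "legP N (- 2) = (- 1) ^ N * legP N 1" for N
    using legP_reflect[of N 1] by simp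
  obtain i where i: "half = Suc i" using p_half p_gt_2 by (cases half) auto
  have "pcong 2 (binom_sum p 8) (- (legP (half - 1) (- 2) + 2 * legP half (- 2) + legP (Suc half) (- 2)) / 4)"
    by (rule binom_sum_legP) auto
  also have "- (legP (half - 1) (- 2) + 2 * legP half (- 2) + legP (Suc half) (- 2)) / 4
     = (- 1) ^ half * ((legP (half - 1) 1 - 2 * legP half 1 + legP (Suc half) 1) / 4)"
    unfolding r i by (simp add: algebra_simps add_divide_distrib diff_divide_distrib)
  finally show ?thesis .
qed

lemma binom_sum_minus_16_legP:
  "pcong 2 (binom_sum p (- 16)) (- (legP (half - 1) 1 + 2 * legP half 1 + legP (Suc half) 1) / 4)"
  by (rule binom_sum_legP) auto

lemma binom_sum_32_legP:
  "pcong 2 (binom_sum p 32) (- (legP (half - 1) (- 1 / 2) + 2 * legP half (- 1 / 2) + legP (Suc half) (- 1 / 2)) / 4)"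
  by (rule binom_sum_legP) (use minus_half_Zp in auto)

end

section \<open>Conclusion for primes congruent to 1 modulo 4\<close>

context prime_1_mod_4
begin

lemma chi_2: "chi 2 = (- 1) ^ j"
proof (rule chi_2_eq)
  have "(- 1) ^ j * 2 ^ half = ((- 4) ^ j :: rat)"
    unfolding half_eq power_mult power_mult_distrib[symmetric] by simp
  then show "pcong 1 ((- 1) ^ j * 2 ^ half) 1" using neg4_power_1 by simp
qed

lemma of_int_chi_2: "of_int (chi 2) = ((- 1) ^ j :: rat)"
  by (simp add: chi_2)

lemma binom_sum_8: "pcong 2 (binom_sum p 8) (of_nat p / cbin j)"
proof -
  let ?D = "legP half 1"
  have "pcong 2 (binom_sum p 8 + binom_sum p (- 16))
    ((- 1) ^ half * ((legP (half - 1) 1 - 2 * ?D + legP (Suc half) 1) / 4) + - (legP (half - 1) 1 + 2 * ?D + legP (Suc half) 1) / 4)"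
    by (intro pcong_add binom_sum_8_legP binom_sum_minus_16_legP)
  also have "(- 1) ^ half * ((legP (half - 1) 1 - 2 * ?D + legP (Suc half) 1) / 4) + - (legP (half - 1) 1 + 2 * ?D + legP (Suc half) 1) / 4 = - ?D"
    by (simp add: field_simps)
  also have "pcong 2 (- ?D) (- cbin j)"
    using legP_half_1_even[OF even_half] by (intro pcong_uminus) (simp add: half_eq)
  finally have "pcong 2 (binom_sum p 8 + binom_sum p (- 16) - binom_sum p (- 16)) (- cbin j - - (cbin j + of_nat p / cbin j))"
    by (intro pcong_diff binom_sum_minus_16)
  then show ?thesis by simp
qed

text \<open>\<open>half\<close> is even, so both neighbouring Legendre polynomials have odd degree
  and vanish at 0.\<close>

lemma binom_sum_32: "pcong 2 (binom_sum p 32) (- Aj / 2)"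
proof -
  obtain i where i: "j = Suc i" using j_pos by (cases j) auto
  have "legP (half - 1) (- 1 / 2) = 0"
    using legP_minus_half[of i] unfolding half_eq i by simp
  moreover have "legP (Suc half) (- 1 / 2) = 0" "legP half (- 1 / 2) = Aj"
    using legP_minus_half[of j] unfolding half_eq by (simp_all add: Aj_def)
  ultimately show ?thesis using binom_sum_32_legP by simp
qed

lemma conclusion_1_mod_4:
  assumes "int p = x\<^sup>2 + y\<^sup>2" "[x = 1] (mod 4)" "even y"
  shows "rat_cong p 2 (poly (R half) 1 - of_nat p) (binom_sum p (- 16))"
    and "rat_cong p 2 (binom_sum p (- 16)) (- 2 * of_int (chi 2) * of_int x)"
    and "rat_cong p 2 (poly (R half) (- 2) + 2 * of_nat p * of_int (chi 2)) (binom_sum p 8)"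
    and "rat_cong p 2 (binom_sum p 8) (of_int (chi 2) * (of_nat p / (2 * of_int x)))"
    and "rat_cong p 2 (poly (R half) (- (1 / 2)) + of_nat p / 2 * of_int (chi 2)) (binom_sum p 32)"
    and "rat_cong p 2 (binom_sum p 32) (of_nat p / (4 * of_int x) - of_int x)"
proof -
  define X where "X = rat_of_int x"
  define P where "P = rat_of_nat p"
  have PZ: "P \<in> Zp" by (simp add: P_def)
  have x2: "pcong 2 (2 * X) (Aj + P / Aj)"
    unfolding X_def P_def using assms by (rule two_squares_pcong)
  have x1: "pcong 1 (2 * X) Aj"
  proof -
    have "pcong 1 (2 * X) (Aj + P / Aj)" by (rule pcong_mono[OF x2]) simp
    also have "pcong 1 (Aj + P / Aj) Aj"
      by (rule pcongI[of _ _ _ "1 / Aj"]) (use Up_Aj in \<open>auto simp: P_def\<close>)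
    finally show ?thesis .
  qed
  have Ux: "2 * X \<in> Up"
    using Up_pcong[of 0 Aj "2 * X"] pcong_sym[OF x1] Up_Aj by simp
  have XZ: "X \<in> Zp" by (simp add: X_def)
  have px: "pcong 2 (P / (2 * X)) (P / Aj)"
  proof -
    have "pcong 1 (1 / (2 * X)) (1 / Aj)"
      by (intro pcong_divide pcong_refl x1 Ux Up_Aj) auto
    then have "pcong 2 (of_nat p * (1 / (2 * X))) (of_nat p * (1 / Aj))" by (rule pcong_p_mult_2)
    then show ?thesis by (simp add: P_def)
  qed
  have s: "(- 1) ^ j * (- 1) ^ j = (1 :: rat)" by (simp add: minus_one_power_iff)
  have ec: "P / cbin j = (- 1) ^ j * (P / Aj)"
    unfolding cbin_j_Aj(1) by (simp add: minus_one_power_iff)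
  have Z16: "- 2 * of_int (chi 2) * of_int x \<in> Zp" by auto
  have c16: "pcong 2 (binom_sum p (- 16)) (- 2 * of_int (chi 2) * of_int x)"
  proof -
    have "pcong 2 (- ((- 1) ^ j) * (2 * X)) (- ((- 1) ^ j) * (Aj + P / Aj))"
      by (rule pcong_mult_left[OF x2]) auto
    moreover have "- ((- 1) ^ j) * (Aj + P / Aj) = - (cbin j + P / cbin j)"
      unfolding ec unfolding cbin_j_Aj(1) by (simp add: algebra_simps)
    moreover have "- 2 * of_int (chi 2) * of_int x = - ((- 1) ^ j) * (2 * X)"
      unfolding of_int_chi_2 X_def by simp
    ultimately have "pcong 2 (- 2 * of_int (chi 2) * of_int x) (- (cbin j + of_nat p / cbin j))"
      unfolding P_def by (simp only:)
    then show ?thesis by (rule pcong_trans[OF binom_sum_minus_16 pcong_sym])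
  qed
  show "rat_cong p 2 (binom_sum p (- 16)) (- 2 * of_int (chi 2) * of_int x)"
    by (rule rat_congI[OF c16 Z16])
  have "pcong 2 (poly (R half) 1 + of_nat p * (- 1) ^ Suc half) (binom_sum p (- 16))"
    by (rule poly_R_binom_sum) auto
  then have "pcong 2 (poly (R half) 1 - of_nat p) (binom_sum p (- 16))" by simp
  then show "rat_cong p 2 (poly (R half) 1 - of_nat p) (binom_sum p (- 16))"
    by (rule rat_congI) (use c16 Z16 pcong_Zp in blast)
  have Z8: "of_int (chi 2) * (of_nat p / (2 * of_int x)) \<in> Zp"
    using Ux by (auto simp: X_def)
  have c8: "pcong 2 (binom_sum p 8) (of_int (chi 2) * (of_nat p / (2 * of_int x)))"
  proof -
    have "pcong 2 ((- 1) ^ j * (P / (2 * X))) ((- 1) ^ j * (P / Aj))"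
      by (rule pcong_mult_left[OF px]) auto
    then have "pcong 2 (P / cbin j) ((- 1) ^ j * (P / (2 * X)))"
      unfolding ec by (rule pcong_sym)
    then have "pcong 2 (of_nat p / cbin j) (of_int (chi 2) * (of_nat p / (2 * of_int x)))"
      unfolding of_int_chi_2 X_def P_def .
    with binom_sum_8 show ?thesis by (rule pcong_trans)
  qed
  show "rat_cong p 2 (binom_sum p 8) (of_int (chi 2) * (of_nat p / (2 * of_int x)))"
    by (rule rat_congI[OF c8 Z8])
  show "rat_cong p 2 (poly (R half) (- 2) + 2 * of_nat p * of_int (chi 2)) (binom_sum p 8)"
    by (rule R_minus_2[OF c8 Z8])
  have Z32: "of_nat p / (4 * of_int x) - of_int x \<in> Zp"
  proof -
    have "P / (2 * X) / 2 - X \<in> Zp" using Ux Up_2 PZ XZ by (intro Zp_diff Zp_divide)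
    then show ?thesis by (simp add: P_def X_def)
  qed
  have c32: "pcong 2 (binom_sum p 32) (of_nat p / (4 * of_int x) - of_int x)"
  proof -
    \<comment> \<open>\<open>- Aj / 2\<close> is not directly a polynomial expression in
      \<open>x\<close>; adding and subtracting \<open>P / Aj\<close> makes both parts known in terms
      of \<open>x\<close>.\<close>
    have "pcong 2 (P / (2 * X) - 2 * X) (P / Aj - (Aj + P / Aj))"
      by (intro pcong_diff px x2)
    then have "pcong 2 ((P / (2 * X) - 2 * X) / 2) ((P / Aj - (Aj + P / Aj)) / 2)"
      by (intro pcong_divide pcong_refl Up_2) (use Ux PZ XZ in \<open>auto simp: UpD\<close>)
    moreover have "(P / (2 * X) - 2 * X) / 2 = of_nat p / (4 * of_int x) - of_int x"
      by (simp add: P_def X_def diff_divide_distrib)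
    ultimately have "pcong 2 (- Aj / 2) (of_nat p / (4 * of_int x) - of_int x)"
      using pcong_sym by simp
    with binom_sum_32 show ?thesis by (rule pcong_trans)
  qed
  show "rat_cong p 2 (binom_sum p 32) (of_nat p / (4 * of_int x) - of_int x)"
    by (rule rat_congI[OF c32 Z32])
  show "rat_cong p 2 (poly (R half) (- (1 / 2)) + of_nat p / 2 * of_int (chi 2)) (binom_sum p 32)"
    by (rule R_minus_half[OF c32 Z32])
qed

end

section \<open>Primes congruent to 3 modulo 4\<close>

locale prime_3_mod_4 = odd_prime_modulus +
  fixes j :: nat
  assumes p_4j3: "p = 4 * j + 3"
begin

lemma half_eq: "half = 2 * j + 1"
  using p_half p_4j3 by linarith

lemma two_power_half_1: "pcong 1 ((- 1) ^ Suc j * 2 ^ half) 1"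
proof -
  have "(p + 1) div 2 = 2 * j + 2" using p_4j3 by simp
  then have "pcong 1 (of_int (- 2 * (- 4) ^ j)) 1"
    using alternating_sum_pcong_1 by (simp only: sum_binomial_even_alternating_3[of j, folded p_4j3])
  moreover have "of_int (- 2 * (- 4) ^ j) = ((- 1) ^ Suc j * 2 ^ half :: rat)"
  proof -
    have "(- 4 :: rat) ^ j = (- 1) ^ j * 2 ^ (2 * j)"
      unfolding power_mult power_mult_distrib[symmetric] by simp
    then show ?thesis by (simp add: half_eq)
  qed
  ultimately show ?thesis by simp
qed

lemma chi_2: "chi 2 = (- 1) ^ Suc j"
  by (rule chi_2_eq) (rule two_power_half_1)

lemma four_power: "(4 :: rat) ^ Suc j = 2 * 2 ^ half"
proof -
  have "(4 :: rat) ^ Suc j = (2 ^ 2) ^ Suc j" by simp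
  also have "\<dots> = 2 ^ (2 * Suc j)" by (simp only: power_mult)
  also have "2 * Suc j = Suc half" by (simp add: half_eq)
  finally show ?thesis by simp
qed

abbreviation cc :: rat where "cc \<equiv> of_nat (((p + 1) div 2) choose ((p + 1) div 4))"

lemma cc_eq: "cc = 4 ^ Suc j * cbin (Suc j)"
proof -
  have "(p + 1) div 2 = 2 * Suc j" "(p + 1) div 4 = Suc j" using p_4j3 by simp_all
  then show ?thesis by (simp only: cbin_def) simp
qed

text \<open>Modulo \<open>p\<close> the boundary term is 0 and reflecting \<open>cbin\<close> turns
  the rest into the mixed convolution, with value \<open>cbin j\<close>.\<close>

lemma binom_sum_minus_16:
  "pcong 1 (binom_sum p (- 16)) (- (1 / 2) * of_int (chi 2) * cc)"
proof -
  have "pcong 1 (binom_sum p (- 16)) (\<Sum>k\<le>Suc half. cbin k * dbin k * (- 1) ^ k)"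
    by (rule pcong_mono[OF binom_sum_pcong]) auto
  also have "pcong 1 \<dots> ((\<Sum>k\<le>half. cbin k * dbin k * (- 1) ^ k) + of_nat p * (- 1) ^ Suc half)"
    by (rule pcong_mono[OF sum_Suc_half_pcong]) auto
  also have "pcong 1 \<dots> ((\<Sum>k\<le>half. - ((- 1) ^ k * dbin k * cbin (half - k))) + 0)"
  proof (intro pcong_add pcong_sum)
    fix k assume "k \<in> {..half}"
    then have k: "k \<le> half" by simp
    then have "pcong 1 (cbin (half - k)) (- cbin k)"
      using cbin_reflect[of k] by (simp add: half_eq power_mult)
    moreover have "dbin k \<in> Zp" using k p_half by (intro dbin_Zp) linarith
    ultimately have "pcong 1 (- ((- 1) ^ k * dbin k) * cbin (half - k)) (- ((- 1) ^ k * dbin k) * - cbin k)"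
      by (intro pcong_mult_left) auto
    then show "pcong 1 (cbin k * dbin k * (- 1) ^ k) (- ((- 1) ^ k * dbin k * cbin (half - k)))"
      by (intro pcong_sym[of _ "- ((- 1) ^ k * dbin k * cbin (half - k))"]) (simp add: ac_simps)
  next
    show "pcong 1 (of_nat p * (- 1) ^ Suc half) 0"
      unfolding One_nat_def by (rule pcong_p_0) (auto simp del: power_Suc)
  qed
  also have "(\<Sum>k\<le>half. - ((- 1) ^ k * dbin k * cbin (half - k))) + 0 = cbin j"
    unfolding sum_negf dbin_cbin_convolution_alternating by (simp add: half_eq)
  \<comment> \<open>The ratio \<open>(2 * j + 1) / (2 * j + 2)\<close> is -1 modulo
    \<open>p = 4 * j + 3\<close>.\<close>
  also have "pcong 1 (cbin j) (- cbin (Suc j))"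
  proof (rule pcongI)
    have "cbin j - - cbin (Suc j) = cbin j * (4 * of_nat j + 3) / (2 * of_nat j + 2)"
      using two_of_nat_plus_2_nonzero[of j] by (simp add: cbin_Suc field_simps)
    also have "4 * rat_of_nat j + 3 = of_nat p" by (subst p_4j3) simp
    finally show "cbin j - - cbin (Suc j) = of_nat p ^ 1 * (cbin j / (2 * of_nat j + 2))" by simp
    show "cbin j / (2 * of_nat j + 2) \<in> Zp"
      using p_4j3 by (intro Zp_divide cbin_Zp Up_2k_plus_2) linarith
  qed
  \<comment> \<open>\<open>cc\<close> carries the power \<open>4 ^ Suc j = 2 * 2 ^ half\<close>, and
    \<open>2 ^ half\<close> cancels against \<open>chi 2\<close> modulo \<open>p\<close>.\<close>
  also have "pcong 1 (- cbin (Suc j)) (- (1 / 2) * of_int (chi 2) * cc)"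
  proof -
    have "pcong 1 (- (of_int (chi 2) * cbin (Suc j)) * 2 ^ half) (- (of_int (chi 2) * cbin (Suc j)) * of_int (chi 2))"
      by (rule pcong_mult_left[OF chi_2_power_half]) auto
    moreover have "- (of_int (chi 2) * cbin (Suc j)) * of_int (chi 2) = - cbin (Suc j)"
    proof -
      have "- (c * y) * c = - (c * c * y)" for c y :: rat by (simp add: ac_simps)
      then show ?thesis by (simp only: chi_2_square_rat mult_1_left)
    qed
    moreover have "- (of_int (chi 2) * cbin (Suc j)) * 2 ^ half = - (1 / 2) * of_int (chi 2) * cc"
      unfolding cc_eq four_power by simp
    ultimately have "pcong 1 (- (1 / 2) * of_int (chi 2) * cc) (- cbin (Suc j))" by (simp only:)
    then show ?thesis by (rule pcong_sym)
  qed
  finally show ?thesis .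
qed

lemma binom_sum_8: "pcong 1 (binom_sum p 8) (- (1 / 2) * of_int (chi 2) * cc)"
proof -
  let ?D = "legP half 1"
  have "pcong 2 (binom_sum p 8 - binom_sum p (- 16))
    ((- 1) ^ half * ((legP (half - 1) 1 - 2 * ?D + legP (Suc half) 1) / 4) - - (legP (half - 1) 1 + 2 * ?D + legP (Suc half) 1) / 4)"
    by (intro pcong_diff binom_sum_8_legP binom_sum_minus_16_legP)
  also have "(- 1) ^ half * ((legP (half - 1) 1 - 2 * ?D + legP (Suc half) 1) / 4) - - (legP (half - 1) 1 + 2 * ?D + legP (Suc half) 1) / 4 = ?D"
  proof -
    have "(- 1 :: rat) ^ half = - 1" by (simp add: half_eq power_mult)
    then show ?thesis by (simp add: field_simps)
  qed
  finally have "pcong 1 (binom_sum p 8 - binom_sum p (- 16)) ?D"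
    by (rule pcong_mono) simp
  also have "pcong 1 ?D 0" by (rule legP_half_1_odd) (simp add: half_eq)
  finally have "pcong 1 (binom_sum p 8 - binom_sum p (- 16) + binom_sum p (- 16)) (0 + - (1 / 2) * of_int (chi 2) * cc)"
    by (intro pcong_add binom_sum_minus_16)
  then show ?thesis by simp
qed

text \<open>With \<open>u\<close> the number \<open>2 ^ half\<close> up to sign, normalised to be 1
  modulo \<open>p\<close>, one has \<open>2 ^ p + 2 = 2 * (u\<^sup>2 + 1)\<close>. Since
  \<open>(u - 1)\<^sup>2\<close> is 0 modulo \<open>p ^ 2\<close>, \<open>u\<^sup>2 + 1\<close> may
  be exchanged for \<open>2 * u\<close>; this accounts for the denominator.\<close>

lemma binom_sum_32:
  "pcong 2 (binom_sum p 32) (- ((of_nat p + 1) / (2 ^ p + 2)) * cc)"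
    "- ((of_nat p + 1) / (2 ^ p + 2)) * cc \<in> Zp"
proof -
  define P where "P = rat_of_nat p"
  define s :: rat where "s = (- 1) ^ Suc j"
  define u where "u = s * 2 ^ half"
  have ss: "s * s = 1" by (simp add: s_def minus_one_power_iff)
  have sZ: "s \<in> Zp" by (auto simp: s_def simp del: power_Suc)
  have u1: "pcong 1 u 1" unfolding u_def s_def by (rule two_power_half_1)
  have uZ: "u \<in> Zp" using pcong_Zp[OF u1] by simp
  have hu: "2 ^ half = s * u" by (simp add: u_def mult.assoc[symmetric] ss)
  have twop: "(2 :: rat) ^ p = 2 * u ^ 2"
  proof -
    have "(2 :: rat) ^ p = 2 * (2 ^ half * 2 ^ half)"
    proof -
      have "p = Suc (half + half)" using p_half by simp
      then have "(2 :: rat) ^ p = 2 ^ Suc (half + half)" by (rule arg_cong)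
      then show ?thesis by (simp only: power_Suc power_add)
    qed
    also have "2 ^ half * 2 ^ half = (s * s) * u ^ 2" unfolding hu power2_eq_square by (simp only: ac_simps)
    finally show ?thesis by (simp only: ss mult_1_left)
  qed
  have pj: "P = 4 * of_nat j + 3" unfolding P_def by (subst p_4j3) simp
  have Uu: "u\<^sup>2 + 1 \<in> Up"
  proof -
    have "pcong 1 (u\<^sup>2 + 1) (1\<^sup>2 + 1)" by (intro pcong_add pcong_power u1 uZ pcong_refl)
    then show ?thesis using Up_pcong[of 0 2 "u\<^sup>2 + 1"] pcong_sym Up_2 by simp
  qed
  have UP: "P - 1 \<in> Up"
    using Up_pcong[of 0 "- 1" "P - 1"] pcongI[of "- 1" "P - 1" 1 "- 1"] by (simp add: P_def)
  have e: "- ((of_nat p + 1) / (2 ^ p + 2)) * cc = s * cbin (Suc j) * (- (P + 1) * u / (u\<^sup>2 + 1))"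
  proof -
    have "- ((P + 1) / (2 * u\<^sup>2 + 2)) * (2 * (s * u) * c) = s * c * (- (P + 1) * u / (u\<^sup>2 + 1))" for c
    proof -
      have "2 * u\<^sup>2 + 2 = 2 * (u\<^sup>2 + 1)" by simp
      moreover have "- (q / (2 * v)) * (2 * (s * u) * c) = s * c * (- q * u / v)" for q v
        by (simp add: ac_simps)
      ultimately show ?thesis by (simp only:)
    qed
    then show ?thesis unfolding cc_eq four_power hu twop P_def by (simp only: mult.assoc)
  qed
  show Z: "- ((of_nat p + 1) / (2 ^ p + 2)) * cc \<in> Zp"
    unfolding e using sZ uZ Uu by (auto simp: P_def)
  \<comment> \<open>After that exchange the claim is \<open>(P - 1) * (P + 1) = - 1\<close> modulo
    \<open>p ^ 2\<close>.\<close>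
  have c: "pcong 2 (1 / (2 * (P - 1))) (- (P + 1) * u / (u\<^sup>2 + 1))"
  proof -
    have "pcong 1 (u - 1) 0" using u1 pcong_0_iff by blast
    then have "pcong (1 + 1) ((u - 1) * (u - 1)) 0" by (intro pcong_mult_mult)
    then have "pcong 2 ((u - 1) * (u - 1)) 0" by (simp add: numeral_2_eq_2)
    then obtain z where z: "z \<in> Zp" "(u - 1) * (u - 1) = of_nat p ^ 2 * z" by (auto simp: pcong_def)
    have nz: "P - 1 \<noteq> 0" "u\<^sup>2 + 1 \<noteq> 0" using UP Uu by (auto dest: UpD)
    show ?thesis
    proof (rule pcongI)
      have "1 / (2 * (P - 1)) - - (P + 1) * u / (u\<^sup>2 + 1)
         = ((u\<^sup>2 + 1) + 2 * (P - 1) * ((P + 1) * u)) / (2 * (P - 1) * (u\<^sup>2 + 1))"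
      proof -
        have *: "1 / a - - q * u / c = (c + a * (q * u)) / (a * c)" if "a \<noteq> 0" "c \<noteq> 0" for a c q
          using that by (simp add: field_simps)
        show ?thesis by (rule *) (use nz in simp_all)
      qed
      also have "(u\<^sup>2 + 1) + 2 * (P - 1) * ((P + 1) * u) = (u - 1) * (u - 1) + 2 * P\<^sup>2 * u"
        by (simp add: power2_eq_square algebra_simps)
      also have "\<dots> = P\<^sup>2 * (z + 2 * u)" unfolding z(2) P_def by (simp add: algebra_simps)
      finally show "1 / (2 * (P - 1)) - - (P + 1) * u / (u\<^sup>2 + 1)
         = of_nat p ^ 2 * ((z + 2 * u) / (2 * (P - 1) * (u\<^sup>2 + 1)))"
        by (simp add: P_def)
      show "(z + 2 * u) / (2 * (P - 1) * (u\<^sup>2 + 1)) \<in> Zp"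
        using z(1) uZ UP Uu Up_2 by (intro Zp_divide Up_mult Zp_add) auto
    qed
  qed
  have "- (legP (half - 1) (- 1 / 2) + 2 * legP half (- 1 / 2) + legP (Suc half) (- 1 / 2)) / 4
     = s * cbin (Suc j) * (1 / (2 * (P - 1)))"
  proof -
    have l: "legP (half - 1) (- 1 / 2) = - s * cbin j" "legP half (- 1 / 2) = 0" "legP (Suc half) (- 1 / 2) = s * cbin (Suc j)"
      using legP_minus_half[of j] legP_minus_half[of "Suc j"] unfolding half_eq by (simp_all add: s_def)
    \<comment> \<open>Here the neighbours have even degrees \<open>2 * j\<close> and
      \<open>2 * j + 2\<close>, with values of opposite sign at 0; their combination is a difference
      of consecutive \<open>cbin\<close>.\<close>
    have d: "cbin j - cbin (Suc j) = cbin (Suc j) / (2 * of_nat j + 1)"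
      using dbin_Suc_diff[of j] unfolding dbin_def by (simp add: add.commute)
    have h: "2 * rat_of_nat j + 1 = (P - 1) / 2" by (simp add: pj)
    have d': "cbin j - cbin (Suc j) = 2 * cbin (Suc j) / (P - 1)" unfolding d h by simp
    have "- (- s * cbin j + 2 * 0 + s * cbin (Suc j)) / 4 = s * (cbin j - cbin (Suc j)) / 4"
      by (simp add: algebra_simps)
    also have "\<dots> = s * (2 * cbin (Suc j) / (P - 1)) / 4" by (simp only: d')
    also have "\<dots> = s * cbin (Suc j) * (1 / (2 * (P - 1)))"
    proof -
      have "s * (2 * c / q) / 4 = s * c * (1 / (2 * q))" for c q by simp
      then show ?thesis .
    qed
    finally show ?thesis unfolding l .
  qed
  then have "pcong 2 (binom_sum p 32) (s * cbin (Suc j) * (1 / (2 * (P - 1))))"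
    using binom_sum_32_legP by (simp only:)
  also have "pcong 2 \<dots> (s * cbin (Suc j) * (- (P + 1) * u / (u\<^sup>2 + 1)))"
    using sZ by (intro pcong_mult_left[OF c]) auto
  finally show "pcong 2 (binom_sum p 32) (- ((of_nat p + 1) / (2 ^ p + 2)) * cc)" unfolding e .
qed

lemma conclusion_3_mod_4:
  "rat_cong p 1 (poly (R half) 1) (binom_sum p (- 16))"
  "rat_cong p 1 (binom_sum p (- 16)) (- (1 / 2) * of_int (chi 2) * cc)"
  "rat_cong p 1 (poly (R half) (- 2)) (binom_sum p 8)"
  "rat_cong p 1 (binom_sum p 8) (- (1 / 2) * of_int (chi 2) * cc)"
  "rat_cong p 2 (poly (R half) (- (1 / 2)) + of_nat p / 2 * of_int (chi 2)) (binom_sum p 32)"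
  "rat_cong p 2 (binom_sum p 32) (- ((of_nat p + 1) / (2 ^ p + 2)) * cc)"
proof -
  have Z: "- (1 / 2) * of_int (chi 2) * cc \<in> Zp"
    using minus_half_Zp by (intro Zp_mult) auto
  show "rat_cong p 1 (binom_sum p (- 16)) (- (1 / 2) * of_int (chi 2) * cc)"
    by (rule rat_congI[OF binom_sum_minus_16 Z])
  show "rat_cong p 1 (binom_sum p 8) (- (1 / 2) * of_int (chi 2) * cc)"
    by (rule rat_congI[OF binom_sum_8 Z])
  have R1: "pcong 1 (poly (R half) x) (binom_sum p m)" if "m \<noteq> 0" "- 16 / m = x" "x \<in> Zp" for m x
  proof -
    have "pcong 1 (of_nat p * (- x) ^ Suc half) 0"
      unfolding One_nat_def by (rule pcong_p_0) (use that in \<open>auto simp del: power_Suc\<close>)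
    then have "pcong 1 (poly (R half) x + 0) (poly (R half) x + of_nat p * (- x) ^ Suc half)"
      by (rule pcong_add[OF pcong_refl pcong_sym])
    also have "pcong 1 \<dots> (binom_sum p m)"
      by (rule pcong_mono[OF poly_R_binom_sum[OF that]]) simp
    finally show ?thesis by simp
  qed
  show "rat_cong p 1 (poly (R half) 1) (binom_sum p (- 16))"
    using R1[of "- 16" 1] pcong_Zp[OF binom_sum_minus_16] Z by (intro rat_congI) auto
  show "rat_cong p 1 (poly (R half) (- 2)) (binom_sum p 8)"
    using R1[of 8 "- 2"] pcong_Zp[OF binom_sum_8] Z by (intro rat_congI) auto
  show "rat_cong p 2 (binom_sum p 32) (- ((of_nat p + 1) / (2 ^ p + 2)) * cc)"
    by (rule rat_congI[OF binom_sum_32])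
  show "rat_cong p 2 (poly (R half) (- (1 / 2)) + of_nat p / 2 * of_int (chi 2)) (binom_sum p 32)"
    by (rule R_minus_half[OF binom_sum_32])
qed

end

theorem theorem1p1:
  fixes p :: nat
  assumes "prime p"
  shows
    "(\<forall>n i. coeff (R n) i \<in> \<int>) \<and>
     ([p = 1] (mod 4) \<longrightarrow>
       (\<forall>x y :: int. int p = x ^ 2 + y ^ 2 \<and> [x = 1] (mod 4) \<and> [y = 0] (mod 2) \<longrightarrow>
          rat_cong p 2 (poly (R ((p - 1) div 2)) 1 - of_nat p) (binom_sum p (-16)) \<and>
          rat_cong p 2 (binom_sum p (-16)) (- 2 * of_int (Legendre 2 (int p)) * of_int x) \<and>
          rat_cong p 2 (poly (R ((p - 1) div 2)) (-2) + 2 * of_nat p * of_int (Legendre 2 (int p)))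
            (binom_sum p 8) \<and>
          rat_cong p 2 (binom_sum p 8)
            (of_int (Legendre 2 (int p)) * (of_nat p / (2 * of_int x))) \<and>
          rat_cong p 2
            (poly (R ((p - 1) div 2)) (- (1 / 2)) + of_nat p / 2 * of_int (Legendre 2 (int p)))
            (binom_sum p 32) \<and>
          rat_cong p 2 (binom_sum p 32) (of_nat p / (4 * of_int x) - of_int x))) \<and>
     ([p = 3] (mod 4) \<longrightarrow>
          rat_cong p 1 (poly (R ((p - 1) div 2)) 1) (binom_sum p (-16)) \<and>
          rat_cong p 1 (binom_sum p (-16))
            (- (1 / 2) * of_int (Legendre 2 (int p)) *
              of_nat (((p + 1) div 2) choose ((p + 1) div 4))) \<and>
          rat_cong p 1 (poly (R ((p - 1) div 2)) (-2)) (binom_sum p 8) \<and>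
          rat_cong p 1 (binom_sum p 8)
            (- (1 / 2) * of_int (Legendre 2 (int p)) *
              of_nat (((p + 1) div 2) choose ((p + 1) div 4))) \<and>
          rat_cong p 2
            (poly (R ((p - 1) div 2)) (- (1 / 2)) + of_nat p / 2 * of_int (Legendre 2 (int p)))
            (binom_sum p 32) \<and>
          rat_cong p 2 (binom_sum p 32)
            (- ((of_nat p + 1) / (2 ^ p + 2)) *
              of_nat (((p + 1) div 2) choose ((p + 1) div 4))))"
proof (intro conjI allI impI)
  fix n i
  show "coeff (R n) i \<in> \<int>" by (rule coeff_R_integer)
next
  assume p: "[p = 1] (mod 4)"
  define j where "j = p div 4"
  have pj: "p = 4 * j + 1" using p by (simp add: j_def cong_def) presburger
  interpret prime_1_mod_4 p j
    by unfold_locales (use assms pj in auto)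
  fix x y :: int
  assume xy: "int p = x ^ 2 + y ^ 2 \<and> [x = 1] (mod 4) \<and> [y = 0] (mod 2)"
  then have "int p = x\<^sup>2 + y\<^sup>2" "[x = 1] (mod 4)" "even y" by (auto simp: cong_0_iff)
  note c = conclusion_1_mod_4[OF this, unfolded chi_def half_def]
  show "rat_cong p 2 (poly (R ((p - 1) div 2)) 1 - of_nat p) (binom_sum p (-16))" by (rule c)
  show "rat_cong p 2 (binom_sum p (-16)) (- 2 * of_int (Legendre 2 (int p)) * of_int x)" by (rule c)
  show "rat_cong p 2 (poly (R ((p - 1) div 2)) (-2) + 2 * of_nat p * of_int (Legendre 2 (int p)))
    (binom_sum p 8)" by (rule c)
  show "rat_cong p 2 (binom_sum p 8) (of_int (Legendre 2 (int p)) * (of_nat p / (2 * of_int x)))" by (rule c)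
  show "rat_cong p 2
    (poly (R ((p - 1) div 2)) (- (1 / 2)) + of_nat p / 2 * of_int (Legendre 2 (int p)))
    (binom_sum p 32)" by (rule c)
  show "rat_cong p 2 (binom_sum p 32) (of_nat p / (4 * of_int x) - of_int x)" by (rule c)
next
  assume p: "[p = 3] (mod 4)"
  define j where "j = p div 4"
  have pj: "p = 4 * j + 3" using p by (simp add: j_def cong_def) presburger
  interpret prime_3_mod_4 p j
    by unfold_locales (use assms pj in auto)
  note c = conclusion_3_mod_4[unfolded chi_def half_def]
  show "rat_cong p 1 (poly (R ((p - 1) div 2)) 1) (binom_sum p (-16))" by (rule c)
  show "rat_cong p 1 (binom_sum p (-16)) (- (1 / 2) * of_int (Legendre 2 (int p)) *
    of_nat (((p + 1) div 2) choose ((p + 1) div 4)))" by (rule c)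
  show "rat_cong p 1 (poly (R ((p - 1) div 2)) (-2)) (binom_sum p 8)" by (rule c)
  show "rat_cong p 1 (binom_sum p 8) (- (1 / 2) * of_int (Legendre 2 (int p)) *
    of_nat (((p + 1) div 2) choose ((p + 1) div 4)))" by (rule c)
  show "rat_cong p 2
    (poly (R ((p - 1) div 2)) (- (1 / 2)) + of_nat p / 2 * of_int (Legendre 2 (int p)))
    (binom_sum p 32)" by (rule c)
  show "rat_cong p 2 (binom_sum p 32) (- ((of_nat p + 1) / (2 ^ p + 2)) *
    of_nat (((p + 1) div 2) choose ((p + 1) div 4)))" by (rule c)
qed

end
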